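(* Let $D$ be a connected skew diagram with a ribbon staircase decomposition, that is, $D=(\varepsilon^k_m(\alpha),\mathcal N)_x$ for some ribbon $\alpha$, with $m<\ell(\alpha)$ and $x=se$ or $nw$. Then $D^t$ also has a ribbon staircase decomposition, specifically $$D^t=(\varepsilon^k_{m'}(\alpha^t),\mathcal N^{*})_x,\qquad m'=|\alpha\cap_m\alpha|-(m-1).$$ Furthermore, if $\alpha=\alpha^t$, then $m'=m$ and $D^t\sim D$.
   Context: Partitions are identified with Ferrers diagrams in English notation (row 1 on top); a skew diagram $D=\lambda/\mu$ is the set of cells of $\lambda$ not in $\mu\subseteq\lambda$, considered up to translation and insertion/removal of empty rows or columns. $D^t=\lambda^t/\mu^t$ is its conjugate (reflection across the northwest-to-southeast diagonal). $s_D=\sum_Tx^T$ over column-strict fillings of $D$ (rows weakly increasing, columns strictly increasing downward) is the skew Schur function; $D_1\sim D_2$ means $s_{D_1}=s_{D_2}$. $D$ is connected if it is not a disjoint union $D_1\oplus D_2$ (two proper subdiagrams, $D_2$ north and east of $D_1$, sharing no row or column). A ribbon is a connected nonempty skew diagram with no $2\times2$ block of cells; a composition $\alpha=(\alpha_1,\dots,\alpha_k)$ is identified with the ribbon with $\alpha_i$ cells in the $i$-th row from the bottom; $\ell(\alpha)=k$ is its number of rows and $|\alpha|$ its number of cells. The diagonal of cell $(i,j)$ is $j-i$. A nonempty ribbon $\omega$ protrudes from the top (resp. bottom) of a skew diagram $D$ if the restriction of $D$ to its $|\omega|$ northeasternmost (resp. southwesternmost) diagonals is $\omega$ and its restriction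 to its $|\omega|+1$ northeasternmost (resp. southwesternmost) diagonals is also a ribbon. If $\omega$ protrudes from the top of $D_1$ and the bottom of $D_2$, $D_1\amalg_\omega D_2$ is obtained by translating and identifying the copy of $\omega$ in the northeast of $D_1$ with the one in the southwest of $D_2$. For ribbons $\alpha=(\alpha_1,\dots,\alpha_k)$, $\beta=(\beta_1,\dots,\beta_\ell)$ and $m\ge1$, the $m$-intersection $\alpha\cap_m\beta$ exists if there is a ribbon $\omega=(\omega_1,\dots,\omega_m)$ with $m$ rows protruding from the top of $\alpha$ and the bottom of $\beta$ with $\omega_1=\beta_1$ and $\omega_m=\alpha_k$ (when $m=1$, instead $\omega_1:=\min\{\alpha_k,\beta_1\}$). Then $\alpha\cap_m\beta:=\omega$ and the $m$-union is $\alpha\cup_m\beta:=\alpha\amalg_\omega\beta$. The $m$-intersection is trivial if it equals $\alpha$ or $\beta$. If $\alpha\cap_m\alpha$ exists and is nontrivial, $\varepsilon^k_m(\alpha):=\alpha\cup_m\alpha\cup_m\cdots\cup_m\alpha$ ($k$ factors). The southeast decomposition of a connected skew diagram $D$: the first ribbon $\theta$ starts at the cell on the lower left, traverses the southeast border of $D$, and ends at the cell on the upper right; remove $\theta$ and iterate on each connected component of what remains. The northwest decomposition is defined in the same way with the northwest border. $D$ has a southeast ribbon staircase decomposition if there are a ribbon $\alpha$ and $m<\ell(\alpha)$ such that every ribbon in its southeast decomposition is of the form $\alpha\cap_m\alpha$ or $\varepsilon^p_m(\alpha)$ for various $p\ge1$. Let $k$ be the maximum $p$ occurring, so the largest ribbon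 is $\theta=\varepsilon^k_m(\alpha)$; number its $k$ copies of $\alpha$ by $1,\dots,k$ from southwest to northeast. The nesting $\mathcal N$ is the word of length $k-1$ in the letters dot, left parenthesis, right parenthesis, vertical slash determined by the remaining ribbons of the decomposition (those other than $\theta$): a ribbon of the form $\varepsilon^p_m(\alpha)$ occupying the same diagonals as the copies of $\alpha$ in $\theta$ numbered $i+1,\dots,j$ creates a left parenthesis in position $i$ and a right parenthesis in position $j$; a ribbon of the form $\alpha\cap_m\alpha$ occupying the same diagonals as the intersection of copies $i$ and $i+1$ creates a vertical slash in position $i$; all other letters are dots. One then writes $D=(\varepsilon^k_m(\alpha),\mathcal N)_{se}$. The notation $D=(\varepsilon^k_m(\alpha),\mathcal N)_{nw}$ is defined analogously with the northwest decomposition. The reverse nesting $\mathcal N^{*}$ is $\mathcal N$ read in reverse (mirror image, so that left and right parentheses are interchanged; e.g. $()\,.\,(|)$ becomes $(|)\,.\,()$).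
   Formalization: The claim on D^t is made unless the m lowest and m highest rows of α are all single cells and k≥2 or α is a column (there it fails, e.g. α=(1,2,1), m=1, k=2); each smaller ribbon must line up with copies of α in θ or with intersections of consecutive copies. *)

theory Defs
  imports Main "HOL-Library.FuncSet" "HOL-Library.Product_Plus"
begin

section \<open>Skew diagrams\<close>

text \<open>A cell is a pair (row, column), rows being numbered downwards and columns to the right.
  Diagrams are concrete finite sets of cells; identification up to translation is the relation
  \<open>same_shape\<close>. A connected diagram has no empty row or column between its cells, so for connected
  diagrams this is also the identification up to insertion and removal of empty rows and columns.\<close>

type_synonym cell = "int \<times> int"

definition is_partition :: "nat list \<Rightarrow> bool" where
  "is_partition \<nu> \<longleftrightarrow> sorted_wrt (\<ge>) \<nu>"

definition ferrers :: "nat list \<Rightarrow> cell set" where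
  "ferrers \<nu> = {(int i, int j) | i j. i < length \<nu> \<and> j < \<nu> ! i}"

definition skew_diagram :: "cell set \<Rightarrow> bool" where
  "skew_diagram D \<longleftrightarrow> (\<exists>\<nu> \<mu> v. is_partition \<nu> \<and> is_partition \<mu> \<and> ferrers \<mu> \<subseteq> ferrers \<nu> \<and>
     D = (+) v ` (ferrers \<nu> - ferrers \<mu>))"

definition same_shape :: "cell set \<Rightarrow> cell set \<Rightarrow> bool" where
  "same_shape D E \<longleftrightarrow> (\<exists>v. E = (+) v ` D)"

definition conj_diagram :: "cell set \<Rightarrow> cell set" where
  "conj_diagram D = prod.swap ` D"

definition strictly_north_east :: "cell set \<Rightarrow> cell set \<Rightarrow> bool" where
  "strictly_north_east B A \<longleftrightarrow> (\<forall>b\<in>B. \<forall>a\<in>A. fst b < fst a \<and> snd a < snd b)"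

definition diagram_connected :: "cell set \<Rightarrow> bool" where
  "diagram_connected D \<longleftrightarrow>
     \<not> (\<exists>D1 D2. D1 \<noteq> {} \<and> D2 \<noteq> {} \<and> D = D1 \<union> D2 \<and> strictly_north_east D2 D1)"

text \<open>\<open>C\<close> is a component if \<open>D = A \<oplus> C \<oplus> B\<close> with \<open>A\<close>, \<open>B\<close> possibly empty.\<close>

definition diagram_components :: "cell set \<Rightarrow> cell set set" where
  "diagram_components D = {C. C \<noteq> {} \<and> diagram_connected C \<and>
     (\<exists>A B. D = A \<union> C \<union> B \<and> strictly_north_east C A \<and> strictly_north_east B C)}"

section \<open>Skew Schur functions\<close>

definition column_strict_fillings :: "cell set \<Rightarrow> (cell \<Rightarrow> nat) set" where
  "column_strict_fillings D = {T \<in> D \<rightarrow>\<^sub>E {1..}.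
     (\<forall>i j j'. (i, j) \<in> D \<and> (i, j') \<in> D \<and> j < j' \<longrightarrow> T (i, j) \<le> T (i, j')) \<and>
     (\<forall>i i' j. (i, j) \<in> D \<and> (i', j) \<in> D \<and> i < i' \<longrightarrow> T (i, j) < T (i', j))}"

text \<open>The formal power series in \<open>x\<^sub>1, x\<^sub>2, \<dots>\<close> is given by its coefficient function:
  \<open>skew_schur D w\<close> is the coefficient of the monomial with exponent \<open>w i\<close> at \<open>x\<^sub>i\<close>,
  i.e. the number of fillings in which each \<open>i\<close> occurs \<open>w i\<close> times. For finite \<open>D\<close> only finitely
  many fillings have a given content, so the cardinality is a genuine one.\<close>

definition skew_schur :: "cell set \<Rightarrow> (nat \<Rightarrow> nat) \<Rightarrow> nat" where
  "skew_schur D w = card {T \<in> column_strict_fillings D. \<forall>i. card {c \<in> D. T c = i} = w i}"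

definition skew_equiv :: "cell set \<Rightarrow> cell set \<Rightarrow> bool" where
  "skew_equiv D1 D2 \<longleftrightarrow> skew_schur D1 = skew_schur D2"

section \<open>Ribbons, intersections and unions\<close>

definition is_ribbon :: "cell set \<Rightarrow> bool" where
  "is_ribbon \<alpha> \<longleftrightarrow> skew_diagram \<alpha> \<and> diagram_connected \<alpha> \<and> \<alpha> \<noteq> {} \<and>
     \<not> (\<exists>i j. {(i, j), (i + 1, j), (i, j + 1), (i + 1, j + 1)} \<subseteq> \<alpha>)"

definition num_rows :: "cell set \<Rightarrow> nat" where
  "num_rows \<alpha> = card (fst ` \<alpha>)"

definition num_cols :: "cell set \<Rightarrow> nat" where
  "num_cols \<alpha> = card (snd ` \<alpha>)"

text \<open>Rows of a ribbon are numbered \<open>1, \<dots>, num_rows \<alpha>\<close> from the bottom, so \<open>row_len \<alpha> i\<close> is the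
  \<open>i\<close>-th part of the composition corresponding to \<open>\<alpha>\<close>.\<close>

definition row_len :: "cell set \<Rightarrow> nat \<Rightarrow> nat" where
  "row_len \<alpha> i = card {c \<in> \<alpha>. fst c = Max (fst ` \<alpha>) + 1 - int i}"

definition diag_of :: "cell \<Rightarrow> int" where
  "diag_of c = snd c - fst c"

text \<open>Restriction to the \<open>n\<close> northeasternmost (southwesternmost) nonempty diagonals; all of \<open>D\<close> if
  there are at most \<open>n\<close> of them.\<close>

definition ne_restrict :: "nat \<Rightarrow> cell set \<Rightarrow> cell set" where
  "ne_restrict n D = {c \<in> D. card {d \<in> diag_of ` D. diag_of c < d} < n}"

definition sw_restrict :: "nat \<Rightarrow> cell set \<Rightarrow> cell set" where
  "sw_restrict n D = {c \<in> D. card {d \<in> diag_of ` D. d < diag_of c} < n}"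

definition protrudes_top :: "cell set \<Rightarrow> cell set \<Rightarrow> bool" where
  "protrudes_top \<omega> D \<longleftrightarrow> is_ribbon \<omega> \<and> same_shape (ne_restrict (card \<omega>) D) \<omega> \<and>
     is_ribbon (ne_restrict (card \<omega> + 1) D)"

definition protrudes_bottom :: "cell set \<Rightarrow> cell set \<Rightarrow> bool" where
  "protrudes_bottom \<omega> D \<longleftrightarrow> is_ribbon \<omega> \<and> same_shape (sw_restrict (card \<omega>) D) \<omega> \<and>
     is_ribbon (sw_restrict (card \<omega> + 1) D)"

text \<open>\<open>amalgamate \<omega> D1 D2\<close> is meaningful if \<open>\<omega>\<close> protrudes from the top of \<open>D1\<close> and the bottom of
  \<open>D2\<close>; then the translation is unique. \<open>D1\<close> stays in place.\<close>

definition amalgamate :: "cell set \<Rightarrow> cell set \<Rightarrow> cell set \<Rightarrow> cell set" where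
  "amalgamate \<omega> D1 D2 = D1 \<union>
     (+) (THE v. (+) v ` sw_restrict (card \<omega>) D2 = ne_restrict (card \<omega>) D1) ` D2"

definition is_m_cap :: "nat \<Rightarrow> cell set \<Rightarrow> cell set \<Rightarrow> cell set \<Rightarrow> bool" where
  "is_m_cap m \<alpha> \<beta> \<omega> \<longleftrightarrow> 1 \<le> m \<and> is_ribbon \<omega> \<and> num_rows \<omega> = m \<and>
     protrudes_top \<omega> \<alpha> \<and> protrudes_bottom \<omega> \<beta> \<and>
     (if m = 1 then row_len \<omega> 1 = min (row_len \<alpha> (num_rows \<alpha>)) (row_len \<beta> 1)
      else row_len \<omega> 1 = row_len \<beta> 1 \<and> row_len \<omega> m = row_len \<alpha> (num_rows \<alpha>))"

text \<open>The ribbon \<open>\<omega>\<close> is unique up to translation; \<open>m_cap\<close> picks an arbitrary representative.\<close>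

definition m_cap :: "nat \<Rightarrow> cell set \<Rightarrow> cell set \<Rightarrow> cell set" where
  "m_cap m \<alpha> \<beta> = (SOME \<omega>. is_m_cap m \<alpha> \<beta> \<omega>)"

definition m_cup :: "nat \<Rightarrow> cell set \<Rightarrow> cell set \<Rightarrow> cell set" where
  "m_cup m \<alpha> \<beta> = amalgamate (m_cap m \<alpha> \<beta>) \<alpha> \<beta>"

definition m_cap_nontrivial :: "nat \<Rightarrow> cell set \<Rightarrow> cell set \<Rightarrow> bool" where
  "m_cap_nontrivial m \<alpha> \<beta> \<longleftrightarrow> (\<exists>\<omega>. is_m_cap m \<alpha> \<beta> \<omega>) \<and>
     \<not> same_shape (m_cap m \<alpha> \<beta>) \<alpha> \<and> \<not> same_shape (m_cap m \<alpha> \<beta>) \<beta>"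

text \<open>\<open>staircase_power m \<alpha> k\<close> is \<open>\<alpha> \<union>\<^sub>m \<cdots> \<union>\<^sub>m \<alpha>\<close> with \<open>k \<ge> 1\<close> factors (the value at \<open>0\<close> is a dummy).\<close>

fun staircase_power :: "nat \<Rightarrow> cell set \<Rightarrow> nat \<Rightarrow> cell set" where
  "staircase_power m \<alpha> 0 = {}"
| "staircase_power m \<alpha> (Suc 0) = \<alpha>"
| "staircase_power m \<alpha> (Suc (Suc k)) = m_cup m (staircase_power m \<alpha> (Suc k)) \<alpha>"

section \<open>Ribbon decompositions\<close>

datatype side = SE | NW

text \<open>The ribbon along the southeast (northwest) border of a connected skew diagram, from its lower
  left cell to its upper right cell, consists of the cells having no diagonal successor
  (predecessor) in the diagram.\<close>

fun border_ribbon :: "side \<Rightarrow> cell set \<Rightarrow> cell set" where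
  "border_ribbon SE D = {(i, j). (i, j) \<in> D \<and> (i + 1, j + 1) \<notin> D}"
| "border_ribbon NW D = {(i, j). (i, j) \<in> D \<and> (i - 1, j - 1) \<notin> D}"

inductive in_decomposition :: "side \<Rightarrow> cell set \<Rightarrow> cell set \<Rightarrow> bool" for x :: side where
  first: "D \<noteq> {} \<Longrightarrow> in_decomposition x D (border_ribbon x D)"
| later: "C \<in> diagram_components (D - border_ribbon x D) \<Longrightarrow> in_decomposition x C R \<Longrightarrow>
    in_decomposition x D R"

definition ribbon_decomposition :: "side \<Rightarrow> cell set \<Rightarrow> cell set set" where
  "ribbon_decomposition x D = {R. in_decomposition x D R}"

section \<open>Ribbon staircase decompositions\<close>

datatype nesting_letter = Dot | LParen | RParen | Bar

text \<open>The diagonals occupied by the \<open>i\<close>-th copy of \<open>\<alpha>\<close> (numbered from \<open>1\<close>, southwest to northeast) in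
  a copy \<open>\<theta>\<close> of \<open>staircase_power m \<alpha> k\<close>: consecutive copies share the diagonals of their
  intersection, so each copy starts \<open>card \<alpha> - card (m_cap m \<alpha> \<alpha>)\<close> diagonals after the previous one.\<close>

definition copy_diags :: "nat \<Rightarrow> cell set \<Rightarrow> cell set \<Rightarrow> nat \<Rightarrow> int set" where
  "copy_diags m \<alpha> \<theta> i =
     (let start = Min (diag_of ` \<theta>) + (int i - 1) * (int (card \<alpha>) - int (card (m_cap m \<alpha> \<alpha>)))
      in {start ..< start + int (card \<alpha>)})"

definition parenthesised :: "nat \<Rightarrow> cell set \<Rightarrow> cell set \<Rightarrow> cell set \<Rightarrow> nat \<Rightarrow> nat \<Rightarrow> bool" where
  "parenthesised m \<alpha> \<theta> R i j \<longleftrightarrow> i < j \<and> same_shape R (staircase_power m \<alpha> (j - i)) \<and>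
     diag_of ` R = (\<Union>l\<in>{i + 1..j}. copy_diags m \<alpha> \<theta> l)"

definition slashed :: "nat \<Rightarrow> cell set \<Rightarrow> cell set \<Rightarrow> cell set \<Rightarrow> nat \<Rightarrow> bool" where
  "slashed m \<alpha> \<theta> R i \<longleftrightarrow> same_shape R (m_cap m \<alpha> \<alpha>) \<and>
     diag_of ` R = copy_diags m \<alpha> \<theta> i \<inter> copy_diags m \<alpha> \<theta> (i + 1)"

definition letter_at :: "nat \<Rightarrow> cell set \<Rightarrow> cell set \<Rightarrow> cell set set \<Rightarrow> nat \<Rightarrow> nesting_letter" where
  "letter_at m \<alpha> \<theta> \<R> i =
     (if \<exists>R\<in>\<R>. \<exists>j. parenthesised m \<alpha> \<theta> R i j then LParen
      else if \<exists>R\<in>\<R>. \<exists>j. parenthesised m \<alpha> \<theta> R j i then RParen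
      else if \<exists>R\<in>\<R>. slashed m \<alpha> \<theta> R i then Bar
      else Dot)"

text \<open>\<open>staircase_decomposition x D m \<alpha> k N\<close> is \<open>D = (\<epsilon>\<^sub>m\<^sup>k(\<alpha>), N)\<^sub>x\<close>. Every ribbon other than the first
  one has to be lined up with the copies of \<open>\<alpha>\<close> (or their intersections) in the first one: the
  notation presupposes that each of them contributes to \<open>N\<close>, so that \<open>D\<close> is determined by the
  right-hand side.\<close>

definition staircase_decomposition ::
    "side \<Rightarrow> cell set \<Rightarrow> nat \<Rightarrow> cell set \<Rightarrow> nat \<Rightarrow> nesting_letter list \<Rightarrow> bool" where
  "staircase_decomposition x D m \<alpha> k N \<longleftrightarrow>
     is_ribbon \<alpha> \<and> 1 \<le> m \<and> m < num_rows \<alpha> \<and> m_cap_nontrivial m \<alpha> \<alpha> \<and>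
     (\<forall>R\<in>ribbon_decomposition x D.
        same_shape R (m_cap m \<alpha> \<alpha>) \<or> (\<exists>p\<ge>1. same_shape R (staircase_power m \<alpha> p))) \<and>
     (let \<theta> = border_ribbon x D; \<R> = ribbon_decomposition x D - {\<theta>} in
        1 \<le> k \<and> same_shape \<theta> (staircase_power m \<alpha> k) \<and>
        (\<forall>R\<in>ribbon_decomposition x D. \<forall>p\<ge>1. same_shape R (staircase_power m \<alpha> p) \<longrightarrow> p \<le> k) \<and>
        (\<forall>R\<in>\<R>. (\<exists>i j. 1 \<le> i \<and> j < k \<and> parenthesised m \<alpha> \<theta> R i j) \<or>
                (\<exists>i. 1 \<le> i \<and> i < k \<and> slashed m \<alpha> \<theta> R i)) \<and>
        N = map (letter_at m \<alpha> \<theta> \<R>) [1..<k])"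

fun mirror_letter :: "nesting_letter \<Rightarrow> nesting_letter" where
  "mirror_letter LParen = RParen"
| "mirror_letter RParen = LParen"
| "mirror_letter Dot = Dot"
| "mirror_letter Bar = Bar"

definition reverse_nesting :: "nesting_letter list \<Rightarrow> nesting_letter list" where
  "reverse_nesting N = rev (map mirror_letter N)"

text \<open>If the \<open>m\<close> lowest and the \<open>m\<close> highest rows of \<open>\<alpha>\<close> all consist of a single cell, then
  \<open>\<alpha> \<inter>\<^sub>m \<alpha>\<close> is a column of \<open>m\<close> cells, whereas both end columns of \<open>\<alpha>\<close> are longer than \<open>m\<close>, so that the
  1-intersection of the conjugate of \<open>\<alpha>\<close> with itself (whose length is the minimum of the two end
  rows) is not the conjugate of \<open>\<alpha> \<inter>\<^sub>m \<alpha>\<close>. For \<open>k \<ge> 2\<close> the conjugate of \<open>\<epsilon>\<^sub>m\<^sup>k(\<alpha>)\<close> is then not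
  \<open>\<epsilon>\<^sub>1\<^sup>k\<close> of the conjugate of \<open>\<alpha>\<close>. Example: \<open>m = 1\<close>, \<open>k = 2\<close>, \<open>\<alpha> = (1,2,1)\<close>, where \<open>\<epsilon>\<^sub>1\<^sup>2(1,2,1) = (1,2,1,2,1)\<close>
  has conjugate \<open>(2,3,2)\<close>, but \<open>(1,2,1)\<close> has conjugate \<open>(2,2)\<close> and \<open>\<epsilon>\<^sub>1\<^sup>2(2,2) = (2,2,2)\<close>.
  For \<open>k = 1\<close> the intersection is irrelevant unless \<open>\<alpha>\<close> is a column; then its conjugate has
  only one row and hence admits no \<open>m' < 1\<close>.\<close>

definition degenerate_ends :: "nat \<Rightarrow> nat \<Rightarrow> cell set \<Rightarrow> bool" where
  "degenerate_ends m k \<alpha> \<longleftrightarrow>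
     (\<forall>i\<in>{1..m}. row_len \<alpha> i = 1 \<and> row_len \<alpha> (num_rows \<alpha> + 1 - i) = 1) \<and>
     (k = 1 \<longrightarrow> num_cols \<alpha> = 1)"

end

theory Submission
  imports Defs "HOL-Library.Poly_Mapping" "Jordan_Normal_Form.Determinant"
begin

text \<open>A ribbon is a start cell together with a word of right and up steps. Conjugation reverses the word and
  exchanges the two letters; the intersection of \<open>\<alpha>\<close> with itself is a word \<open>w\<close> that is both a prefix and a
  suffix, \<open>u = w z = y w\<close>, and the staircase powers are \<open>w z\<^sup>k = y\<^sup>k w\<close>, so conjugation exchanges the
  roles of \<open>y\<close> and \<open>z\<close>. The ribbons of a decomposition occupy nested or disjoint intervals of diagonals without
  common end points, hence no two of them compete for the same letter of the nesting, and the nesting is reversed.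

  For the equality of skew Schur functions, a filling of \<open>D\<close> is read diagonal by diagonal: the entries on one diagonal
  form a strictly decreasing sequence interlacing with the next one. Interlacing is a column operation on determinants, so
  summing over all fillings gives the determinant of Hamel and Goulden whose entries are the generating functions of the
  segments of the border ribbon from the start of one ribbon of the decomposition to the end of another one. The conjugate
  diagram gives the same determinant with strict and weak inequalities exchanged, that is, with the conjugate segments.
  If \<open>\<alpha>\<close> is self-conjugate then so are all these segments, by the periodicity of \<open>w z\<^sup>k\<close>. The northwest case
  reduces to the southeast case by a rotation.\<close>

section \<open>Order-convex diagrams\<close>

text \<open>The obstacle in the first claim is the convention for one-row intersections, whose
  length is the minimum of two end rows: if \<open>w\<close> is a column, its conjugate is a row
  that need not have this length. Excluding \<open>degenerate_ends\<close> prevents this for k >= 2;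
  for k = 1 no intersection is visible in \<open>D\<close>, and another one may be chosen for the
  conjugate. In the second claim weak and strict rows are both described by a family of sets
  \<open>L b\<close>, so the determinant is computed once for an abstract \<open>L\<close>. It never
  refers to individual ribbons: starts and ends are jumps of the number of cells per diagonal, and
  every start is combined with every later end. Hence self-conjugacy is needed also for segments
  joining different ribbons, including those shorter than \<alpha>, and there the period of
  \<open>w\<close> within itself is decisive. Signs need no interpretation, as they agree for
  \<open>D\<close> and its conjugate. Generating functions are compared for arbitrary values
  \<open>x\<close> of the variables, because the half turn permutes the variables.\<close>

definition order_convex :: "cell set \<Rightarrow> bool" where
  "order_convex D \<longleftrightarrow> (\<forall>i j i' j' a b. (i, j) \<in> D \<and> (i', j') \<in> D \<and> i \<le> a \<and> a \<le> i' \<and> j \<le> b \<and> b \<le> j' \<longrightarrow> (a, b) \<in> D)"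

lemma order_convexD:
  "order_convex D \<Longrightarrow> (i, j) \<in> D \<Longrightarrow> (i', j') \<in> D \<Longrightarrow> i \<le> a \<Longrightarrow> a \<le> i' \<Longrightarrow> j \<le> b \<Longrightarrow> b \<le> j' \<Longrightarrow> (a, b) \<in> D"
  unfolding order_convex_def by blast

lemma finite_ferrers: "finite (ferrers \<nu>)"
proof -
  have "ferrers \<nu> \<subseteq> (\<lambda>(i, j). (int i, int j)) ` (SIGMA i:{..<length \<nu>}. {..<\<nu> ! i})"
    by (auto simp: ferrers_def)
  then show ?thesis
    by (rule finite_subset) auto
qed

lemma ferrers_down_closed:
  assumes "is_partition \<nu>" "(i, j) \<in> ferrers \<nu>" "0 \<le> a" "a \<le> i" "0 \<le> b" "b \<le> j"
  shows "(a, b) \<in> ferrers \<nu>"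
proof -
  obtain i' j' where ij: "i = int i'" "j = int j'" "i' < length \<nu>" "j' < \<nu> ! i'"
    using assms(2) by (auto simp: ferrers_def)
  have "\<nu> ! i' \<le> \<nu> ! (nat a)"
  proof (cases "nat a = i'")
    case False
    then have "nat a < i'" using assms ij by auto
    then show ?thesis using assms(1) ij(3) by (auto simp: is_partition_def sorted_wrt_iff_nth_less)
  qed simp
  moreover have "nat b \<le> j'" using assms ij by auto
  moreover have "nat a < length \<nu>" using assms ij by auto
  ultimately have "nat b < \<nu> ! nat a" "nat a < length \<nu>" using ij by auto
  then show ?thesis using assms(3,5) unfolding ferrers_def
    by (intro CollectI exI[of _ "nat a"] exI[of _ "nat b"]) auto
qed

lemma ferrers_nonneg: "(i, j) \<in> ferrers \<nu> \<Longrightarrow> 0 \<le> i \<and> 0 \<le> j"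
  by (auto simp: ferrers_def)

lemma order_convex_translate: "order_convex D \<Longrightarrow> order_convex ((+) v ` D)"
proof -
  assume *: "order_convex D"
  show ?thesis unfolding order_convex_def
  proof (intro allI impI, elim conjE)
    fix i j i' j' a b assume A: "(i, j) \<in> (+) v ` D" "(i', j') \<in> (+) v ` D"
      and le: "i \<le> a" "a \<le> i'" "j \<le> b" "b \<le> j'"
    from A obtain p q p' q' where "(p, q) \<in> D" "i = fst v + p" "j = snd v + q"
      "(p', q') \<in> D" "i' = fst v + p'" "j' = snd v + q'"
      by (auto simp: plus_prod_def)
    then have "(a - fst v, b - snd v) \<in> D"
      using order_convexD[OF *, of p q p' q' "a - fst v" "b - snd v"] le by auto
    moreover have "(a, b) = v + (a - fst v, b - snd v)" by (cases v) auto
    ultimately show "(a, b) \<in> (+) v ` D" by blast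
  qed
qed

text \<open>The parts of the partition are the row lengths; they decrease because a cell forces all
  cells above it and to its left.\<close>

lemma finite_down_set_ferrers:
  assumes fin: "finite E" and nonneg: "\<And>i j. (i, j) \<in> E \<Longrightarrow> 0 \<le> i \<and> 0 \<le> j"
    and down: "\<And>i j a b. (i, j) \<in> E \<Longrightarrow> 0 \<le> a \<Longrightarrow> a \<le> i \<Longrightarrow> 0 \<le> b \<Longrightarrow> b \<le> j \<Longrightarrow> (a, b) \<in> E"
  shows "\<exists>\<nu>. is_partition \<nu> \<and> E = ferrers \<nu>"
proof -
  define len where "len i = card {j. (int i, int j) \<in> E}" for i
  have finr: "finite {j. (int i, int j) \<in> E}" for i
  proof -
    have "(\<lambda>j. (int i, int j)) ` {j. (int i, int j) \<in> E} \<subseteq> E" by auto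
    then have "finite ((\<lambda>j. (int i, int j)) ` {j. (int i, int j) \<in> E})" using fin finite_subset by blast
    then show ?thesis by (rule finite_imageD) (auto simp: inj_on_def)
  qed
  have row: "{j. (int i, int j) \<in> E} = {..<len i}" for i
  proof -
    let ?S = "{j. (int i, int j) \<in> E}"
    have dc: "\<And>x y. x \<in> ?S \<Longrightarrow> y \<le> x \<Longrightarrow> y \<in> ?S"
      using down[of "int i" _ "int i"] by auto
    show ?thesis
    proof (cases "?S = {}")
      case True then show ?thesis by (auto simp: len_def)
    next
      case False
      have "?S = {..Max ?S}"
        using dc Max_in[OF finr False] Max_ge[OF finr] by blast
      then have "card ?S = Suc (Max ?S)" by (metis card_atMost)
      with \<open>?S = {..Max ?S}\<close> show ?thesis unfolding len_def by (metis lessThan_Suc_atMost)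
    qed
  qed
  \<comment> \<open>A bound for the number of rows; \<open>insert 0\<close> keeps the maximum
    meaningful for empty \<open>E\<close>.\<close>
  define M where "M = nat (Max (insert 0 (fst ` E))) + 1"
  define \<nu> where "\<nu> = map len [0..<M]"
  have mono: "i \<le> i' \<Longrightarrow> len i' \<le> len i" for i i'
  proof -
    assume "i \<le> i'"
    then have "{j. (int i', int j) \<in> E} \<subseteq> {j. (int i, int j) \<in> E}"
      using down[of "int i'" _ "int i"] by auto
    then show ?thesis unfolding len_def using finr card_mono by blast
  qed
  have "is_partition \<nu>"
    unfolding is_partition_def \<nu>_def sorted_wrt_iff_nth_less using mono by auto
  moreover have "E = ferrers \<nu>"
  proof (intro Set.set_eqI iffI)
    fix c assume c: "c \<in> E"
    obtain i j where ij: "c = (int i, int j)"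
      using nonneg[of "fst c" "snd c"] c by (metis nonneg_int_cases prod.collapse)
    have "int i \<le> Max (insert 0 (fst ` E))"
      using fin c ij by (intro Max_ge) (force simp: image_iff)+
    then have "i < M" unfolding M_def by linarith
    moreover have "j < len i" using row[of i] c ij by blast
    ultimately show "c \<in> ferrers \<nu>" unfolding ferrers_def \<nu>_def ij by auto
  next
    fix c assume "c \<in> ferrers \<nu>"
    then obtain i j where "c = (int i, int j)" "j < len i" by (auto simp: ferrers_def \<nu>_def)
    then show "c \<in> E" using row[of i] by blast
  qed
  ultimately show ?thesis by blast
qed

text \<open>Replaces the two partitions by an intrinsic condition. Conversely, once the diagram is
  moved into the quadrant as \<open>D'\<close>, the outer partition is its closure \<open>E\<close>
  towards the origin, and the inner one is \<open>E - D'\<close>, again closed towards the origin by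
  convexity.\<close>

lemma skew_diagram_iff: "skew_diagram D \<longleftrightarrow> finite D \<and> order_convex D"
proof
  assume "skew_diagram D"
  then obtain \<nu> \<mu> v where *: "is_partition \<nu>" "is_partition \<mu>" "D = (+) v ` (ferrers \<nu> - ferrers \<mu>)"
    by (auto simp: skew_diagram_def)
  have "order_convex (ferrers \<nu> - ferrers \<mu>)"
    unfolding order_convex_def
  proof (intro allI impI, elim conjE)
    fix i j i' j' a b assume A: "(i, j) \<in> ferrers \<nu> - ferrers \<mu>" "(i', j') \<in> ferrers \<nu> - ferrers \<mu>"
      and le: "i \<le> a" "a \<le> i'" "j \<le> b" "b \<le> j'"
    have "0 \<le> i" "0 \<le> j" using A(1) ferrers_nonneg by auto
    then have "(a, b) \<in> ferrers \<nu>" using ferrers_down_closed[OF *(1), of i' j' a b] A le by auto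
    moreover have "(a, b) \<notin> ferrers \<mu>"
      using ferrers_down_closed[OF *(2), of a b i j] A le \<open>0 \<le> i\<close> \<open>0 \<le> j\<close> by auto
    ultimately show "(a, b) \<in> ferrers \<nu> - ferrers \<mu>" by auto
  qed
  then show "finite D \<and> order_convex D"
    using *(3) order_convex_translate finite_ferrers by auto
next
  assume D: "finite D \<and> order_convex D"
  define a where "a = Min (insert 0 (fst ` D))"
  define b where "b = Min (insert 0 (snd ` D))"
  define D' where "D' = (+) (- a, - b) ` D"
  have inD': "(i, j) \<in> D' \<longleftrightarrow> (i + a, j + b) \<in> D" for i j
    unfolding D'_def image_iff by (force simp: plus_prod_def)
  have nn: "0 \<le> i \<and> 0 \<le> j" if "(i, j) \<in> D'" for i j
  proof -
    have "a \<le> i + a" unfolding a_def using D that inD'[of i j]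
      by (intro Min_le) (force simp: a_def image_iff)+
    moreover have "b \<le> j + b" unfolding b_def using D that inD'[of i j]
      by (intro Min_le) (force simp: b_def image_iff)+
    ultimately show ?thesis by auto
  qed
  have finD': "finite D'" using D by (simp add: D'_def)
  have cvx: "order_convex D'" unfolding D'_def using D order_convex_translate by blast
  define E where "E = {(i, j). 0 \<le> i \<and> 0 \<le> j \<and> (\<exists>i' j'. (i', j') \<in> D' \<and> i \<le> i' \<and> j \<le> j')}"
  have "E \<subseteq> (\<Union>c\<in>D'. {0..fst c} \<times> {0..snd c})" by (force simp: E_def)
  moreover have "finite (\<Union>c\<in>D'. {0..fst c} \<times> {0..snd c})" using finD' by auto
  ultimately have finE: "finite E" using finite_subset by blast
  have "D' \<subseteq> E" using nn by (auto simp: E_def)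
  obtain \<nu> where \<nu>: "is_partition \<nu>" "E = ferrers \<nu>"
    using finite_down_set_ferrers[OF finE] by (fastforce simp: E_def)
  have "\<exists>\<mu>. is_partition \<mu> \<and> E - D' = ferrers \<mu>"
  proof (rule finite_down_set_ferrers)
    show "finite (E - D')" using finE by auto
    show "0 \<le> i \<and> 0 \<le> j" if "(i, j) \<in> E - D'" for i j using that by (auto simp: E_def)
    fix i j a b assume *: "(i, j) \<in> E - D'" "0 \<le> a" "a \<le> i" "0 \<le> b" "b \<le> j"
    then obtain i' j' where "(i', j') \<in> D'" "i \<le> i'" "j \<le> j'" by (auto simp: E_def)
    then have "(a, b) \<in> E" using * by (fastforce simp: E_def)
    moreover have "(a, b) \<notin> D'"
      using order_convexD[OF cvx, of a b i' j' i j] * \<open>(i', j') \<in> D'\<close> \<open>i \<le> i'\<close> \<open>j \<le> j'\<close> by auto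
    ultimately show "(a, b) \<in> E - D'" by auto
  qed
  then obtain \<mu> where \<mu>: "is_partition \<mu>" "E - D' = ferrers \<mu>" by blast
  have "D = (+) (a, b) ` D'" unfolding D'_def image_image by (simp add: add.assoc[symmetric] plus_prod_def)
  moreover have "D' = ferrers \<nu> - ferrers \<mu>" using \<nu> \<mu> \<open>D' \<subseteq> E\<close> by blast
  moreover have "ferrers \<mu> \<subseteq> ferrers \<nu>" using \<nu> \<mu> by blast
  ultimately show "skew_diagram D" unfolding skew_diagram_def using \<nu> \<mu> by blast
qed

section \<open>Connectedness in terms of diagonals\<close>

lemma diag_less_if_strictly_north_east:
  "strictly_north_east B A \<Longrightarrow> a \<in> A \<Longrightarrow> b \<in> B \<Longrightarrow> diag_of a + 1 < diag_of b"
  by (fastforce simp: strictly_north_east_def diag_of_def)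

text \<open>Otherwise the cell on diagonal \<open>e\<close> in the row of \<open>a\<close>, or the
  one in the column of \<open>b\<close>, lies between \<open>a\<close> and \<open>b\<close>, and
  convexity puts it into \<open>D\<close>.\<close>

lemma north_east_if_diag_gap:
  assumes "order_convex D" "a \<in> D" "b \<in> D" "diag_of a < e" "e < diag_of b" "e \<notin> diag_of ` D"
  shows "fst b < fst a \<and> snd a < snd b"
proof (rule ccontr)
  obtain i j i' j' where ab: "a = (i, j)" "b = (i', j')" by fastforce
  have d: "j - i < e" "e < j' - i'" using assms ab by (auto simp: diag_of_def)
  assume "\<not> ?thesis"
  then consider "i \<le> i'" | "j' \<le> j" using ab by fastforce
  then show False
  proof cases
    case 1
    then have "(i, i + e) \<in> D" using d assms ab order_convexD[of D i j i' j' i "i + e"] by auto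
    then show False using assms(6) by (force simp: diag_of_def)
  next
    case 2
    then have "(j' - e, j') \<in> D" using d assms ab order_convexD[of D i' j' i j "j' - e" "j'"] by auto
    then show False using assms(6) by (force simp: diag_of_def)
  qed
qed

text \<open>Reduces connectedness to a one-dimensional condition: the summands of a convex diagram
  are separated by empty diagonals.\<close>

lemma connected_iff_diag_interval:
  assumes "order_convex D"
  shows "diagram_connected D \<longleftrightarrow> (\<forall>a\<in>D. \<forall>b\<in>D. {diag_of a..diag_of b} \<subseteq> diag_of ` D)"
proof (intro iffI ballI subsetI)
  fix a b e assume con: "diagram_connected D" and ab: "a \<in> D" "b \<in> D" and e: "e \<in> {diag_of a..diag_of b}"
  show "e \<in> diag_of ` D"
  proof (rule ccontr)
    assume ne: "e \<notin> diag_of ` D"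
    have *: "a \<in> {c\<in>D. diag_of c < e}" "b \<in> {c\<in>D. diag_of c > e}"
      using ab ne e by (auto simp: order_le_less)
    have "D = {c\<in>D. diag_of c < e} \<union> {c\<in>D. diag_of c > e}"
      using ne by force
    moreover have "strictly_north_east {c\<in>D. diag_of c > e} {c\<in>D. diag_of c < e}"
      unfolding strictly_north_east_def using north_east_if_diag_gap[OF assms] ne by blast
    moreover have "{c\<in>D. diag_of c < e} \<noteq> {}" "{c\<in>D. diag_of c > e} \<noteq> {}" using * by blast+
    ultimately have "\<exists>D1 D2. D1 \<noteq> {} \<and> D2 \<noteq> {} \<and> D = D1 \<union> D2 \<and> strictly_north_east D2 D1"
      by (intro exI[of _ "{c\<in>D. diag_of c < e}"] exI[of _ "{c\<in>D. diag_of c > e}"] conjI)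
    then show False using con unfolding diagram_connected_def by (rule notE[rotated])
  qed
next
  assume iv: "\<forall>a\<in>D. \<forall>b\<in>D. {diag_of a..diag_of b} \<subseteq> diag_of ` D"
  show "diagram_connected D"
    unfolding diagram_connected_def
  proof (intro notI, elim exE conjE)
    fix D1 D2 assume *: "D1 \<noteq> {}" "D2 \<noteq> {}" "D = D1 \<union> D2" "strictly_north_east D2 D1"
    then obtain a b where ab: "a \<in> D1" "b \<in> D2" by blast
    have "\<exists>d\<in>{diag_of a..diag_of b}. \<forall>c\<in>D. diag_of c \<noteq> d"
    proof (rule ccontr)
      assume "\<not> ?thesis"
      then have all: "\<And>d. d \<in> {diag_of a..diag_of b} \<Longrightarrow> \<exists>c\<in>D. diag_of c = d" by blast
      \<comment> \<open>Walking from \<open>a\<close> one diagonal at a time never leaves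
        \<open>D1\<close>, because cells of \<open>D2\<close> are at least two diagonals further
        on.\<close>
      have "\<exists>c\<in>D1. diag_of c = diag_of a + int n" if "diag_of a + int n \<le> diag_of b" for n
        using that
      proof (induction n)
        case 0 then show ?case using ab by force
      next
        case (Suc n)
        then obtain c where c: "c \<in> D1" "diag_of c = diag_of a + int n" by auto
        obtain c' where "c' \<in> D" "diag_of c' = diag_of a + int (Suc n)"
          using all[of "diag_of a + int (Suc n)"] Suc.prems by auto
        then show ?case using c *(3) diag_less_if_strictly_north_east[OF *(4) c(1)] by fastforce
      qed
      from this[of "nat (diag_of b - diag_of a)"] obtain c where "c \<in> D1" "diag_of c = diag_of b"
        using diag_less_if_strictly_north_east[OF *(4) ab] by auto
      then show False using diag_less_if_strictly_north_east[OF *(4) _ ab(2)] by fastforce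
    qed
    then obtain d where "d \<in> {diag_of a..diag_of b}" "d \<notin> diag_of ` D" by blast
    then show False using iv ab *(3) by blast
  qed
qed

lemma diag_comparable:
  assumes "order_convex D" "(i, i + d) \<in> D" "(i', i' + d) \<in> D" "i \<le> a" "a \<le> i'"
  shows "(a, a + d) \<in> D"
  using order_convexD[OF assms(1,2,3)] assms by auto

section \<open>Ribbons as words\<close>

text \<open>The letter \<open>True\<close> is a step to the right and \<open>False\<close> a step up, so every step increases the diagonal by one.\<close>

definition move :: "bool \<Rightarrow> cell \<Rightarrow> cell" where
  "move b c = (if b then (fst c, snd c + 1) else (fst c - 1, snd c))"

fun strip :: "cell \<Rightarrow> bool list \<Rightarrow> cell set" where
  "strip c [] = {c}"
| "strip c (b # u) = insert c (strip (move b c) u)"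

fun strip_end :: "cell \<Rightarrow> bool list \<Rightarrow> cell" where
  "strip_end c [] = c"
| "strip_end c (b # u) = strip_end (move b c) u"

lemma diag_of_move [simp]: "diag_of (move b c) = diag_of c + 1"
  by (simp add: move_def diag_of_def)

lemma strip_end_append [simp]: "strip_end c (u @ v) = strip_end (strip_end c u) v"
  by (induction u arbitrary: c) auto

lemma strip_end_eq:
  "strip_end c u = (fst c - int (count_list u False), snd c + int (count_list u True))"
  by (induction u arbitrary: c) (auto simp: move_def)

lemma count_list_bool: "count_list u True + count_list u False = length u"
  by (induction u) auto

lemma diag_of_strip_end [simp]: "diag_of (strip_end c u) = diag_of c + int (length u)"
  by (induction u arbitrary: c) auto

lemma start_in_strip [simp]: "c \<in> strip c u"
  by (cases u) auto

lemma end_in_strip [simp]: "strip_end c u \<in> strip c u"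
  by (induction u arbitrary: c) auto

lemma strip_append: "strip c (u @ v) = strip c u \<union> strip (strip_end c u) v"
  by (induction u arbitrary: c) (auto simp: insert_absorb)

lemma strip_snoc: "strip c (u @ [b]) = insert (move b (strip_end c u)) (strip c u)"
  by (auto simp: strip_append)

lemma strip_conv: "strip c u = (\<lambda>n. strip_end c (take n u)) ` {..length u}"
proof (induction u arbitrary: c)
  case (Cons b u)
  have "{..length (b # u)} = insert 0 (Suc ` {..length u})"
    by (simp add: atMost_Suc_eq_insert_0)
  then show ?case using Cons by (simp add: image_image)
qed simp

lemma finite_strip [simp]: "finite (strip c u)"
  by (simp add: strip_conv)

lemma diag_of_image_strip: "diag_of ` strip c u = {diag_of c..diag_of c + int (length u)}"
proof (induction u arbitrary: c)
  case (Cons b u)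
  show ?case unfolding strip.simps image_insert Cons by auto
qed simp

lemma inj_on_diag_of_strip: "inj_on diag_of (strip c u)"
  unfolding strip_conv by (auto simp: inj_on_def min_def split: if_splits)

lemma card_strip [simp]: "card (strip c u) = Suc (length u)"
  using card_image[OF inj_on_diag_of_strip, of c u] by (simp add: diag_of_image_strip)

text \<open>The start is the cell of smallest diagonal, and there is only one cell on each diagonal,
  so the set of cells remembers every step.\<close>

lemma strip_inject: "strip c u = strip c' u' \<longleftrightarrow> c = c' \<and> u = u'"
proof
  assume eq: "strip c u = strip c' u'"
  have "{diag_of c..diag_of c + int (length u)} = {diag_of c'..diag_of c' + int (length u')}"
    using eq by (metis diag_of_image_strip)
  then have d: "diag_of c = diag_of c'" by (simp add: Icc_eq_Icc)
  have "c' \<in> strip c u" using eq by simp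
  then have cc: "c = c'" using inj_on_diag_of_strip[of c u] d by (metis inj_onD start_in_strip)
  have "length u = length u'" using eq card_strip by (metis Suc_inject)
  moreover have "strip c u = strip c u'" using eq cc by simp
  ultimately have "u = u'"
  proof (induction u u' arbitrary: c rule: list_induct2)
    case (Cons b u b' u')
    have nin: "c \<notin> strip (move a c) v" for a v
    proof
      assume "c \<in> strip (move a c) v"
      then have "diag_of c \<in> diag_of ` strip (move a c) v" by simp
      then show False by (simp add: diag_of_image_strip)
    qed
    then have eq: "strip (move b c) u = strip (move b' c) u'"
      using Cons.prems by (metis insert_ident strip.simps(2))
    have "diag_of (move b c) = diag_of (move b' c)" "move b' c \<in> strip (move b c) u" using eq by auto
    then have "move b c = move b' c"
      using inj_on_diag_of_strip[of "move b c" u] by (metis inj_onD start_in_strip)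
    then have "b = b'" by (auto simp: move_def split: if_splits)
    then show ?case using eq Cons.IH by simp
  qed simp
  then show "c = c' \<and> u = u'" using cc by simp
qed simp

lemma move_translate: "move b (v + c) = v + move b c"
  by (cases v; cases c) (simp add: move_def)

lemma translate_strip: "(+) v ` strip c u = strip (v + c) u"
  by (induction u arbitrary: c) (auto simp: move_translate)

lemma same_shape_strip_iff [simp]: "same_shape (strip c u) (strip c' u') \<longleftrightarrow> u = u'"
proof -
  have "c' = c' - c + c" by simp
  then show ?thesis unfolding same_shape_def translate_strip strip_inject by metis
qed

lemma same_shape_strip_left: "same_shape (strip c u) D \<longleftrightarrow> (\<exists>c'. D = strip c' u)"
proof
  assume "\<exists>c'. D = strip c' u" then show "same_shape (strip c u) D" by auto
next
  assume "same_shape (strip c u) D"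
  then show "\<exists>c'. D = strip c' u" unfolding same_shape_def translate_strip by (elim exE) (rule exI)
qed

lemma same_shape_sym: "same_shape D E \<Longrightarrow> same_shape E D"
proof -
  assume "same_shape D E"
  then obtain v where "E = (+) v ` D" by (auto simp: same_shape_def)
  then have "D = (+) (- v) ` E" by (simp add: image_image)
  then show ?thesis unfolding same_shape_def by (rule exI)
qed

lemma same_shape_strip_right: "same_shape D (strip c u) \<longleftrightarrow> (\<exists>c'. D = strip c' u)"
  using same_shape_sym same_shape_strip_left by blast

section \<open>Reflection of words\<close>

definition conj_word :: "bool list \<Rightarrow> bool list" where
  "conj_word u = map Not (rev u)"

lemma conj_word_append: "conj_word (u @ v) = conj_word v @ conj_word u"
  by (simp add: conj_word_def)

lemma length_conj_word [simp]: "length (conj_word u) = length u"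
  by (simp add: conj_word_def)

lemma count_list_map_Not: "count_list (map Not u) b = count_list u (\<not> b)"
  by (induction u) auto

lemma count_list_conj_word [simp]: "count_list (conj_word u) b = count_list u (\<not> b)"
  by (simp add: conj_word_def count_list_map_Not count_list_rev)

lemma conj_diagram_conj_diagram [simp]: "conj_diagram (conj_diagram D) = D"
  by (simp add: conj_diagram_def image_image)

lemma in_conj_diagram [simp]: "(i, j) \<in> conj_diagram D \<longleftrightarrow> (j, i) \<in> D"
  by (force simp: conj_diagram_def)

lemma diag_of_swap [simp]: "diag_of (prod.swap c) = - diag_of c"
  by (simp add: diag_of_def)

lemma move_swap: "move (\<not> b) (prod.swap (move b c)) = prod.swap c"
  by (cases c) (simp add: move_def)

lemma strip_end_conj: "strip_end (prod.swap (strip_end c u)) (conj_word u) = prod.swap c"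
  by (cases c) (simp add: strip_end_eq)

lemma conj_diagram_strip: "conj_diagram (strip c u) = strip (prod.swap (strip_end c u)) (conj_word u)"
proof (induction u arbitrary: c)
  case Nil then show ?case by (simp add: conj_diagram_def conj_word_def)
next
  case (Cons b u)
  have "conj_diagram (strip c (b # u)) = insert (prod.swap c) (conj_diagram (strip (move b c) u))"
    by (simp add: conj_diagram_def)
  also have "\<dots> = strip (prod.swap (strip_end c (b # u))) (conj_word u @ [\<not> b])"
    unfolding Cons strip_snoc by (simp add: strip_end_conj move_swap)
  finally show ?case by (simp add: conj_word_def)
qed

lemma strip_monotone:
  assumes "x \<in> strip c u" "y \<in> strip c u" "diag_of x \<le> diag_of y"
  shows "fst y \<le> fst x \<and> snd x \<le> snd y"
proof -
  obtain k l where kl: "x = strip_end c (take k u)" "y = strip_end c (take l u)" "k \<le> length u" "l \<le> length u"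
    using assms(1,2) by (auto simp: strip_conv)
  then have "k \<le> l" using assms(3) by simp
  then have "take l u = take k u @ take (l - k) (drop k u)" by (metis le_add_diff_inverse take_add)
  then have "y = strip_end x (take (l - k) (drop k u))" using kl by simp
  then show ?thesis by (simp add: strip_end_eq)
qed

text \<open>Along a strip rows weakly decrease and columns weakly increase. Two cells bounding a
  rectangle from the northwest and the southeast therefore share a row or a column, and so does
  everything between them.\<close>

lemma order_convex_strip: "order_convex (strip c u)"
  unfolding order_convex_def
proof (intro allI impI, elim conjE)
  fix i j i' j' a b assume x: "(i, j) \<in> strip c u" and y: "(i', j') \<in> strip c u"
    and le: "i \<le> a" "a \<le> i'" "j \<le> b" "b \<le> j'"
  have D: "\<exists>z\<in>strip c u. diag_of z = e" if "p \<in> strip c u" "q \<in> strip c u" "diag_of p \<le> e" "e \<le> diag_of q" for p q e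
  proof -
    have "diag_of p \<in> diag_of ` strip c u" "diag_of q \<in> diag_of ` strip c u" using that by auto
    then have "e \<in> diag_of ` strip c u" using that unfolding diag_of_image_strip by auto
    then show ?thesis by auto
  qed
  show "(a, b) \<in> strip c u"
  proof (cases "diag_of (i, j) \<le> diag_of (i', j')")
    case True
    then have "i = i'" using strip_monotone[OF x y] le by auto
    then obtain z where z: "z \<in> strip c u" "diag_of z = b - i"
      using D[OF x y, of "b - i"] le by (auto simp: diag_of_def)
    then have "diag_of (i, j) \<le> diag_of z" "diag_of z \<le> diag_of (i', j')"
      using le \<open>i = i'\<close> by (auto simp: diag_of_def)
    then have "fst z = i" using strip_monotone[OF x z(1)] strip_monotone[OF z(1) y] \<open>i = i'\<close> by auto
    then have "z = (a, b)" using z(2) le \<open>i = i'\<close> by (cases z) (auto simp: diag_of_def)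
    then show ?thesis using z by simp
  next
    case False
    then have "j = j'" using strip_monotone[OF y x] le by auto
    then obtain z where z: "z \<in> strip c u" "diag_of z = j - a"
      using D[OF y x, of "j - a"] le by (auto simp: diag_of_def)
    then have "diag_of (i', j') \<le> diag_of z" "diag_of z \<le> diag_of (i, j)"
      using le \<open>j = j'\<close> by (auto simp: diag_of_def)
    then have "snd z = j" using strip_monotone[OF y z(1)] strip_monotone[OF z(1) x] \<open>j = j'\<close> by auto
    then have "z = (a, b)" using z(2) le \<open>j = j'\<close> by (cases z) (auto simp: diag_of_def)
    then show ?thesis using z by simp
  qed
qed

lemma is_ribbon_strip [simp]: "is_ribbon (strip c u)"
proof -
  have "\<not> {(i, j), (i + 1, j), (i, j + 1), (i + 1, j + 1)} \<subseteq> strip c u" for i j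
  proof
    assume "{(i, j), (i + 1, j), (i, j + 1), (i + 1, j + 1)} \<subseteq> strip c u"
    then have "(i, j) \<in> strip c u" "(i + 1, j + 1) \<in> strip c u" "diag_of (i, j) = diag_of (i + 1, j + 1)"
      by (auto simp: diag_of_def)
    then have "(i, j) = (i + 1, j + 1)" using inj_on_diag_of_strip by (metis inj_onD)
    then show False by simp
  qed
  moreover have "diagram_connected (strip c u)"
    unfolding connected_iff_diag_interval[OF order_convex_strip]
  proof (intro ballI)
    fix x y assume "x \<in> strip c u" "y \<in> strip c u"
    then have "diag_of x \<in> diag_of ` strip c u" "diag_of y \<in> diag_of ` strip c u" by auto
    then show "{diag_of x..diag_of y} \<subseteq> diag_of ` strip c u" unfolding diag_of_image_strip by auto
  qed
  moreover have "strip c u \<noteq> {}" using start_in_strip[of c u] by blast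
  ultimately show ?thesis
    unfolding is_ribbon_def skew_diagram_iff using order_convex_strip by auto
qed

text \<open>If the southeasternmost cells of adjacent diagonals were not neighbours, the cell
  diagonally after one of them would lie between them in the convex diagram.\<close>

lemma next_border_cell:
  assumes "order_convex D" "x \<in> D" "y \<in> D" "diag_of y = diag_of x + 1"
    and "\<And>k. k > 0 \<Longrightarrow> x + (k, k) \<notin> D" "\<And>k. k > 0 \<Longrightarrow> y + (k, k) \<notin> D"
  shows "y = move True x \<or> y = move False x"
proof -
  obtain i j i' j' where xy: "x = (i, j)" "y = (i', j')" by fastforce
  have j': "j' = i' + (j - i) + 1" using assms(4) xy by (auto simp: diag_of_def)
  have "i' \<le> i"
  proof (rule ccontr)
    assume "\<not> i' \<le> i"
    then have "(i + 1, j + 1) \<in> D" using order_convexD[OF assms(1), of i j i' j' "i+1" "j+1"] assms j' xy by auto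
    then show False using assms(5)[of 1] xy by auto
  qed
  moreover have "i - 1 \<le> i'"
  proof (rule ccontr)
    assume "\<not> i - 1 \<le> i'"
    then have "(i' + 1, j' + 1) \<in> D" using order_convexD[OF assms(1), of i' j' i j "i'+1" "j'+1"] assms j' xy by auto
    then show False using assms(6)[of 1] xy by auto
  qed
  ultimately show ?thesis using xy j' by (auto simp: move_def)
qed

text \<open>Two cells on one diagonal would span a square containing a 2x2 block, so a ribbon has
  one cell per diagonal. Connectedness leaves no diagonal out, and reading the cells by increasing
  diagonal gives the word.\<close>

lemma is_ribbon_iff: "is_ribbon \<alpha> \<longleftrightarrow> (\<exists>c u. \<alpha> = strip c u)"
proof
  assume "is_ribbon \<alpha>"
  then have *: "finite \<alpha>" "order_convex \<alpha>" "diagram_connected \<alpha>" "\<alpha> \<noteq> {}"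
    and no22: "\<And>i j. \<not> {(i, j), (i + 1, j), (i, j + 1), (i + 1, j + 1)} \<subseteq> \<alpha>"
    by (auto simp: is_ribbon_def skew_diagram_iff)
  have single: "x + (k, k) \<notin> \<alpha>" if "x \<in> \<alpha>" "k > 0" for x k
  proof
    obtain i j where x: "x = (i, j)" by fastforce
    assume "x + (k, k) \<in> \<alpha>"
    then have "(a, b) \<in> \<alpha>" if "i \<le> a" "a \<le> i + 1" "j \<le> b" "b \<le> j + 1" for a b
      using order_convexD[OF *(2), of i j "i + k" "j + k" a b] that x \<open>x \<in> \<alpha>\<close> \<open>k > 0\<close> by auto
    then show False using no22[of i j] by auto
  qed
  have inj: "x = y" if "x \<in> \<alpha>" "y \<in> \<alpha>" "diag_of x = diag_of y" for x y
  proof -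
    obtain i j i' j' where xy: "x = (i, j)" "y = (i', j')" by fastforce
    have "y = x + (i' - i, i' - i)" "x = y + (i - i', i - i')" using xy that(3) by (auto simp: diag_of_def)
    then have "\<not> i' - i > 0" "\<not> i - i' > 0" using single that by metis+
    then show ?thesis using xy that(3) by (auto simp: diag_of_def)
  qed
  have fd: "finite (diag_of ` \<alpha>)" "diag_of ` \<alpha> \<noteq> {}" using * by auto
  obtain c where c: "c \<in> \<alpha>" "diag_of c = Min (diag_of ` \<alpha>)" using Min_in[OF fd] by force
  obtain e where e: "e \<in> \<alpha>" "diag_of e = Max (diag_of ` \<alpha>)" using Max_in[OF fd] by force
  have le: "diag_of c \<le> diag_of x" "diag_of x \<le> diag_of e" if "x \<in> \<alpha>" for x using fd c e that by auto
  have cover: "\<exists>y\<in>\<alpha>. diag_of y = d" if "diag_of c \<le> d" "d \<le> diag_of e" for d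
    using *(3) that c(1) e(1) unfolding connected_iff_diag_interval[OF *(2)] by fastforce
  have "\<exists>u. length u = n \<and> strip c u = {x \<in> \<alpha>. diag_of x \<le> diag_of c + int n}"
    if "diag_of c + int n \<le> diag_of e" for n
    using that
  proof (induction n)
    case 0
    have "x = c" if "x \<in> \<alpha>" "diag_of x \<le> diag_of c" for x
      using inj[OF that(1) c(1)] le(1)[OF that(1)] that(2) by linarith
    then have "{x \<in> \<alpha>. diag_of x \<le> diag_of c} = {c}" using c(1) by blast
    then show ?case by auto
  next
    case (Suc n)
    then obtain u where u: "length u = n" "strip c u = {x \<in> \<alpha>. diag_of x \<le> diag_of c + int n}" by auto
    let ?x = "strip_end c u"
    have x: "?x \<in> \<alpha>" using u end_in_strip[of c u] by blast
    obtain y where y: "y \<in> \<alpha>" "diag_of y = diag_of c + int (Suc n)" using cover[of "diag_of c + int (Suc n)"] Suc.prems by auto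
    have "diag_of y = diag_of ?x + 1" using y(2) u(1) by simp
    then obtain b where "y = move b ?x"
      using next_border_cell[OF *(2) x y(1) _ single[OF x] single[OF y(1)]] by metis
    moreover have "{x \<in> \<alpha>. diag_of x \<le> diag_of c + int (Suc n)} = insert y {x \<in> \<alpha>. diag_of x \<le> diag_of c + int n}"
    proof (intro Set.set_eqI iffI)
      fix z assume z: "z \<in> {x \<in> \<alpha>. diag_of x \<le> diag_of c + int (Suc n)}"
      show "z \<in> insert y {x \<in> \<alpha>. diag_of x \<le> diag_of c + int n}"
      proof (cases "diag_of z = diag_of y")
        case True
        then have "z = y" using inj[OF _ y(1) True] z by blast
        then show ?thesis by blast
      next
        case False
        then show ?thesis using z y(2) by simp
      qed
    qed (use y in auto)
    ultimately show ?case using u by (intro exI[of _ "u @ [b]"]) (simp add: strip_snoc)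
  qed
  from this[of "nat (diag_of e - diag_of c)"] obtain u where
    "strip c u = {x \<in> \<alpha>. diag_of x \<le> diag_of e}" using le[OF c(1)] by auto
  then have "\<alpha> = strip c u" using le by auto
  then show "\<exists>c u. \<alpha> = strip c u" by blast
qed auto

text \<open>Each diagonal carries one cell, and \<open>Suc n\<close> cells are joined by n steps;
  hence the shift by one.\<close>

lemma sw_restrict_strip:
  "sw_restrict (Suc n) (strip c u) = strip c (take n u)"
proof -
  have *: "card {d \<in> diag_of ` strip c u. d < diag_of (strip_end c (take k u))} = k" if "k \<le> length u" for k
  proof -
    have "{d \<in> diag_of ` strip c u. d < diag_of (strip_end c (take k u))} = {diag_of c..<diag_of c + int k}"
      unfolding diag_of_image_strip using that by auto
    then show ?thesis by simp
  qed
  have "sw_restrict (Suc n) (strip c u) = (\<lambda>k. strip_end c (take k u)) ` {k. k \<le> length u \<and> k < Suc n}"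
    unfolding sw_restrict_def using * by (auto simp: strip_conv[of c u])
  also have "{k. k \<le> length u \<and> k < Suc n} = {..length (take n u)}" by auto
  also have "(\<lambda>k. strip_end c (take k u)) ` \<dots> = (\<lambda>k. strip_end c (take k (take n u))) ` \<dots>"
    by (intro image_cong) simp_all
  finally show ?thesis by (simp add: strip_conv)
qed

text \<open>Reflection negates diagonals; this derives the northeast restriction of a strip from the
  southwest one.\<close>

lemma sw_restrict_conj: "sw_restrict n (conj_diagram D) = conj_diagram (ne_restrict n D)"
proof -
  have "{d \<in> diag_of ` conj_diagram D. d < diag_of (prod.swap c)} = uminus ` {d \<in> diag_of ` D. diag_of c < d}" for c
    unfolding conj_diagram_def by (auto simp: image_iff)
  then have "card {d \<in> diag_of ` conj_diagram D. d < diag_of (prod.swap c)} = card {d \<in> diag_of ` D. diag_of c < d}" for c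
    by (simp add: card_image)
  then have *: "{c \<in> D. card {d \<in> diag_of ` conj_diagram D. d < diag_of (prod.swap c)} < n} = ne_restrict n D"
    by (simp add: ne_restrict_def)
  have "sw_restrict n (conj_diagram D) = prod.swap ` {c \<in> D. card {d \<in> diag_of ` conj_diagram D. d < diag_of (prod.swap c)} < n}"
  proof -
    have "- diag_of (a, b) = diag_of (b, a)" for a b by (simp add: diag_of_def)
    then show ?thesis unfolding sw_restrict_def conj_diagram_def by auto
  qed
  then show ?thesis unfolding * by (simp add: conj_diagram_def)
qed

lemma ne_restrict_strip:
  "ne_restrict (Suc n) (strip c u) = strip (strip_end c (take (length u - n) u)) (drop (length u - n) u)"
proof -
  let ?u = "drop (length u - n) u" and ?v = "take (length u - n) u"
  have "conj_diagram (ne_restrict (Suc n) (strip c u)) = strip (prod.swap (strip_end c u)) (take n (conj_word u))"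
    by (simp add: sw_restrict_conj[symmetric] conj_diagram_strip sw_restrict_strip)
  also have "take n (conj_word u) = conj_word ?u"
    by (simp add: conj_word_def take_map take_rev)
  also have "strip_end c u = strip_end (strip_end c ?v) ?u"
    by (metis append_take_drop_id strip_end_append)
  finally have "conj_diagram (ne_restrict (Suc n) (strip c u)) = conj_diagram (strip (strip_end c ?v) ?u)"
    by (simp add: conj_diagram_strip)
  then show ?thesis by (metis conj_diagram_conj_diagram)
qed

lemma fst_image_strip: "fst ` strip c u = {fst c - int (count_list u False)..fst c}"
  by (induction u arbitrary: c) (auto simp: move_def)

lemma num_rows_strip [simp]: "num_rows (strip c u) = Suc (count_list u False)"
  by (simp add: num_rows_def fst_image_strip)

lemma num_cols_eq: "num_cols D = num_rows (conj_diagram D)"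
  by (simp add: num_cols_def num_rows_def conj_diagram_def image_image)

lemma num_cols_strip [simp]: "num_cols (strip c u) = Suc (count_list u True)"
  by (simp add: num_cols_eq conj_diagram_strip)

lemma row_len_strip: "row_len (strip c u) i = card {x \<in> strip c u. fst x = fst c + 1 - int i}"
proof -
  have "Max (fst ` strip c u) = fst c" unfolding fst_image_strip by (intro Max_eqI) auto
  then show ?thesis by (simp add: row_len_def)
qed

text \<open>Intersections constrain only the lengths of end rows, which are one more than the
  initial and final runs of right steps.\<close>

lemma row_len_strip_bottom: "row_len (strip c u) (Suc 0) = Suc (length (takeWhile id u))"
proof -
  have "{x \<in> strip c u. fst x = fst c} = strip c (takeWhile id u)"
  proof (induction u arbitrary: c)
    case (Cons b u)
    show ?case
    proof (cases b)
      case True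
      then have "fst (move b c) = fst c" by (simp add: move_def)
      then show ?thesis using Cons[of "move b c"] True by auto
    next
      case False
      have "fst x \<noteq> fst c" if "x \<in> strip (move b c) u" for x
      proof -
        have "fst x \<in> fst ` strip (move b c) u" using that by simp
        then show ?thesis using False by (simp add: fst_image_strip move_def)
      qed
      then show ?thesis using False by auto
    qed
  qed auto
  then show ?thesis by (simp add: row_len_strip)
qed

lemma row_len_strip_top: "row_len (strip c u) (num_rows (strip c u)) = Suc (length (takeWhile id (rev u)))"
proof -
  have "card {x \<in> strip c u. fst x = fst (strip_end c u)} = Suc (length (takeWhile id (rev u)))"
  proof (induction u rule: rev_induct)
    case Nil
    have "{x. x = c \<and> fst x = fst c} = {c}" by auto
    then show ?case by simp
  next
    case (snoc b u)
    let ?e = "strip_end c u"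
    show ?case
    proof (cases b)
      case True
      have "{x \<in> strip c (u @ [b]). fst x = fst (strip_end c (u @ [b]))} =
          insert (move b ?e) {x \<in> strip c u. fst x = fst ?e}"
        using True by (auto simp: strip_snoc move_def)
      moreover have "move b ?e \<notin> strip c u"
      proof
        assume "move b ?e \<in> strip c u"
        then have "diag_of (move b ?e) \<in> diag_of ` strip c u" by (rule imageI)
        then show False by (simp add: diag_of_image_strip)
      qed
      ultimately show ?thesis using snoc True by simp
    next
      case False
      have "fst x \<noteq> fst (move b ?e)" if "x \<in> strip c u" for x
      proof -
        have "fst x \<in> fst ` strip c u" using that by simp
        then show ?thesis using False by (auto simp: fst_image_strip move_def strip_end_eq)
      qed
      then have "{x \<in> strip c (u @ [b]). fst x = fst (strip_end c (u @ [b]))} = {move b ?e}"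
        by (auto simp: strip_snoc)
      then show ?thesis using False by simp
    qed
  qed
  moreover have "fst c + 1 - int (num_rows (strip c u)) = fst (strip_end c u)" by (simp add: strip_end_eq)
  ultimately show ?thesis unfolding row_len_strip by simp
qed

section \<open>Intersections, unions and conjugation of words\<close>

text \<open>The word form of \<open>is_m_cap\<close>. As soon as \<open>w\<close> contains an up
  step, its end rows agree with those of \<open>u\<close> and \<open>v\<close> because it is a
  suffix of one and a prefix of the other; only a one-row intersection needs its length
  prescribed.\<close>

definition cap_word :: "nat \<Rightarrow> bool list \<Rightarrow> bool list \<Rightarrow> bool list \<Rightarrow> bool" where
  "cap_word m u v w \<longleftrightarrow> m = Suc (count_list w False) \<and> (\<exists>y. u = y @ w) \<and> (\<exists>z. v = w @ z) \<and>
     (False \<notin> set w \<longrightarrow> length w = min (length (takeWhile id (rev u))) (length (takeWhile id v)))"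

lemma takeWhile_id_eq: "False \<notin> set w \<Longrightarrow> takeWhile id w = w"
  by (metis (full_types) id_apply takeWhile_eq_all_conv)

lemma is_m_cap_strip:
  "is_m_cap m (strip c u) (strip c' v) \<omega> \<longleftrightarrow> (\<exists>e w. \<omega> = strip e w \<and> cap_word m u v w)"
proof
  assume A: "is_m_cap m (strip c u) (strip c' v) \<omega>"
  then obtain e w where \<omega>: "\<omega> = strip e w" by (auto simp: is_m_cap_def is_ribbon_iff)
  have m: "m = Suc (count_list w False)" using A \<omega> by (auto simp: is_m_cap_def)
  have "drop (length u - length w) u = w"
    using A \<omega> by (auto simp: is_m_cap_def protrudes_top_def ne_restrict_strip)
  then have "u = take (length u - length w) u @ w" by (metis append_take_drop_id)
  moreover have "take (length w) v = w"
    using A \<omega> by (auto simp: is_m_cap_def protrudes_bottom_def sw_restrict_strip)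
  then have "v = w @ drop (length w) v" by (metis append_take_drop_id)
  moreover have "length w = min (length (takeWhile id (rev u))) (length (takeWhile id v))" if "False \<notin> set w"
  proof -
    have "m = 1" using m that by (simp add: count_notin)
    then have "row_len (strip e w) (Suc 0) = min (row_len (strip c u) (num_rows (strip c u))) (row_len (strip c' v) (Suc 0))"
      using A \<omega> by (simp add: is_m_cap_def)
    then show ?thesis using takeWhile_id_eq[OF that]
      unfolding row_len_strip_bottom row_len_strip_top by simp
  qed
  ultimately show "\<exists>e w. \<omega> = strip e w \<and> cap_word m u v w" using \<omega> m unfolding cap_word_def by blast
next
  assume "\<exists>e w. \<omega> = strip e w \<and> cap_word m u v w"
  then obtain e w y z where \<omega>: "\<omega> = strip e w" and m: "m = Suc (count_list w False)"
    and u: "u = y @ w" and v: "v = w @ z"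
    and one: "False \<notin> set w \<Longrightarrow> length w = min (length (takeWhile id (rev u))) (length (takeWhile id v))"
    unfolding cap_word_def by blast
  have "protrudes_top \<omega> (strip c u)"
    unfolding protrudes_top_def \<omega> by (simp add: ne_restrict_strip u)
  moreover have "protrudes_bottom \<omega> (strip c' v)"
    unfolding protrudes_bottom_def \<omega> by (simp add: sw_restrict_strip v)
  moreover have "if m = 1 then row_len \<omega> 1 = min (row_len (strip c u) (num_rows (strip c u))) (row_len (strip c' v) 1)
      else row_len \<omega> 1 = row_len (strip c' v) 1 \<and> row_len \<omega> m = row_len (strip c u) (num_rows (strip c u))"
  proof (cases "m = 1")
    case True
    then have "False \<notin> set w" using m by (metis One_nat_def Suc_inject count_list_0_iff)
    then have "length (takeWhile id w) = length w" using takeWhile_id_eq by metis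
    then show ?thesis using True one[OF \<open>False \<notin> set w\<close>]
      unfolding One_nat_def \<omega> row_len_strip_bottom row_len_strip_top by simp
  next
    case False
    then have f: "False \<in> set w" using m by (metis One_nat_def count_list_0_iff)
    have "takeWhile id (w @ z) = takeWhile id w" "takeWhile id (rev w @ rev y) = takeWhile id (rev w)"
      using f by (auto intro: takeWhile_append1)
    moreover have "row_len (strip e w) m = Suc (length (takeWhile id (rev w)))"
      using row_len_strip_top[of e w] m by simp
    ultimately show ?thesis using False
      unfolding One_nat_def \<omega> row_len_strip_bottom row_len_strip_top by (simp add: u v)
  qed
  ultimately show "is_m_cap m (strip c u) (strip c' v) \<omega>"
    unfolding is_m_cap_def using m \<omega> by simp
qed

text \<open>If \<open>w\<close> contains an up step, then \<open>w' = w @ t = s @ w\<close> and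
  equal numbers of up steps leave only right steps in \<open>s\<close>. These would lengthen the
  initial run of right steps of \<open>w'\<close>, which is already determined by its prefix
  \<open>w\<close>.\<close>

lemma cap_word_unique_aux:
  assumes "cap_word m u v w" "cap_word m u v w'" "length w \<le> length w'"
  shows "w = w'"
proof -
  have c: "count_list w False = count_list w' False" using assms by (auto simp: cap_word_def)
  show ?thesis
  proof (cases "False \<in> set w")
    case False
    then have "False \<notin> set w'" using c by (metis count_list_0_iff)
    then have "length w = length w'" using False assms by (auto simp: cap_word_def)
    then show ?thesis using assms(1,2) unfolding cap_word_def by (metis append_eq_append_conv)
  next
    case True
    obtain z z' where "v = w @ z" "v = w' @ z'" using assms(1,2) unfolding cap_word_def by blast
    then obtain t where t: "w' = w @ t" using assms(3) by (metis append_eq_append_conv_if append_take_drop_id)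
    obtain y y' where "u = y @ w" "u = y' @ w'" using assms(1,2) unfolding cap_word_def by blast
    then have "rev w @ rev y = rev w' @ rev y'" by (metis rev_append)
    then obtain s where "rev w' = rev w @ s"
      using assms(3) by (metis append_eq_append_conv_if append_take_drop_id length_rev)
    then obtain s where s: "w' = s @ w" by (metis rev_append rev_rev_ident)
    have "False \<notin> set s" using s c by (metis add_cancel_left_left count_list_0_iff count_list_append)
    then have "takeWhile id w' = s @ takeWhile id w" using s by (metis (full_types) id_apply takeWhile_append2)
    moreover have "takeWhile id w' = takeWhile id w" using t True by (simp add: takeWhile_append1)
    ultimately show ?thesis using s by simp
  qed
qed

lemma cap_word_unique: "cap_word m u v w \<Longrightarrow> cap_word m u v w' \<Longrightarrow> w = w'"
  using cap_word_unique_aux by (metis nat_le_linear)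

lemma m_cap_strip:
  assumes "cap_word m u v w" shows "\<exists>e. m_cap m (strip c u) (strip c' v) = strip e w"
proof -
  have "is_m_cap m (strip c u) (strip c' v) (strip (0, 0) w)"
    using assms is_m_cap_strip by blast
  then have "is_m_cap m (strip c u) (strip c' v) (m_cap m (strip c u) (strip c' v))"
    unfolding m_cap_def by (rule someI)
  then obtain e w' where "m_cap m (strip c u) (strip c' v) = strip e w'" "cap_word m u v w'"
    using is_m_cap_strip by blast
  then show ?thesis using cap_word_unique[OF assms] by blast
qed

lemma amalgamate_strip:
  "amalgamate (strip e w) (strip c (y @ w)) (strip c' (w @ z)) = strip c (y @ w @ z)"
proof -
  let ?d = "strip_end c y"
  have "(+) v ` sw_restrict (card (strip e w)) (strip c' (w @ z)) = ne_restrict (card (strip e w)) (strip c (y @ w))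
      \<longleftrightarrow> v = ?d - c'" for v
    by (simp add: sw_restrict_strip ne_restrict_strip translate_strip strip_inject eq_diff_eq)
  then have "(THE v. (+) v ` sw_restrict (card (strip e w)) (strip c' (w @ z)) =
      ne_restrict (card (strip e w)) (strip c (y @ w))) = ?d - c'"
    by auto
  then show ?thesis
    unfolding amalgamate_def translate_strip by (auto simp: strip_append)
qed

lemma m_cup_strip:
  assumes "cap_word m (y @ w) (w @ z) w"
  shows "m_cup m (strip c (y @ w)) (strip c' (w @ z)) = strip c (y @ w @ z)"
proof -
  obtain e where "m_cap m (strip c (y @ w)) (strip c' (w @ z)) = strip e w"
    using m_cap_strip[OF assms] by blast
  then show ?thesis unfolding m_cup_def by (simp add: amalgamate_strip)
qed

section \<open>Words overlapping themselves and their powers\<close>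

definition repeat :: "nat \<Rightarrow> bool list \<Rightarrow> bool list" where
  "repeat n z = concat (replicate n z)"

lemma repeat_0 [simp]: "repeat 0 z = []" and repeat_Suc [simp]: "repeat (Suc n) z = z @ repeat n z"
  by (simp_all add: repeat_def)

lemma length_repeat [simp]: "length (repeat n z) = n * length z"
  by (induction n) auto

lemma repeat_add: "repeat (m + n) z = repeat m z @ repeat n z"
  by (induction m) auto

lemma repeat_Suc_right: "repeat (Suc n) z = repeat n z @ z"
  using repeat_add[of n 1 z] by simp

lemma repeat_shift: "y @ w = w @ z \<Longrightarrow> repeat n y @ w = w @ repeat n z"
proof (induction n)
  case (Suc n)
  assume eq: "y @ w = w @ z"
  then have "repeat (Suc n) y @ w = y @ w @ repeat n z" using Suc by simp
  also have "\<dots> = (w @ z) @ repeat n z" unfolding eq[symmetric] by simp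
  finally show ?case by simp
qed simp

lemma conj_word_repeat: "conj_word (repeat n z) = repeat n (conj_word z)"
proof (induction n)
  case (Suc n)
  have "conj_word (repeat (Suc n) z) = repeat n (conj_word z) @ conj_word z"
    by (simp add: conj_word_append Suc)
  then show ?case by (simp only: repeat_Suc_right)
qed (simp add: conj_word_def)

lemma set_repeat: "set (repeat n z) \<subseteq> set z"
  by (induction n) auto

text \<open>\<open>u\<close> is the word of \<alpha> and \<open>w\<close> that of its intersection
  with itself; \<open>y\<close> and \<open>z\<close> are what \<alpha> has before and after the
  overlap. The assumption \<open>rows\<close> is m < l(\<alpha>), since a ribbon has one row more
  than up steps.\<close>

locale overlap =
  fixes m :: nat and u w y z :: "bool list"
  assumes left: "u = y @ w" and right: "u = w @ z" and cap: "cap_word m u u w"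
    and rows: "m \<le> count_list u False"
begin

lemma shift: "y @ w = w @ z"
  using left right by simp

lemma count_eq: "m = Suc (count_list w False)"
  using cap by (simp add: cap_word_def)

lemma False_in_z: "False \<in> set z"
proof -
  have "count_list w False < count_list w False + count_list z False"
    using rows count_eq right by simp
  then show ?thesis by (metis add_cancel_left_right count_list_0_iff less_irrefl)
qed

lemma length_z_pos: "0 < length z"
  using False_in_z by (cases z) auto

lemma length_y: "length y = length z"
  using shift by (metis add_left_cancel add.commute length_append)

text \<open>The equation \<open>w z^k = y^k w\<close> exposes the suffix \<open>w\<close> on which
  the next copy of \<alpha> is glued.\<close>

lemma power_word: "staircase_power m (strip c u) (Suc k) = strip c (w @ repeat (Suc k) z)"
proof (induction k)
  case 0 then show ?case by (simp add: right)
next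
  case (Suc k)
  have eq: "w @ repeat (Suc k) z = repeat (Suc k) y @ w" using repeat_shift[OF shift] by metis
  have "cap_word m (repeat (Suc k) y @ w) (w @ z) w"
  proof -
    \<comment> \<open>The top row of the power is the top row of its last copy of \<alpha>, so the
      minimum that prescribes a one-row intersection is unchanged.\<close>
    have "takeWhile id (rev (repeat (Suc k) y @ w)) = takeWhile id (rev u)"
    proof -
      have "False \<in> set (rev u)" using False_in_z right by simp
      then have "takeWhile id (rev u @ rev (repeat k y)) = takeWhile id (rev u)"
        by (intro takeWhile_append1) auto
      then show ?thesis unfolding repeat_Suc_right by (simp add: left)
    qed
    then show ?thesis using cap unfolding cap_word_def right[symmetric] by auto
  qed
  from m_cup_strip[OF this, of c c]
  have "staircase_power m (strip c u) (Suc (Suc k)) = strip c (repeat (Suc k) y @ w @ z)"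
    using Suc eq by (simp add: right)
  also have "repeat (Suc k) y @ w @ z = w @ repeat (Suc (Suc k)) z"
    using eq unfolding repeat_Suc_right[of "Suc k"] by simp
  finally show ?case .
qed

lemma staircase_power_word: "1 \<le> k \<Longrightarrow> staircase_power m (strip c u) k = strip c (w @ repeat k z)"
  using power_word by (metis Suc_le_D One_nat_def)

lemma staircase_power_word_inject:
  "w @ repeat k z = w @ repeat l z \<longleftrightarrow> k = l"
  using length_z_pos by (metis length_repeat mult_cancel2 less_numeral_extra(3) same_append_eq)

lemma nontrivial: "m_cap_nontrivial m (strip c u) (strip c u)"
proof -
  obtain e where "m_cap m (strip c u) (strip c u) = strip e w" using m_cap_strip[OF cap] by blast
  moreover have "w \<noteq> u" using right length_z_pos by auto
  ultimately show ?thesis unfolding m_cap_nontrivial_def using cap is_m_cap_strip by (metis same_shape_strip_iff)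
qed

text \<open>\<open>y\<close> has as many right steps as \<open>z\<close>, and by periodicity
  \<open>w\<close> is a prefix of a power of \<open>y\<close>. The contrapositive provides the
  strict row inequality for the conjugate.\<close>

lemma no_True_if_no_True_z:
  assumes "True \<notin> set z" shows "True \<notin> set u"
proof -
  have "count_list y True = count_list z True" using arg_cong[OF shift, of "\<lambda>u. count_list u True"] by simp
  then have y: "True \<notin> set y" using assms by (metis count_list_0_iff)
  have "repeat (length w) y @ w = w @ repeat (length w) z" using repeat_shift[OF shift] .
  moreover have "length w \<le> length (repeat (length w) y)" using length_z_pos length_y by (simp add: Suc_le_eq)
  ultimately have "w = take (length w) (repeat (length w) y)"
    by (metis append_eq_append_conv_if)
  then have "set w \<subseteq> set y" by (metis set_repeat set_take_subset subset_trans)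
  then show ?thesis using y left by auto
qed

text \<open>If \<open>w\<close> is a column, its conjugate is a row, and the second assumption is
  the length demanded of a one-row intersection. The new number of rows is the number of columns of
  \<open>w\<close>, that is, its number of cells minus (m - 1).\<close>

lemma conj_overlap:
  assumes "True \<in> set u"
    and "True \<notin> set w \<Longrightarrow> length w = min (length (takeWhile Not u)) (length (takeWhile Not (rev u)))"
  shows "overlap (Suc (count_list w True)) (conj_word u) (conj_word w) (conj_word z) (conj_word y)"
proof
  show "conj_word u = conj_word z @ conj_word w" by (metis right conj_word_append)
  show "conj_word u = conj_word w @ conj_word y" by (metis left conj_word_append)
  have *: "length (takeWhile id (map Not v)) = length (takeWhile Not v)" for v
    by (simp add: takeWhile_map comp_def)
  have **: "False \<notin> set (conj_word w) \<longleftrightarrow> True \<notin> set w" by (auto simp: conj_word_def)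
  have "length (conj_word w) = min (length (takeWhile id (rev (conj_word u)))) (length (takeWhile id (conj_word u)))"
    if "False \<notin> set (conj_word w)"
    using assms(2) that unfolding ** length_conj_word by (simp add: conj_word_def rev_map *)
  then show "cap_word (Suc (count_list w True)) (conj_word u) (conj_word u) (conj_word w)"
    unfolding cap_word_def using
      \<open>conj_word u = conj_word z @ conj_word w\<close> \<open>conj_word u = conj_word w @ conj_word y\<close>
    by (intro conjI impI) (simp, blast+)
  have "True \<in> set z" using no_True_if_no_True_z assms(1) by blast
  then have "count_list z True \<noteq> 0" by (simp add: count_list_0_iff)
  then show "Suc (count_list w True) \<le> count_list (conj_word u) False" using right by simp
qed

lemma period_suffix:
  assumes "n * length z \<le> length w"
  shows "drop (n * length z) w = take (length w - n * length z) w"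
proof -
  have "drop (n * length z) (w @ repeat n z) = w"
    using repeat_shift[OF shift, of n] length_y by (metis append_eq_conv_conj length_repeat)
  then have "drop (n * length z) w @ repeat n z = w" using assms by simp
  then show ?thesis using assms by (metis append_eq_conv_conj length_drop)
qed

text \<open>Self-conjugacy of \<open>u\<close> makes \<open>w\<close> self-conjugate and exchanges
  \<open>y\<close> with \<open>z\<close>. For \<open>a \<le> Suc b\<close> the segment is
  \<open>y^n w\<close>, with conjugate \<open>w z^n\<close>, the same word. Otherwise it is
  \<open>w\<close> without its first n periods; conjugation turns it into \<open>w\<close> without
  its last n periods, and both agree by periodicity.\<close>

lemma conj_segment:
  assumes "conj_word u = u" "b < k" "a * length z \<le> length w + Suc b * length z"
  shows "conj_word (drop (a * length z) (take (length w + Suc b * length z) (w @ repeat k z))) =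
    drop (a * length z) (take (length w + Suc b * length z) (w @ repeat k z))"
proof -
  have cw: "conj_word w = w" and cy: "conj_word y = z"
    using assms(1) left right by (metis append_eq_append_conv conj_word_append length_conj_word)+
  obtain l where "k = Suc b + l" using assms(2) by (metis less_eq_Suc_le le_iff_add)
  then have t: "take (length w + Suc b * length z) (w @ repeat k z) = w @ repeat (Suc b) z"
    unfolding \<open>k = Suc b + l\<close> repeat_add by (simp del: repeat_Suc mult_Suc)
  show ?thesis
  proof (cases "a \<le> Suc b")
    case True
    then obtain n where n: "Suc b = a + n" by (metis le_iff_add)
    have "w @ repeat (Suc b) z = repeat a y @ repeat n y @ w"
      using repeat_shift[OF shift, of "Suc b"] unfolding n repeat_add by simp
    then have "drop (a * length z) (w @ repeat (Suc b) z) = repeat n y @ w" using length_y by simp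
    moreover have "conj_word (repeat n y @ w) = w @ repeat n z"
      by (simp only: conj_word_append conj_word_repeat cw cy)
    ultimately show ?thesis unfolding t by (simp only: repeat_shift[OF shift])
  next
    case False
    then obtain n where n: "a = Suc b + n" by (metis le_iff_add nat_le_linear)
    have nw: "n * length z \<le> length w" using assms(3) unfolding n by (simp add: algebra_simps)
    have "w @ repeat (Suc b) z = repeat (Suc b) y @ w"
      using repeat_shift[OF shift, of "Suc b"] by simp
    moreover have "a * length z = n * length z + length (repeat (Suc b) y)"
      unfolding n using length_y by (simp add: algebra_simps)
    ultimately have d: "drop (a * length z) (w @ repeat (Suc b) z) = drop (n * length z) w"
      by (metis append_eq_conv_conj drop_drop)
    have "conj_word (drop (n * length z) w) = take (length w - n * length z) (conj_word w)"
      unfolding conj_word_def by (simp add: take_map take_rev nw)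
    then show ?thesis unfolding t d cw using period_suffix[OF nw] by simp
  qed
qed

end

lemma overlapI:
  assumes "cap_word m u u w" "m < num_rows (strip c u)"
  shows "\<exists>y z. overlap m u w y z"
  using assms unfolding overlap_def cap_word_def by auto

text \<open>The shorter of the two end runs of right steps is both a prefix and a suffix. It serves
  as intersection when k = 1 and the conjugate of \<open>w\<close> is unsuitable.\<close>

lemma cap_word_one:
  "\<exists>w. cap_word 1 u u w"
proof -
  let ?r = "min (length (takeWhile id (rev u))) (length (takeWhile id u))"
  have tr: "take n v = replicate n True" if "n \<le> length (takeWhile id v)" for n v
  proof (rule nth_equalityI)
    show "length (take n v) = length (replicate n True)"
      using that length_takeWhile_le[of id v] by simp
    fix i assume "i < length (take n v)"
    then have "i < length (takeWhile id v)" using that by simp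
    then have "v ! i" by (metis id_apply nth_mem set_takeWhileD takeWhile_nth)
    then show "take n v ! i = replicate n True ! i" using \<open>i < length (take n v)\<close> by simp
  qed
  have 1: "u = replicate ?r True @ drop ?r u"
    using tr[of ?r u] by (metis append_take_drop_id min.cobounded2)
  have "rev u = replicate ?r True @ drop ?r (rev u)"
    using tr[of ?r "rev u"] by (metis append_take_drop_id min.cobounded1)
  then have 2: "u = rev (drop ?r (rev u)) @ replicate ?r True"
    by (metis rev_append rev_replicate rev_rev_ident)
  have "cap_word 1 u u (replicate ?r True)"
    unfolding cap_word_def by (intro conjI exI[of _ "rev (drop ?r (rev u))"] exI[of _ "drop ?r u"] 1 2)
      (auto simp: count_list_0_iff)
  then show ?thesis by blast
qed

section \<open>Degenerate end rows\<close>

lemma count_list_replicate_same: "count_list (replicate n a) a = n"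
  by (induction n) auto

lemma strip_filter:
  "{x \<in> strip c u. P x} = (\<lambda>n. strip_end c (take n u)) ` {n. n \<le> length u \<and> P (strip_end c (take n u))}"
  unfolding strip_conv by blast

lemma Collect_singletonI: "(\<And>n. P n \<longleftrightarrow> n = a) \<Longrightarrow> Collect P = {a}"
  by blast

text \<open>Row i from the bottom holds the positions after exactly i - 1 up steps; in a word
  starting with m \<ge> i up steps there is just one.\<close>

lemma row_len_leading_False:
  assumes "u = replicate m False @ v" "1 \<le> i" "i \<le> m"
  shows "row_len (strip c u) i = 1"
proof -
  have small: "count_list (take n u) False = n" if "n \<le> m" for n
    using that unfolding assms(1) by (simp add: count_list_replicate_same)
  have large: "m \<le> count_list (take n u) False" if "m \<le> n" for n
    using that unfolding assms(1) by (simp add: count_list_replicate_same)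
  have *: "count_list (take n u) False = i - 1 \<longleftrightarrow> n = i - 1" for n
  proof (cases "n \<le> m")
    case False
    then have "m \<le> count_list (take n u) False" using large by simp
    then show ?thesis using False assms(2,3) by linarith
  qed (simp add: small)
  have "{x \<in> strip c u. fst x = fst c + 1 - int i} = (\<lambda>n. strip_end c (take n u)) ` {i - 1}"
    unfolding strip_filter
  proof (rule image_cong[OF _ refl], rule Collect_singletonI)
    fix n
    have "int (count_list (take n u) False) = int i - 1 \<longleftrightarrow> n = i - 1"
      using *[of n] assms(2) by linarith
    moreover have "i - 1 \<le> length u" using assms by simp
    ultimately show "n \<le> length u \<and> fst (strip_end c (take n u)) = fst c + 1 - int i \<longleftrightarrow> n = i - 1"
      unfolding strip_end_eq by auto
  qed
  then show ?thesis by (simp add: row_len_strip)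
qed

lemma row_len_trailing_False:
  assumes "u = v @ replicate m False" "1 \<le> i" "i \<le> m"
  shows "row_len (strip c u) (num_rows (strip c u) + 1 - i) = 1"
proof -
  have small: "count_list (drop (length u - n) u) False = n" if "n \<le> m" for n
    using that unfolding assms(1) by (simp add: count_list_replicate_same)
  have large: "m \<le> count_list (drop (length u - n) u) False" if "m \<le> n" "n \<le> length u" for n
  proof -
    have "length u - n \<le> length v" using that assms(1) by simp
    then show ?thesis unfolding assms(1) by (simp add: count_list_replicate_same)
  qed
  have *: "count_list (drop (length u - n) u) False = i - 1 \<longleftrightarrow> n = i - 1" if "n \<le> length u" for n
  proof (cases "n \<le> m")
    case False
    then have "m \<le> count_list (drop (length u - n) u) False" using large that by simp
    then show ?thesis using False assms(2,3) by linarith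
  qed (simp add: small)
  have iu: "i - 1 \<le> length u" using assms by simp
  have "{x \<in> strip c u. fst x = fst c + 1 - int (num_rows (strip c u) + 1 - i)} =
      (\<lambda>n. strip_end c (take n u)) ` {length u - (i - 1)}"
    unfolding strip_filter
  proof (rule image_cong[OF _ refl], rule Collect_singletonI)
    fix n
    have "count_list (drop n u) False = i - 1 \<longleftrightarrow> n = length u - (i - 1)" if "n \<le> length u"
      using *[of "length u - n"] that iu by auto
    moreover have "count_list u False = count_list (take n u) False + count_list (drop n u) False"
      by (metis append_take_drop_id count_list_append)
    moreover have "i \<le> count_list u False" using assms by (simp add: count_list_replicate_same)
    ultimately show "n \<le> length u \<and> fst (strip_end c (take n u)) = fst c + 1 - int (num_rows (strip c u) + 1 - i)
        \<longleftrightarrow> n = length u - (i - 1)"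
      using assms(2) unfolding strip_end_eq num_rows_strip by auto
  qed
  then show ?thesis unfolding row_len_strip by simp
qed

lemma degenerate_ends_strip:
  assumes "u = replicate m False @ v" "u = v' @ replicate m False" "k = 1 \<Longrightarrow> True \<notin> set u"
  shows "degenerate_ends m k (strip c u)"
  unfolding degenerate_ends_def
  using row_len_leading_False[OF assms(1)] row_len_trailing_False[OF assms(2)] assms(3)
  by (auto simp: count_list_0_iff)

context overlap begin

lemma True_in_u_if_nondegenerate:
  assumes "\<not> degenerate_ends m k (strip c u)" shows "True \<in> set u"
proof (rule ccontr)
  assume no: "True \<notin> set u"
  then have u: "u = replicate (length u) False" by (intro replicate_eqI) auto
  have "m \<le> length u" using rows count_list_bool[of u] by linarith
  then have "replicate (length u) False = replicate m False @ replicate (length u - m) False"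
    "replicate (length u) False = replicate (length u - m) False @ replicate m False"
    by (simp_all flip: replicate_add)
  then show False using degenerate_ends_strip u no assms by metis
qed

text \<open>If \<open>z\<close> began and \<open>y\<close> ended with an up step, then
  \<open>u\<close> would begin and end with length w + 1 = m up steps, the degenerate case. So one
  of the two end runs of up steps is no longer than \<open>w\<close>.\<close>

lemma min_end_columns_if_nondegenerate:
  assumes "\<not> degenerate_ends m k (strip c u)" "k \<noteq> 1" "True \<notin> set w"
  shows "length w = min (length (takeWhile Not u)) (length (takeWhile Not (rev u)))"
proof -
  have w: "w = replicate (length w) False" using assms(3) by (intro replicate_eqI) auto
  have m: "m = Suc (length w)" using count_eq count_list_bool[of w] assms(3) by (simp add: count_notin)
  have "takeWhile Not u = w @ takeWhile Not z"
    unfolding right using assms(3) by (intro takeWhile_append2) auto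
  moreover have "takeWhile Not (rev u) = rev w @ takeWhile Not (rev y)"
    unfolding left rev_append using assms(3) by (intro takeWhile_append2) auto
  moreover have "takeWhile Not z = [] \<or> takeWhile Not (rev y) = []"
  proof (rule ccontr)
    assume "\<not> ?thesis"
    then obtain z' y' where "z = False # z'" "rev y = False # y'"
      by (cases z; cases "rev y") (auto split: if_splits)
    then have "u = (w @ [False]) @ z'" "u = rev y' @ ([False] @ w)" using left right by auto
    moreover have "w @ [False] = replicate m False" "[False] @ w = replicate m False"
      using w m by (metis replicate_append_same replicate_Suc, metis append_Cons append_Nil replicate_Suc)
    ultimately show False using degenerate_ends_strip assms(1,2) by metis
  qed
  ultimately show ?thesis by auto
qed

end

section \<open>Symmetries and laminarity of ribbon decompositions\<close>

fun opposite :: "side \<Rightarrow> side" where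
  "opposite SE = NW" | "opposite NW = SE"

text \<open>Instantiated by the reflection, which keeps the southeast and northwest borders in
  place, and by the half turn, which exchanges them; \<open>f\<close> records the effect on the
  side. Both exchange southwest and northeast.\<close>

locale diagram_symmetry =
  fixes h :: "cell \<Rightarrow> cell" and f :: "side \<Rightarrow> side"
  assumes involution [simp]: "h (h c) = c"
    and border: "border_ribbon (f x) (h ` D) = h ` border_ribbon x D"
    and north_east: "(\<forall>A B. strictly_north_east (h ` B) (h ` A) \<longleftrightarrow> strictly_north_east B A) \<or>
      (\<forall>A B. strictly_north_east (h ` B) (h ` A) \<longleftrightarrow> strictly_north_east A B)"
begin

lemma image_involution [simp]: "h ` h ` A = A"
  by (simp add: image_image)

lemma inj_h: "inj h"
  by (metis injI involution)

lemma connected_image: "diagram_connected C \<Longrightarrow> diagram_connected (h ` C)"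
proof (rule ccontr)
  assume con: "diagram_connected C" and "\<not> diagram_connected (h ` C)"
  then obtain D1 D2 where D: "D1 \<noteq> {}" "D2 \<noteq> {}" "h ` C = D1 \<union> D2" "strictly_north_east D2 D1"
    unfolding diagram_connected_def by blast
  have C: "C = h ` D1 \<union> h ` D2" using D(3) by (metis image_Un image_involution)
  have "strictly_north_east (h ` D2) (h ` D1) \<or> strictly_north_east (h ` D1) (h ` D2)"
    using north_east D(4) by blast
  then show False using con C D(1,2) unfolding diagram_connected_def by (metis Un_commute image_is_empty)
qed

lemma components_image: "C \<in> diagram_components D \<Longrightarrow> h ` C \<in> diagram_components (h ` D)"
proof -
  assume "C \<in> diagram_components D"
  then obtain A B where C: "C \<noteq> {}" "diagram_connected C" "D = A \<union> C \<union> B"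
    "strictly_north_east C A" "strictly_north_east B C" by (auto simp: diagram_components_def)
  have "h ` D = h ` A \<union> h ` C \<union> h ` B" "h ` D = h ` B \<union> h ` C \<union> h ` A" using C(3) by auto
  moreover have "(strictly_north_east (h ` C) (h ` A) \<and> strictly_north_east (h ` B) (h ` C)) \<or>
    (strictly_north_east (h ` C) (h ` B) \<and> strictly_north_east (h ` A) (h ` C))"
    using north_east C(4,5) by blast
  ultimately have "\<exists>A B. h ` D = A \<union> h ` C \<union> B \<and> strictly_north_east (h ` C) A \<and> strictly_north_east B (h ` C)"
    by blast
  then show ?thesis using C(1,2) connected_image unfolding diagram_components_def by auto
qed

lemma in_decomposition_image:
  "in_decomposition x D R \<Longrightarrow> in_decomposition (f x) (h ` D) (h ` R)"
proof (induction rule: in_decomposition.induct)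
  case (first D)
  then show ?case using in_decomposition.first[of "h ` D" "f x"] by (simp add: border)
next
  case (later C D R)
  have "h ` C \<in> diagram_components (h ` D - border_ribbon (f x) (h ` D))"
    using components_image[OF later.hyps(1)] by (simp add: border image_set_diff[OF inj_h])
  then show ?case using in_decomposition.later later.IH by blast
qed

lemma ribbon_decomposition_image:
  assumes "f (f x) = x"
  shows "ribbon_decomposition (f x) (h ` D) = (`) h ` ribbon_decomposition x D"
proof (intro subset_antisym subsetI)
  fix R assume "R \<in> ribbon_decomposition (f x) (h ` D)"
  then have "h ` R \<in> ribbon_decomposition x D"
    using in_decomposition_image[of "f x" "h ` D" R] assms by (simp add: ribbon_decomposition_def)
  then show "R \<in> (`) h ` ribbon_decomposition x D" by (metis image_eqI image_involution)
qed (auto simp: ribbon_decomposition_def in_decomposition_image)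

end

lemma swap_in_image: "(i, j) \<in> prod.swap ` D \<longleftrightarrow> (j, i) \<in> D"
  by force

interpretation conj: diagram_symmetry prod.swap "\<lambda>x. x"
proof
  fix x D show "border_ribbon x (prod.swap ` D) = prod.swap ` border_ribbon x D"
    by (cases x) (simp_all add: set_eq_iff swap_in_image)
next
  show "(\<forall>A B. strictly_north_east (prod.swap ` B) (prod.swap ` A) \<longleftrightarrow> strictly_north_east B A) \<or>
      (\<forall>A B. strictly_north_east (prod.swap ` B) (prod.swap ` A) \<longleftrightarrow> strictly_north_east A B)"
    unfolding strictly_north_east_def by auto
qed simp

lemma in_uminus_image [simp]: "(i, j) \<in> uminus ` D \<longleftrightarrow> (- i, - j) \<in> (D :: cell set)"
proof
  assume "(- i, - j) \<in> D"
  then have "- (- i, - j) \<in> uminus ` D" by (rule imageI)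
  then show "(i, j) \<in> uminus ` D" by simp
qed auto

interpretation rot: diagram_symmetry uminus opposite
proof
  fix x and D :: "cell set" show "border_ribbon (opposite x) (uminus ` D) = uminus ` border_ribbon x D"
    by (cases x) (simp_all add: set_eq_iff)
next
  show "(\<forall>A B. strictly_north_east (uminus ` B) (uminus ` A) \<longleftrightarrow> strictly_north_east B A) \<or>
      (\<forall>A B. strictly_north_east (uminus ` B) (uminus ` A) \<longleftrightarrow> strictly_north_east A B)"
    unfolding strictly_north_east_def by (auto simp: uminus_prod_def)
qed simp

lemma order_convex_conj: "order_convex D \<Longrightarrow> order_convex (conj_diagram D)"
  unfolding order_convex_def in_conj_diagram by blast

lemma order_convex_uminus:
  assumes "order_convex D" shows "order_convex (uminus ` D)"
  unfolding order_convex_def in_uminus_image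
proof (intro allI impI, elim conjE)
  fix i j i' j' a b assume "(- i, - j) \<in> D" "(- i', - j') \<in> D" "i \<le> a" "a \<le> i'" "j \<le> b" "b \<le> j'"
  then show "(- a, - b) \<in> D" using order_convexD[OF assms, of "- i'" "- j'" "- i" "- j" "- a" "- b"] by simp
qed

abbreviation segment :: "side \<Rightarrow> cell set \<Rightarrow> int \<Rightarrow> int \<Rightarrow> cell set" where
  "segment x D p q \<equiv> {c \<in> border_ribbon x D. p \<le> diag_of c \<and> diag_of c \<le> q}"

section \<open>Laminarity of the occupied diagonals\<close>

lemma border_ribbon_subset: "border_ribbon x D \<subseteq> D"
  by (cases x) auto

lemma component_subset: "C \<in> diagram_components D \<Longrightarrow> C \<subseteq> D"
  by (auto simp: diagram_components_def)

lemma in_decomposition_subset: "in_decomposition x D R \<Longrightarrow> R \<subseteq> D"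
  by (induction rule: in_decomposition.induct) (use border_ribbon_subset component_subset in blast)+

text \<open>The last cell of a diagonal lies on the southeast border, the first one on the northwest
  border.\<close>

lemma diag_of_border:
  assumes "finite D" shows "diag_of ` border_ribbon x D = diag_of ` D"
proof (intro subset_antisym subsetI)
  fix d assume "d \<in> diag_of ` D"
  let ?S = "{i. (i, i + d) \<in> D}"
  have "?S \<subseteq> fst ` D" by force
  then have fin: "finite ?S" using assms finite_subset by blast
  obtain i j where "(i, j) \<in> D" "d = j - i" using \<open>d \<in> diag_of ` D\<close> by (auto simp: diag_of_def)
  then have "i \<in> ?S" by simp
  then have ne: "?S \<noteq> {}" by blast
  have "(Max ?S, Max ?S + d) \<in> border_ribbon SE D"
    using Max_in[OF fin ne] Max_ge[OF fin, of "Max ?S + 1"] by (auto simp: algebra_simps)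
  moreover have "(Min ?S, Min ?S + d) \<in> border_ribbon NW D"
    using Min_in[OF fin ne] Min_le[OF fin, of "Min ?S - 1"] by (auto simp: algebra_simps)
  ultimately have "\<exists>i. (i, i + d) \<in> border_ribbon x D" by (cases x) blast+
  then show "d \<in> diag_of ` border_ribbon x D" by (force simp: diag_of_def)
qed (use border_ribbon_subset in blast)

lemma order_convex_minus_border:
  assumes "order_convex D" shows "order_convex (D - border_ribbon x D)"
proof (cases x)
  case SE
  have "D - border_ribbon x D = {(i, j). (i, j) \<in> D \<and> (i + 1, j + 1) \<in> D}" using SE by auto
  then show ?thesis using order_convexD[OF assms] unfolding order_convex_def
    by simp (meson add_le_cancel_right order_trans)
next
  case NW
  have "D - border_ribbon x D = {(i, j). (i, j) \<in> D \<and> (i - 1, j - 1) \<in> D}" using NW by auto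
  then show ?thesis using order_convexD[OF assms] unfolding order_convex_def
    by simp (meson diff_right_mono order_trans)
qed

lemma order_convex_summand:
  assumes D: "order_convex D" "D = A \<union> C \<union> B" and ne: "strictly_north_east C A" "strictly_north_east B C"
  shows "order_convex C"
  unfolding order_convex_def
proof (intro allI impI, elim conjE)
  fix i j i' j' a b assume *: "(i, j) \<in> C" "(i', j') \<in> C" "i \<le> a" "a \<le> i'" "j \<le> b" "b \<le> j'"
  then have "(a, b) \<in> D" using order_convexD[OF D(1), of i j i' j' a b] D(2) by auto
  moreover have "(a, b) \<notin> A" "(a, b) \<notin> B"
    using ne * unfolding strictly_north_east_def by force+
  ultimately show "(a, b) \<in> C" using D(2) by blast
qed

lemma order_convex_component:
  assumes "order_convex D" "C \<in> diagram_components D" shows "order_convex C"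
proof -
  obtain A B where "D = A \<union> C \<union> B" "strictly_north_east C A" "strictly_north_east B C"
    using assms(2) by (auto simp: diagram_components_def)
  then show ?thesis by (rule order_convex_summand[OF assms(1)])
qed

text \<open>A cell off the border has a diagonal neighbour in \<open>D\<close>; by convexity the 2x2
  block spanned by the two lies in \<open>D\<close> and meets both adjacent diagonals.\<close>

lemma minus_border_diags:
  assumes "order_convex D" "c \<in> D - border_ribbon x D"
  shows "diag_of c - 1 \<in> diag_of ` D \<and> diag_of c + 1 \<in> diag_of ` D"
proof -
  obtain i j where c: "c = (i, j)" by fastforce
  show ?thesis
  proof (cases x)
    case SE
    then have "(i, j) \<in> D" "(i + 1, j + 1) \<in> D" using assms(2) c by auto
    then have "(i + 1, j) \<in> D" "(i, j + 1) \<in> D"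
      using order_convexD[OF assms(1), of i j "i + 1" "j + 1"] by auto
    then show ?thesis by (force simp: c diag_of_def)
  next
    case NW
    then have "(i, j) \<in> D" "(i - 1, j - 1) \<in> D" using assms(2) c by auto
    then have "(i - 1, j) \<in> D" "(i, j - 1) \<in> D"
      using order_convexD[OF assms(1), of "i - 1" "j - 1" i j] by auto
    then show ?thesis by (force simp: c diag_of_def)
  qed
qed

text \<open>Strict containment at both ends, phrased without naming end points so that it passes to
  subsets of \<open>A\<close>.\<close>

definition inside :: "int set \<Rightarrow> int set \<Rightarrow> bool" where
  "inside A B \<longleftrightarrow> (\<exists>b\<in>B. \<forall>a\<in>A. b < a) \<and> (\<exists>b\<in>B. \<forall>a\<in>A. a < b)"

lemma inside_subset: "inside A B \<Longrightarrow> A' \<subseteq> A \<Longrightarrow> inside A' B"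
  unfolding inside_def by blast

lemma component_inside:
  assumes "finite D" "order_convex D" "C \<in> diagram_components (D - border_ribbon x D)"
  shows "inside (diag_of ` C) (diag_of ` D)"
proof -
  have C: "C \<subseteq> D - border_ribbon x D" "C \<noteq> {}" using assms(3) by (auto simp: diagram_components_def)
  then have fin: "finite (diag_of ` C)" "diag_of ` C \<noteq> {}" using assms(1) by (auto intro: finite_subset)
  obtain a where a: "a \<in> C" "diag_of a = Min (diag_of ` C)" using Min_in[OF fin] by force
  obtain b where b: "b \<in> C" "diag_of b = Max (diag_of ` C)" using Max_in[OF fin] by force
  have "diag_of a - 1 \<in> diag_of ` D" "diag_of b + 1 \<in> diag_of ` D"
    using minus_border_diags[OF assms(2)] a(1) b(1) C by blast+
  moreover have "\<forall>d\<in>diag_of ` C. diag_of a - 1 < d" "\<forall>d\<in>diag_of ` C. d < diag_of b + 1"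
    using Min_le[OF fin(1)] Max_ge[OF fin(1)] a(2) b(2) by fastforce+
  ultimately show ?thesis unfolding inside_def by blast
qed

text \<open>The parts \<open>A\<close> and \<open>B\<close> on either side of \<open>C'\<close> miss
  the diagonals of \<open>C'\<close>, so \<open>C\<close> meets \<open>C'\<close>; being connected,
  \<open>C\<close> cannot extend beyond it.\<close>

lemma components_disjoint_aux:
  assumes "C \<in> diagram_components D" "C' \<in> diagram_components D" "diag_of ` C \<inter> diag_of ` C' \<noteq> {}"
  shows "C \<subseteq> C'"
proof (rule ccontr)
  assume ns: "\<not> C \<subseteq> C'"
  obtain A B where C': "D = A \<union> C' \<union> B" "strictly_north_east C' A" "strictly_north_east B C'" "C' \<noteq> {}"
    using assms(2) by (auto simp: diagram_components_def)
  have con: "diagram_connected C" and CD: "C \<subseteq> D" using assms(1) component_subset by (auto simp: diagram_components_def)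
  obtain c c' where c: "c \<in> C" "c' \<in> C'" "diag_of c = diag_of c'" using assms(3) by auto
  have cA: "c \<notin> A" using diag_less_if_strictly_north_east[OF C'(2) _ c(2), of c] c(3) by auto
  have cB: "c \<notin> B" using diag_less_if_strictly_north_east[OF C'(3) c(2), of c] c(3) by auto
  have cC': "c \<in> C'" using cA cB c(1) CD C'(1) by blast
  have AB: "strictly_north_east B A"
    unfolding strictly_north_east_def
  proof (intro ballI)
    fix b a assume "b \<in> B" "a \<in> A"
    then have "fst b < fst c'" "snd c' < snd b" "fst c' < fst a" "snd a < snd c'"
      using C'(2,3) c(2) unfolding strictly_north_east_def by blast+
    then show "fst b < fst a \<and> snd a < snd b" by simp
  qed
  have split: False if "C = D1 \<union> D2" "D1 \<noteq> {}" "D2 \<noteq> {}" "strictly_north_east D2 D1" for D1 D2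
    using con that unfolding diagram_connected_def by blast
  from ns obtain e where e: "e \<in> C" "e \<notin> C'" by blast
  show False
  proof (cases "e \<in> A")
    case True
    show False
    proof (rule split)
      show "C = (C \<inter> A) \<union> (C \<inter> (C' \<union> B))" using CD C'(1) by blast
      show "C \<inter> A \<noteq> {}" using True e(1) by blast
      show "C \<inter> (C' \<union> B) \<noteq> {}" using c(1) cC' by blast
      show "strictly_north_east (C \<inter> (C' \<union> B)) (C \<inter> A)"
        using C'(2) AB unfolding strictly_north_east_def by blast
    qed
  next
    case False
    show False
    proof (rule split)
      show "C = (C \<inter> (A \<union> C')) \<union> (C \<inter> B)" using CD C'(1) by blast
      show "C \<inter> B \<noteq> {}" using False e CD C'(1) by blast
      show "C \<inter> (A \<union> C') \<noteq> {}" using c(1) cC' by blast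
      show "strictly_north_east (C \<inter> B) (C \<inter> (A \<union> C'))"
        using C'(3) AB unfolding strictly_north_east_def by blast
    qed
  qed
qed

lemma components_disjoint:
  assumes "C \<in> diagram_components D" "C' \<in> diagram_components D" "C \<noteq> C'"
  shows "diag_of ` C \<inter> diag_of ` C' = {}"
  using components_disjoint_aux[OF assms(1,2)] components_disjoint_aux[OF assms(2,1)] assms(3) by blast

text \<open>The border occupies all diagonals of \<open>D\<close>, a component of the rest only
  diagonals strictly between the extreme ones, and distinct components share none. Induction carries
  this to all ribbons.\<close>

lemma in_decomposition_laminar:
  assumes "in_decomposition x D R" "in_decomposition x D S" "finite D" "order_convex D"
  shows "R = S \<or> diag_of ` R \<inter> diag_of ` S = {} \<or> inside (diag_of ` R) (diag_of ` S) \<or>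
    inside (diag_of ` S) (diag_of ` R)"
  using assms
proof (induction arbitrary: S rule: in_decomposition.induct)
  case (first D)
  from first.prems(1) show ?case
  proof cases
    case first then show ?thesis by simp
  next
    case (later C)
    then have "inside (diag_of ` S) (diag_of ` D)"
      using component_inside[OF first.prems(2,3)] in_decomposition_subset inside_subset by (metis image_mono)
    then show ?thesis using diag_of_border[OF first.prems(2)] by simp
  qed
next
  case (later C D R)
  note hyps = later.hyps and IH = later.IH and fin = later.prems(2) and cvx = later.prems(3)
  have CD: "finite C" "order_convex C"
    using fin component_subset[OF hyps(1)] finite_subset
      order_convex_component[OF order_convex_minus_border[OF cvx] hyps(1)] by blast+
  have RC: "R \<subseteq> C" using in_decomposition_subset hyps(2) by blast
  from later.prems(1) show ?case
  proof cases
    case first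
    have "inside (diag_of ` R) (diag_of ` D)"
      using component_inside[OF fin cvx hyps(1)] inside_subset RC by (metis image_mono)
    then show ?thesis using diag_of_border[OF fin] first by simp
  next
    case (later C')
    show ?thesis
    proof (cases "C = C'")
      case True
      then show ?thesis using IH[of S] later CD by blast
    next
      case False
      then have "diag_of ` C \<inter> diag_of ` C' = {}" using components_disjoint hyps(1) later(1) by blast
      moreover have "S \<subseteq> C'" using in_decomposition_subset later(2) by blast
      ultimately show ?thesis using RC by blast
    qed
  qed
qed

lemma decomposition_intervals:
  assumes "R \<in> ribbon_decomposition x D" "S \<in> ribbon_decomposition x D" "R \<noteq> S" "finite D" "order_convex D"
    and "diag_of ` R = {p..q}" "diag_of ` S = {p'..q'}" "p \<le> q" "p' \<le> q'"
  shows "p \<noteq> p'" "q \<noteq> q'" "\<not> (p < p' \<and> p' \<le> q \<and> q < q')"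
proof -
  have "{p..q} \<inter> {p'..q'} = {} \<or> inside {p..q} {p'..q'} \<or> inside {p'..q'} {p..q}"
    using in_decomposition_laminar[of x D R S] assms by (simp add: ribbon_decomposition_def)
  moreover have "c < a \<and> b < d" if "inside {a..b} {c..d}" "a \<le> b" for a b c d
  proof -
    have "\<exists>x\<in>{c..d}. \<forall>e\<in>{a..b}. x < e" "\<exists>y\<in>{c..d}. \<forall>e\<in>{a..b}. e < y"
      using that(1) unfolding inside_def by simp_all
    moreover have "a \<in> {a..b}" "b \<in> {a..b}" using that(2) by auto
    ultimately have "\<exists>x\<in>{c..d}. x < a" "\<exists>y\<in>{c..d}. b < y" by fast+
    then show ?thesis by auto
  qed
  ultimately have "{p..q} \<inter> {p'..q'} = {} \<or> p' < p \<and> q < q' \<or> p < p' \<and> q' < q"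
    using assms(8,9) by blast
  then show "p \<noteq> p'" "q \<noteq> q'" "\<not> (p < p' \<and> p' \<le> q \<and> q < q')" using assms(8,9) by auto
qed

section \<open>Conjugating a ribbon staircase decomposition\<close>

text \<open>A pair \<open>(i, l)\<close> stands for a ribbon made of the copies i+1, ..., i+l, with
  parentheses in positions i and i + l; l = 0 stands for the intersection of copies i and i+1. This
  treats parentheses and slashes uniformly; the order of the tests is that of
  \<open>letter_at\<close>.\<close>

definition nesting_word :: "(nat \<times> nat) set \<Rightarrow> nat \<Rightarrow> nesting_letter list" where
  "nesting_word B k = map (\<lambda>i. if \<exists>l>0. (i, l) \<in> B then LParen
     else if \<exists>i'<i. (i', i - i') \<in> B then RParen
     else if (i, 0) \<in> B then Bar else Dot) [1..<k]"

lemma mirror_letter_if: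
  assumes "\<not> (A \<and> B)" "\<not> (A \<and> C)" "\<not> (B \<and> C)"
  shows "(if A then LParen else if B then RParen else if C then Bar else Dot) =
    mirror_letter (if B then LParen else if A then RParen else if C then Bar else Dot)"
  using assms by auto

lemma ex_conj_cong:
  assumes "\<And>e. Q (f e) \<longleftrightarrow> h e" shows "(\<exists>e. R = f e) \<and> Q R \<longleftrightarrow> (\<exists>e. R = f e \<and> h e)"
  using assms by blast

text \<open>Position i goes to k - i, which exchanges the start i and the end i + l of a block. The
  tests in \<open>nesting_word\<close> prefer left parentheses and are not symmetric; the last three
  assumptions ensure that no position competes for two letters.\<close>

lemma nesting_word_mirror:
  assumes bound: "\<And>i l. (i, l) \<in> B \<Longrightarrow> 1 \<le> i \<and> i + l < k"
    and start: "\<And>i l l'. (i, l) \<in> B \<Longrightarrow> (i, l') \<in> B \<Longrightarrow> l = l'"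
    and stop: "\<And>i l i' l'. (i, l) \<in> B \<Longrightarrow> (i', l') \<in> B \<Longrightarrow> i + l = i' + l' \<Longrightarrow> i = i'"
    and cross: "\<And>i l i' l'. (i, l) \<in> B \<Longrightarrow> (i', l') \<in> B \<Longrightarrow> i' < i \<Longrightarrow> i' + l' = i \<Longrightarrow> l = 0"
  shows "nesting_word ((\<lambda>(i, l). (k - i - l, l)) ` B) k = reverse_nesting (nesting_word B k)"
proof (rule nth_equalityI)
  let ?B = "(\<lambda>(i, l). (k - i - l, l)) ` B"
  show len: "length (nesting_word ?B k) = length (reverse_nesting (nesting_word B k))"
    by (simp add: nesting_word_def reverse_nesting_def)
  fix n assume "n < length (nesting_word ?B k)"
  then have n: "n < k - 1" by (simp add: nesting_word_def)
  define j where "j = Suc n"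
  define i where "i = k - j"
  have ij: "1 \<le> i" "i < k" "1 \<le> j" "j < k" "j = k - i" using n by (auto simp: i_def j_def)
  have inB: "(a, l) \<in> ?B \<longleftrightarrow> a + l < k \<and> 1 \<le> a \<and> (k - a - l, l) \<in> B" for a l
  proof
    assume "(a, l) \<in> ?B"
    then obtain i' where "(i', l) \<in> B" "a = k - i' - l" by auto
    then show "a + l < k \<and> 1 \<le> a \<and> (k - a - l, l) \<in> B" using bound[of i' l] by auto
  next
    assume *: "a + l < k \<and> 1 \<le> a \<and> (k - a - l, l) \<in> B"
    then show "(a, l) \<in> ?B" by (intro image_eqI[of _ _ "(k - a - l, l)"]) auto
  qed
  have L: "(\<exists>l>0. (j, l) \<in> ?B) \<longleftrightarrow> (\<exists>i'<i. (i', i - i') \<in> B)"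
  proof
    assume "\<exists>l>0. (j, l) \<in> ?B"
    then obtain l where l: "l > 0" "j + l < k" "(k - j - l, l) \<in> B" using inB by blast
    moreover have "k - j - l = i - l" "i - (i - l) = l" using l by (auto simp: i_def)
    ultimately have "i - l < i \<and> (i - l, i - (i - l)) \<in> B" using ij by simp
    then show "\<exists>i'<i. (i', i - i') \<in> B" by blast
  next
    assume "\<exists>i'<i. (i', i - i') \<in> B"
    then obtain i' where i': "i' < i" "(i', i - i') \<in> B" by blast
    then have "1 \<le> i'" using bound by blast
    moreover have "k - j - (i - i') = i'" "j + (i - i') < k" using \<open>1 \<le> i'\<close> i'(1) ij(1-4) i_def by arith+
    ultimately have "(j, i - i') \<in> ?B" unfolding inB using i' ij(3) by simp
    moreover have "i - i' > 0" using i' by simp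
    ultimately show "\<exists>l>0. (j, l) \<in> ?B" by blast
  qed
  have R: "(\<exists>j'<j. (j', j - j') \<in> ?B) \<longleftrightarrow> (\<exists>l>0. (i, l) \<in> B)"
  proof
    assume "\<exists>j'<j. (j', j - j') \<in> ?B"
    then obtain j' where j': "j' < j" "(k - j' - (j - j'), j - j') \<in> B" using inB by blast
    moreover have "k - j' - (j - j') = i" "0 < j - j'" using j' by (simp_all add: i_def)
    ultimately have "0 < j - j' \<and> (i, j - j') \<in> B" by simp
    then show "\<exists>l>0. (i, l) \<in> B" by blast
  next
    assume "\<exists>l>0. (i, l) \<in> B"
    then obtain l where l: "l > 0" "(i, l) \<in> B" by blast
    then have b: "i + l < k" using bound by blast
    then have "j - (j - l) = l" "j - l + l < k" "1 \<le> j - l" "k - (j - l) - l = i" "j - l < j"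
      using l b ij(1-4) i_def by arith+
    then have "j - l < j \<and> (j - l, j - (j - l)) \<in> ?B" unfolding inB using l by simp
    then show "\<exists>j'<j. (j', j - j') \<in> ?B" by blast
  qed
  have Z: "(j, 0) \<in> ?B \<longleftrightarrow> (i, 0) \<in> B" unfolding inB i_def using ij by auto
  have LR: "\<not> ((\<exists>i'<i. (i', i - i') \<in> B) \<and> (\<exists>l>0. (i, l) \<in> B))"
    using cross by fastforce
  have RB: "\<not> ((\<exists>i'<i. (i', i - i') \<in> B) \<and> (i, 0) \<in> B)" using stop[of _ _ i 0] by fastforce
  have LB: "\<not> ((\<exists>l>0. (i, l) \<in> B) \<and> (i, 0) \<in> B)" using start by fastforce
  have "nesting_word ?B k ! n = (if \<exists>l>0. (j, l) \<in> ?B then LParen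
     else if \<exists>j'<j. (j', j - j') \<in> ?B then RParen else if (j, 0) \<in> ?B then Bar else Dot)"
    unfolding nesting_word_def using n by (simp add: j_def)
  also have "\<dots> = mirror_letter (nesting_word B k ! (i - 1))"
  proof -
    have "[1..<k] ! (i - 1) = i" "i - 1 < length [1..<k]" using ij(1,2) by simp_all
    then have "nesting_word B k ! (i - 1) = (if \<exists>l>0. (i, l) \<in> B then LParen
       else if \<exists>i'<i. (i', i - i') \<in> B then RParen else if (i, 0) \<in> B then Bar else Dot)"
      unfolding nesting_word_def by (simp only: nth_map)
    then show ?thesis unfolding L R Z using mirror_letter_if[OF LR RB LB] by (simp only:)
  qed
  also have "\<dots> = reverse_nesting (nesting_word B k) ! n"
    unfolding reverse_nesting_def using n
    by (simp add: rev_nth nesting_word_def i_def j_def)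
  finally show "nesting_word ?B k ! n = reverse_nesting (nesting_word B k) ! n" .
qed

context overlap begin

text \<open>\<open>P\<close> is the first diagonal of the border ribbon. Consecutive copies of
  \<alpha> start \<open>length z\<close> diagonals apart, so this says that \<open>R\<close> is
  lined up with the copies i+1, ..., i+l, or with the intersection of copies i and i+1 if l =
  0.\<close>

definition block :: "int \<Rightarrow> cell set \<Rightarrow> nat \<Rightarrow> nat \<Rightarrow> bool" where
  "block P R i l \<longleftrightarrow> (\<exists>e. R = strip e (w @ repeat l z) \<and> diag_of e = P + int i * int (length z))"

lemma block_diags:
  assumes "block P R i l"
  shows "diag_of ` R =
    {P + int i * int (length z)..P + int i * int (length z) + int (length w) + int l * int (length z)}"
proof -
  obtain e where "R = strip e (w @ repeat l z)" "diag_of e = P + int i * int (length z)"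
    using assms unfolding block_def by blast
  then show ?thesis by (simp add: diag_of_image_strip add.assoc)
qed

lemma block_unique: "block P R i l \<Longrightarrow> block P R i' l' \<Longrightarrow> i = i' \<and> l = l'"
  unfolding block_def using strip_inject staircase_power_word_inject length_z_pos
  by (metis add_left_cancel mult_cancel2 of_nat_eq_iff of_nat_mult less_irrefl_nat)

context
  fixes c \<theta> :: cell and k :: nat and T :: "cell set"
  assumes T: "T = strip \<theta> (w @ repeat k z)"
begin

lemma copy_diags_eq:
  "copy_diags m (strip c u) T i =
    {diag_of \<theta> + (int i - 1) * int (length z)..diag_of \<theta> + (int i - 1) * int (length z) + int (length u)}"
proof -
  have "Min (diag_of ` T) = diag_of \<theta>" unfolding T diag_of_image_strip by (intro Min_eqI) auto
  moreover obtain e where "m_cap m (strip c u) (strip c u) = strip e w" using m_cap_strip[OF cap] by blast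
  moreover have "length u = length w + length z" by (simp add: right)
  ultimately show ?thesis unfolding copy_diags_def Let_def by auto
qed

lemma union_copy_diags_eq:
  assumes "i < j"
  shows "(\<Union>l\<in>{i + 1..j}. copy_diags m (strip c u) T l) =
    {diag_of \<theta> + int i * int (length z)..diag_of \<theta> + (int j - 1) * int (length z) + int (length u)}"
  using assms
proof (induction j)
  case (Suc j)
  show ?case
  proof (cases "i = j")
    case True
    then show ?thesis by (simp add: copy_diags_eq)
  next
    case False
    then have "i < j" using Suc by simp
    then have "{i + 1..Suc j} = insert (Suc j) {i + 1..j}" by auto
    then have "(\<Union>l\<in>{i + 1..Suc j}. copy_diags m (strip c u) T l) =
        copy_diags m (strip c u) T (Suc j) \<union>
        {diag_of \<theta> + int i * int (length z)..diag_of \<theta> + (int j - 1) * int (length z) + int (length u)}"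
      using Suc.IH[OF \<open>i < j\<close>] by simp
    also have "copy_diags m (strip c u) T (Suc j) =
        {diag_of \<theta> + int j * int (length z)..diag_of \<theta> + int j * int (length z) + int (length u)}"
      by (simp add: copy_diags_eq)
    also have "\<dots> \<union> {diag_of \<theta> + int i * int (length z)..diag_of \<theta> + (int j - 1) * int (length z) + int (length u)} =
        {diag_of \<theta> + int i * int (length z)..diag_of \<theta> + int j * int (length z) + int (length u)}"
    proof -
      have "int i * int (length z) \<le> int j * int (length z)" using \<open>i < j\<close> by (simp add: mult_right_mono)
      moreover have "(int j - 1) * int (length z) = int j * int (length z) - int (length z)" by (simp add: algebra_simps)
      moreover have "int (length z) \<le> int (length u)" by (simp add: right)
      ultimately show ?thesis by auto
    qed
    finally show ?thesis by simp
  qed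
qed simp

lemma parenthesised_iff:
  "parenthesised m (strip c u) T R i j \<longleftrightarrow> i < j \<and> block (diag_of \<theta>) R i (j - i)"
proof (cases "i < j")
  case True
  have len: "length u = length w + length z" by (simp add: right)
  have "same_shape R (staircase_power m (strip c u) (j - i)) \<longleftrightarrow> (\<exists>e. R = strip e (w @ repeat (j - i) z))"
    using True by (simp add: staircase_power_word same_shape_strip_right)
  moreover have eq: "diag_of ` strip e (w @ repeat (j - i) z) =
      {diag_of \<theta> + int i * int (length z)..diag_of \<theta> + (int j - 1) * int (length z) + int (length u)}
      \<longleftrightarrow> diag_of e = diag_of \<theta> + int i * int (length z)" for e
  proof -
    have "int (length (w @ repeat (j - i) z)) = int (length w) + (int j - int i) * int (length z)"
      using True by (simp add: of_nat_diff)
    then show ?thesis unfolding diag_of_image_strip len by (auto simp: algebra_simps Icc_eq_Icc)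
  qed
  ultimately show ?thesis unfolding parenthesised_def union_copy_diags_eq[OF True] block_def
    using True ex_conj_cong[where Q = "\<lambda>R. diag_of ` R = _", OF eq] by (simp only: simp_thms)
qed (simp add: parenthesised_def)

lemma slashed_iff: "slashed m (strip c u) T R i \<longleftrightarrow> block (diag_of \<theta>) R i 0"
proof -
  have len: "length u = length w + length z" by (simp add: right)
  obtain e where "m_cap m (strip c u) (strip c u) = strip e w" using m_cap_strip[OF cap] by blast
  then have "same_shape R (m_cap m (strip c u) (strip c u)) \<longleftrightarrow> (\<exists>e. R = strip e w)"
    by (simp add: same_shape_strip_right)
  moreover have "copy_diags m (strip c u) T i \<inter> copy_diags m (strip c u) T (i + 1) =
      {diag_of \<theta> + int i * int (length z)..diag_of \<theta> + int i * int (length z) + int (length w)}"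
    unfolding copy_diags_eq len by (auto simp: algebra_simps)
  moreover have eq: "diag_of ` strip e w = {p..p + int (length w)} \<longleftrightarrow> diag_of e = p" for e p
    by (auto simp: diag_of_image_strip Icc_eq_Icc)
  ultimately show ?thesis unfolding slashed_def block_def
    using ex_conj_cong[where Q = "\<lambda>R. diag_of ` R = _", OF eq] by (simp only: repeat_0 append_Nil2)
qed

end

definition blocks :: "side \<Rightarrow> cell set \<Rightarrow> int \<Rightarrow> (nat \<times> nat) set" where
  "blocks x D P = {(i, l). \<exists>R\<in>ribbon_decomposition x D - {border_ribbon x D}. block P R i l}"

lemma staircase_decomposition_iff:
  "staircase_decomposition x D m (strip c u) k N \<longleftrightarrow> 1 \<le> k \<and>
    (\<exists>\<theta>. border_ribbon x D = strip \<theta> (w @ repeat k z) \<and>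
      (\<forall>R\<in>ribbon_decomposition x D - {border_ribbon x D}. \<exists>i l. 1 \<le> i \<and> i + l < k \<and> block (diag_of \<theta>) R i l) \<and>
      N = nesting_word (blocks x D (diag_of \<theta>)) k)"
  (is "?L \<longleftrightarrow> ?R")
proof -
  let ?T = "border_ribbon x D" and ?RD = "ribbon_decomposition x D"
  obtain e where mc: "m_cap m (strip c u) (strip c u) = strip e w" using m_cap_strip[OF cap] by blast
  have letter: "map (letter_at m (strip c u) ?T (?RD - {?T})) [1..<k] = nesting_word (blocks x D (diag_of \<theta>)) k"
    if T: "?T = strip \<theta> (w @ repeat k z)" for \<theta>
  proof -
    have E1: "(\<exists>R\<in>\<R>. \<exists>j>i. block P R i (j - i)) \<longleftrightarrow> (\<exists>l>0. \<exists>R\<in>\<R>. block P R i l)" for \<R> P i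
    proof
      assume "\<exists>l>0. \<exists>R\<in>\<R>. block P R i l"
      then obtain l R where "l > 0" "R \<in> \<R>" "block P R i l" by blast
      then show "\<exists>R\<in>\<R>. \<exists>j>i. block P R i (j - i)" by (intro bexI[of _ R] exI[of _ "i + l"]) auto
    qed (metis zero_less_diff)
    have E2: "(\<exists>R\<in>\<R>. \<exists>j<i. block P R j (i - j)) \<longleftrightarrow> (\<exists>j<i. \<exists>R\<in>\<R>. block P R j (i - j))" for \<R> P i
      by blast
    show ?thesis unfolding nesting_word_def letter_at_def parenthesised_iff[OF T] slashed_iff[OF T] blocks_def
      by (simp only: E1 E2 mem_Collect_eq prod.case)
  qed
  show ?thesis
  proof
    assume L: ?L
    then have k: "1 \<le> k" by (simp add: staircase_decomposition_def Let_def)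
    have "same_shape ?T (staircase_power m (strip c u) k)" using L by (simp add: staircase_decomposition_def Let_def)
    then obtain \<theta> where T: "?T = strip \<theta> (w @ repeat k z)"
      unfolding staircase_power_word[OF k] same_shape_strip_right by blast
    have "\<exists>i l. 1 \<le> i \<and> i + l < k \<and> block (diag_of \<theta>) R i l" if R: "R \<in> ?RD - {?T}" for R
    proof -
      have "(\<exists>i j. 1 \<le> i \<and> j < k \<and> parenthesised m (strip c u) ?T R i j) \<or>
          (\<exists>i. 1 \<le> i \<and> i < k \<and> slashed m (strip c u) ?T R i)"
        using L R unfolding staircase_decomposition_def Let_def by blast
      then show ?thesis unfolding parenthesised_iff[OF T] slashed_iff[OF T]
        by (metis add.right_neutral le_add_diff_inverse less_imp_le_nat)
    qed
    moreover have "N = map (letter_at m (strip c u) ?T (?RD - {?T})) [1..<k]"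
      using L by (simp add: staircase_decomposition_def Let_def)
    ultimately show ?R using k T letter[OF T] by (intro conjI exI[of _ \<theta>]) blast+
  next
    assume ?R
    then obtain \<theta> where k: "1 \<le> k" and T: "?T = strip \<theta> (w @ repeat k z)"
      and B: "\<And>R. R \<in> ?RD - {?T} \<Longrightarrow> \<exists>i l. 1 \<le> i \<and> i + l < k \<and> block (diag_of \<theta>) R i l"
      and N: "N = nesting_word (blocks x D (diag_of \<theta>)) k" by blast
    have shape: "\<exists>e l. R = strip e (w @ repeat l z) \<and> l \<le> k" if mem: "R \<in> ?RD" for R
    proof (cases "R = ?T")
      case False
      then obtain i l where "i + l < k" "block (diag_of \<theta>) R i l" using B mem by blast
      then show ?thesis unfolding block_def by (metis add_leD2 less_imp_le)
    qed (use T in blast)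
    have "same_shape R (strip e w) \<or> (\<exists>p\<ge>1. same_shape R (staircase_power m (strip c u) p))" if "R \<in> ?RD" for R
    proof -
      obtain e' l where R: "R = strip e' (w @ repeat l z)" using shape[OF \<open>R \<in> ?RD\<close>] by blast
      show ?thesis
      proof (cases l)
        case (Suc l')
        then have "same_shape R (staircase_power m (strip c u) l)" "l \<ge> 1"
          using staircase_power_word[of l c] R by auto
        then show ?thesis by blast
      qed (simp add: R)
    qed
    moreover have "p \<le> k" if "R \<in> ?RD" "1 \<le> p" "same_shape R (staircase_power m (strip c u) p)" for R p
    proof -
      obtain e' l where R: "R = strip e' (w @ repeat l z)" "l \<le> k" using shape[OF \<open>R \<in> ?RD\<close>] by blast
      then have "w @ repeat l z = w @ repeat p z" using that staircase_power_word[of p c] by simp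
      then show ?thesis using R staircase_power_word_inject by simp
    qed
    moreover have "(\<exists>i j. 1 \<le> i \<and> j < k \<and> parenthesised m (strip c u) ?T R i j) \<or>
          (\<exists>i. 1 \<le> i \<and> i < k \<and> slashed m (strip c u) ?T R i)" if mem: "R \<in> ?RD - {?T}" for R
    proof -
      obtain i l where il: "1 \<le> i" "i + l < k" "block (diag_of \<theta>) R i l" using B mem by blast
      show ?thesis
      proof (cases "l = 0")
        case True
        then show ?thesis using il unfolding slashed_iff[OF T] by auto
      next
        case False
        then have "1 \<le> i \<and> i + l < k \<and> parenthesised m (strip c u) ?T R i (i + l)"
          using il unfolding parenthesised_iff[OF T] by auto
        then show ?thesis by blast
      qed
    qed
    moreover have "same_shape ?T (staircase_power m (strip c u) k)"
      unfolding staircase_power_word[OF k] same_shape_strip_right using T by blast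
    ultimately show ?L
      unfolding staircase_decomposition_def Let_def mc
      using k N letter[OF T] nontrivial[of c] rows count_eq by auto
  qed
qed

end

text \<open>Reflection maps \<open>w z^l\<close> to the corresponding power for the conjugate word,
  hence blocks to blocks with the copies counted from the other end. Laminarity supplies the
  assumptions of \<open>nesting_word_mirror\<close>.\<close>

lemma mirror_decomposition:
  assumes fin: "finite D" and cvx: "order_convex D"
    and ov: "overlap m u w y z"
    and ov': "overlap m' (conj_word u) (conj_word w) (conj_word z) (conj_word y)"
    and dec: "staircase_decomposition x D m (strip c u) k N"
  shows "staircase_decomposition x (conj_diagram D) m' (strip c' (conj_word u)) k (reverse_nesting N)"
proof -
  interpret overlap m u w y z by (rule ov)
  interpret C: overlap m' "conj_word u" "conj_word w" "conj_word z" "conj_word y" by (rule ov')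
  let ?T = "border_ribbon x D" and ?RD = "ribbon_decomposition x D"
  let ?s = "int (length z)"
  obtain \<theta> where k: "1 \<le> k" and T: "?T = strip \<theta> (w @ repeat k z)"
    and B: "\<And>R. R \<in> ?RD - {?T} \<Longrightarrow> \<exists>i l. 1 \<le> i \<and> i + l < k \<and> block (diag_of \<theta>) R i l"
    and N: "N = nesting_word (blocks x D (diag_of \<theta>)) k"
    using dec unfolding staircase_decomposition_iff by blast
  have T': "border_ribbon x (conj_diagram D) = conj_diagram ?T"
    by (simp add: conj.border conj_diagram_def)
  have RD': "ribbon_decomposition x (conj_diagram D) = conj_diagram ` ?RD"
    using conj.ribbon_decomposition_image[of x D] by (simp add: conj_diagram_def[abs_def])
  have word: "conj_word (w @ repeat l z) = conj_word w @ repeat l (conj_word y)" for l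
    using repeat_shift[OF C.shift, of l] by (simp add: conj_word_append conj_word_repeat)
  define \<theta>' where "\<theta>' = prod.swap (strip_end \<theta> (w @ repeat k z))"
  have T'': "border_ribbon x (conj_diagram D) = strip \<theta>' (conj_word w @ repeat k (conj_word y))"
    unfolding T' T conj_diagram_strip word \<theta>'_def ..
  have dt': "diag_of \<theta>' = - (diag_of \<theta> + int (length w) + int k * ?s)"
    by (simp add: \<theta>'_def)
  \<comment> \<open>A block of l copies after the first i ones is followed by k - i - l copies,
    which come first after reflection.\<close>
  have block': "C.block (diag_of \<theta>') (conj_diagram R) (k - i - l) l"
    if blk: "block (diag_of \<theta>) R i l" and il: "i + l < k" for R i l
  proof -
    obtain e where R: "R = strip e (w @ repeat l z)" and e: "diag_of e = diag_of \<theta> + int i * ?s"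
      using blk unfolding block_def by blast
    have "conj_diagram R = strip (prod.swap (strip_end e (w @ repeat l z))) (conj_word w @ repeat l (conj_word y))"
      unfolding R conj_diagram_strip word ..
    moreover have "diag_of (prod.swap (strip_end e (w @ repeat l z))) =
        diag_of \<theta>' + int (k - i - l) * int (length (conj_word y))"
    proof -
      have "int (k - i - l) = int k - int i - int l" using il by linarith
      then show ?thesis by (simp add: dt' e length_y algebra_simps)
    qed
    ultimately show ?thesis unfolding C.block_def by blast
  qed
  have inj: "conj_diagram R = conj_diagram S \<longleftrightarrow> R = S" for R S by (metis conj_diagram_conj_diagram)
  have Bl: "(i, l) \<in> blocks x D (diag_of \<theta>) \<longleftrightarrow> (\<exists>R\<in>?RD - {?T}. block (diag_of \<theta>) R i l)" for i l
    by (simp add: blocks_def)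
  have bound: "1 \<le> i \<and> i + l < k" if R: "R \<in> ?RD - {?T}" and b: "block (diag_of \<theta>) R i l" for R i l
    using B[OF R] block_unique[OF b] by blast
  have blocks': "C.blocks x (conj_diagram D) (diag_of \<theta>') = (\<lambda>(i, l). (k - i - l, l)) ` blocks x D (diag_of \<theta>)"
  proof (intro subset_antisym subsetI)
    fix p assume "p \<in> C.blocks x (conj_diagram D) (diag_of \<theta>')"
    then obtain i' l' R where R: "p = (i', l')" "R \<in> ?RD - {?T}" "C.block (diag_of \<theta>') (conj_diagram R) i' l'"
      unfolding C.blocks_def RD' T' by auto
    obtain i l where il: "i + l < k" "block (diag_of \<theta>) R i l" using B[OF R(2)] by blast
    then have "p = (k - i - l, l)" using C.block_unique[OF R(3) block'] R(1) by simp
    moreover have "(i, l) \<in> blocks x D (diag_of \<theta>)" using Bl R(2) il by blast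
    ultimately show "p \<in> (\<lambda>(i, l). (k - i - l, l)) ` blocks x D (diag_of \<theta>)" by force
  next
    fix p assume "p \<in> (\<lambda>(i, l). (k - i - l, l)) ` blocks x D (diag_of \<theta>)"
    then obtain i l where "p = (k - i - l, l)" "(i, l) \<in> blocks x D (diag_of \<theta>)" by auto
    then obtain R where il: "p = (k - i - l, l)" "R \<in> ?RD - {?T}" "block (diag_of \<theta>) R i l"
      using Bl by blast
    then have "C.block (diag_of \<theta>') (conj_diagram R) (k - i - l) l" using block' bound by blast
    then show "p \<in> C.blocks x (conj_diagram D) (diag_of \<theta>')"
      unfolding C.blocks_def RD' T' using il inj by auto
  qed
  have disj: "i = i' \<and> l = l' \<or> (i \<noteq> i' \<and> i + l \<noteq> i' + l' \<and> \<not> (i' < i \<and> i' + l' = i \<and> l \<noteq> 0))"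
    if mem: "(i, l) \<in> blocks x D (diag_of \<theta>)" "(i', l') \<in> blocks x D (diag_of \<theta>)" for i l i' l'
  proof -
    obtain R S where R: "R \<in> ?RD" "block (diag_of \<theta>) R i l" and S: "S \<in> ?RD" "block (diag_of \<theta>) S i' l'"
      using mem Bl by blast
    show ?thesis
    proof (cases "R = S")
      case True
      then show ?thesis using block_unique[OF R(2)] S(2) by blast
    next
      case False
      define p q p' q' where pq: "p = diag_of \<theta> + int i * ?s" "q = diag_of \<theta> + int i * ?s + int (length w) + int l * ?s"
        "p' = diag_of \<theta> + int i' * ?s" "q' = diag_of \<theta> + int i' * ?s + int (length w) + int l' * ?s"
      have *: "p \<noteq> p'" "q \<noteq> q'" "\<not> (p' < p \<and> p \<le> q' \<and> q' < q)"
        using decomposition_intervals[OF R(1) S(1) False fin cvx block_diags[OF R(2)] block_diags[OF S(2)]]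
          decomposition_intervals[OF S(1) R(1) False[symmetric] fin cvx block_diags[OF S(2)] block_diags[OF R(2)]]
        unfolding pq by auto
      have q: "q = diag_of \<theta> + int (length w) + int (i + l) * ?s" "q' = diag_of \<theta> + int (length w) + int (i' + l') * ?s"
        unfolding pq by (simp_all add: algebra_simps)
      have "i \<noteq> i'" using *(1) pq by auto
      moreover have "i + l \<noteq> i' + l'" using *(2) q by auto
      \<comment> \<open>A ribbon ending with copy i and one starting with copy i + 1 would overlap
        in the diagonals of \<open>w\<close> without being nested.\<close>
      moreover have "\<not> (i' < i \<and> i' + l' = i \<and> l \<noteq> 0)"
      proof
        assume a: "i' < i \<and> i' + l' = i \<and> l \<noteq> 0"
        have sp: "0 < ?s" using length_z_pos by simp
        have "p' < p" using a sp by (simp add: pq)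
        moreover have "p \<le> q'" using a unfolding q pq by simp
        moreover have "q' < q" using a sp unfolding q by simp
        ultimately show False using *(3) by blast
      qed
      ultimately show ?thesis by blast
    qed
  qed
  have word_eq: "nesting_word (C.blocks x (conj_diagram D) (diag_of \<theta>')) k = reverse_nesting N"
    unfolding blocks' N
  proof (rule nesting_word_mirror)
    show "1 \<le> i \<and> i + l < k" if "(i, l) \<in> blocks x D (diag_of \<theta>)" for i l
      using that Bl bound by blast
    fix i l i' l' assume mem: "(i, l) \<in> blocks x D (diag_of \<theta>)" "(i', l') \<in> blocks x D (diag_of \<theta>)"
    show "i + l = i' + l' \<Longrightarrow> i = i'" using disj[OF mem] by blast
    show "i' < i \<Longrightarrow> i' + l' = i \<Longrightarrow> l = 0" using disj[OF mem] by auto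
  next
    fix i l l' assume mem: "(i, l) \<in> blocks x D (diag_of \<theta>)" "(i, l') \<in> blocks x D (diag_of \<theta>)"
    show "l = l'" using disj[OF mem] by blast
  qed
  have "\<exists>i l. 1 \<le> i \<and> i + l < k \<and> C.block (diag_of \<theta>') R i l"
    if mem: "R \<in> ribbon_decomposition x (conj_diagram D) - {border_ribbon x (conj_diagram D)}" for R
  proof -
    obtain S where S: "R = conj_diagram S" "S \<in> ?RD - {?T}" using mem unfolding RD' T' by blast
    obtain i l where il: "1 \<le> i" "i + l < k" "block (diag_of \<theta>) S i l" using B[OF S(2)] by blast
    then have "C.block (diag_of \<theta>') R (k - i - l) l" using block' S(1) by blast
    moreover have "1 \<le> k - i - l" "k - i - l + l < k" using il by auto
    ultimately show ?thesis by blast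
  qed
  then show ?thesis unfolding C.staircase_decomposition_iff
    by (intro conjI exI[of _ \<theta>'] ballI k T'' word_eq[symmetric])
qed

lemma conj_decomposition:
  assumes fin: "finite D" and cvx: "order_convex D"
    and ov: "overlap m u w y z"
    and dec: "staircase_decomposition x D m (strip c u) k N"
    and nondeg: "\<not> degenerate_ends m k (strip c u)"
  shows "staircase_decomposition x (conj_diagram D) (Suc (count_list w True)) (strip c' (conj_word u)) k (reverse_nesting N)"
proof -
  interpret overlap m u w y z by (rule ov)
  have T: "True \<in> set u" using True_in_u_if_nondegenerate[OF nondeg] .
  show ?thesis
  proof (cases "True \<notin> set w \<longrightarrow> length w = min (length (takeWhile Not u)) (length (takeWhile Not (rev u)))")
    case True
    then show ?thesis using mirror_decomposition[OF fin cvx ov conj_overlap dec] T by blast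
  next
    case False
    \<comment> \<open>Now the border is \<alpha> alone and there is no other ribbon, so any one-row
      intersection of the conjugate will do; \<open>m'\<close> is 1 because \<open>w\<close> is a
      column.\<close>
    then have "k = 1" and w: "True \<notin> set w" using min_end_columns_if_nondegenerate[OF nondeg] by auto
    then have m': "Suc (count_list w True) = 1" by (simp add: count_list_0_iff)
    obtain v where v: "cap_word 1 (conj_word u) (conj_word u) v" using cap_word_one by blast
    have "0 < count_list u True" using T by (metis count_list_0_iff gr0I)
    then obtain y' z' where "overlap 1 (conj_word u) v y' z'" using overlapI[OF v, of c] by auto
    then interpret C: overlap 1 "conj_word u" v y' z' .
    obtain \<theta> where th: "border_ribbon x D = strip \<theta> u"
      "ribbon_decomposition x D - {border_ribbon x D} = {}" "N = []"
      using dec unfolding staircase_decomposition_iff \<open>k = 1\<close> nesting_word_def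
      by (auto simp: right[symmetric])
    have "border_ribbon x (conj_diagram D) = strip (prod.swap (strip_end \<theta> u)) (v @ repeat 1 z')"
      using th(1) by (simp add: conj.border conj_diagram_def C.right[symmetric] flip: conj_diagram_strip)
    moreover have "ribbon_decomposition x (conj_diagram D) - {border_ribbon x (conj_diagram D)} = {}"
      using conj.ribbon_decomposition_image[of x D] th(2) by (auto simp: conj_diagram_def conj.border)
    moreover have "reverse_nesting N = []" using th(3) by (simp add: reverse_nesting_def)
    ultimately show ?thesis unfolding m' C.staircase_decomposition_iff \<open>k = 1\<close>
      by (intro conjI exI[of _ "prod.swap (strip_end \<theta> u)"]) (simp_all only: nesting_word_def, simp_all)
  qed
qed

section \<open>Interlacing transfer sums as determinants\<close>

text \<open>Columns are functions of the row index, read only below \<open>r\<close>; the same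
  columns can thus be used in matrices of growing size.\<close>

definition cols_det :: "nat \<Rightarrow> (nat \<Rightarrow> 'a :: comm_ring_1) list \<Rightarrow> 'a" where
  "cols_det r vs = det (mat r r (\<lambda>(i, j). (vs ! j) i))"

lemma nth_append_other: "l \<noteq> length pre \<Longrightarrow> (pre @ v # rest) ! l = (pre @ v' # rest) ! l"
  by (simp add: nth_append nth_Cons')

lemma mat_delete_entry:
  "k < r - 1 \<Longrightarrow> l < r - 1 \<Longrightarrow>
    mat_delete (mat r r f) i j $$ (k, l) = f (if k < i then k else Suc k, if l < j then l else Suc l)"
  by (auto simp: mat_delete_def)

text \<open>Laplace expansion along the column \<open>v\<close>, whose cofactors do not involve
  \<open>v\<close>. Linearity in a single column follows from it.\<close>

lemma cols_det_expand:
  assumes "Suc (length pre + length rest) = r"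
  shows "\<exists>C. \<forall>v. cols_det r (pre @ v # rest) = (\<Sum>i<r. v i * C i)"
proof -
  let ?M = "\<lambda>v. mat r r (\<lambda>(i, j). ((pre @ v # rest) ! j) i)"
  let ?j = "length pre"
  have del: "mat_delete (?M v) i ?j = mat_delete (?M (\<lambda>_. 0)) i ?j" if "i < r" for v i
  proof (rule eq_matI)
    fix k l assume "k < dim_row (mat_delete (?M (\<lambda>_. 0)) i ?j)" "l < dim_col (mat_delete (?M (\<lambda>_. 0)) i ?j)"
    then have "k < r - 1" "l < r - 1" by (simp_all add: mat_delete_def)
    moreover have "(pre @ v # rest) ! (if l < ?j then l else Suc l) = (pre @ (\<lambda>_. 0) # rest) ! (if l < ?j then l else Suc l)"
      by (rule nth_append_other) auto
    ultimately show "mat_delete (?M v) i ?j $$ (k, l) = mat_delete (?M (\<lambda>_. 0)) i ?j $$ (k, l)"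
      by (simp only: mat_delete_entry prod.case)
  qed (simp_all add: mat_delete_def)
  have "cols_det r (pre @ v # rest) = (\<Sum>i<r. v i * cofactor (?M (\<lambda>_. 0)) i ?j)" for v
  proof -
    have "cols_det r (pre @ v # rest) = (\<Sum>i<r. ?M v $$ (i, ?j) * cofactor (?M v) i ?j)"
      unfolding cols_det_def using assms by (intro laplace_expansion_column) auto
    also have "\<dots> = (\<Sum>i<r. v i * cofactor (?M (\<lambda>_. 0)) i ?j)"
    proof (intro sum.cong refl)
      fix i assume "i \<in> {..<r}"
      then have i: "i < r" by simp
      have "cofactor (?M v) i ?j = cofactor (?M (\<lambda>_. 0)) i ?j"
        unfolding cofactor_def del[OF i, of v] ..
      moreover have "?M v $$ (i, ?j) = v i" using assms i by simp
      ultimately show "?M v $$ (i, ?j) * cofactor (?M v) i ?j = v i * cofactor (?M (\<lambda>_. 0)) i ?j" by (simp only:)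
    qed
    finally show ?thesis .
  qed
  then show ?thesis by (intro exI allI)
qed

lemma cols_det_sum:
  assumes "Suc (length pre + length rest) = r"
  shows "cols_det r (pre @ (\<lambda>i. \<Sum>s\<in>S. f s i) # rest) = (\<Sum>s\<in>S. cols_det r (pre @ f s # rest))"
proof -
  obtain C where C: "\<And>v. cols_det r (pre @ v # rest) = (\<Sum>i<r. v i * C i)"
    using cols_det_expand[OF assms] by blast
  show ?thesis unfolding C sum_distrib_right by (rule sum.swap)
qed

lemma cols_det_scale:
  assumes "Suc (length pre + length rest) = r"
  shows "cols_det r (pre @ (\<lambda>i. a * v i) # rest) = a * cols_det r (pre @ v # rest)"
proof -
  obtain C where C: "\<And>v. cols_det r (pre @ v # rest) = (\<Sum>i<r. v i * C i)"
    using cols_det_expand[OF assms] by blast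
  show ?thesis unfolding C by (simp add: sum_distrib_left mult.assoc)
qed

lemma cols_det_diff:
  assumes "Suc (length pre + length rest) = r"
  shows "cols_det r (pre @ (\<lambda>i. v i - v' i) # rest) = cols_det r (pre @ v # rest) - cols_det r (pre @ v' # rest)"
proof -
  obtain C where C: "\<And>v. cols_det r (pre @ v # rest) = (\<Sum>i<r. v i * C i)"
    using cols_det_expand[OF assms] by blast
  show ?thesis unfolding C by (simp add: sum_subtractf left_diff_distrib)
qed

lemma cols_det_adjacent_equal:
  assumes "Suc (Suc (length pre + length rest)) = r"
  shows "cols_det r (pre @ v # v # rest) = 0"
proof -
  let ?A = "mat r r (\<lambda>(i, j). ((pre @ v # v # rest) ! j) i)"
  have "col ?A (length pre) = col ?A (Suc (length pre))"
    by (rule eq_vecI) (use assms in \<open>simp_all add: nth_append\<close>)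
  then show ?thesis unfolding cols_det_def
    by (intro det_identical_columns[of ?A r "length pre" "Suc (length pre)"]) (use assms in auto)
qed

lemma cols_det_subtract_left:
  assumes "Suc (Suc (length pre + length rest)) = r"
  shows "cols_det r (pre @ v # (\<lambda>i. v' i - v i) # rest) = cols_det r (pre @ v # v' # rest)"
  using cols_det_diff[of "pre @ [v]" rest r v' v] cols_det_adjacent_equal[OF assms, of v] assms by simp

lemma cols_det_subtract_right:
  assumes "Suc (Suc (length pre + length rest)) = r"
  shows "cols_det r (pre @ (\<lambda>i. v i - v' i) # v' # rest) = cols_det r (pre @ v # v' # rest)"
  using cols_det_diff[of pre "v' # rest" r v v'] cols_det_adjacent_equal[OF assms, of v'] assms by simp

text \<open>Summing over the sets of a chain produces differences of neighbouring columns. The left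
  version arises at up steps, where sums over \<open>A - L b\<close> are kept, the right one at
  right steps, where sums over \<open>L b\<close> are kept.\<close>

fun diffs_left :: "(nat \<Rightarrow> 'a :: comm_ring_1) \<Rightarrow> (nat \<Rightarrow> 'a) list \<Rightarrow> (nat \<Rightarrow> 'a) list" where
  "diffs_left v [] = []"
| "diffs_left v (v' # vs) = (\<lambda>i. v' i - v i) # diffs_left v' vs"

fun diffs_right :: "(nat \<Rightarrow> 'a :: comm_ring_1) \<Rightarrow> (nat \<Rightarrow> 'a) list \<Rightarrow> (nat \<Rightarrow> 'a) list" where
  "diffs_right v [] = [v]"
| "diffs_right v (v' # vs) = (\<lambda>i. v i - v' i) # diffs_right v' vs"

lemma cols_det_diffs_left:
  "Suc (length pre + length vs + length rest) = r \<Longrightarrow>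
    cols_det r (pre @ v # diffs_left v vs @ rest) = cols_det r (pre @ v # vs @ rest)"
proof (induction vs arbitrary: pre v)
  case (Cons v' vs)
  have len: "length (diffs_left v' vs) = length vs" by (induction vs arbitrary: v') auto
  have "cols_det r (pre @ v # diffs_left v (v' # vs) @ rest) = cols_det r (pre @ v # v' # diffs_left v' vs @ rest)"
    using cols_det_subtract_left[of pre "diffs_left v' vs @ rest" r v v'] Cons.prems len by simp
  then show ?case using Cons.IH[of "pre @ [v]" v'] Cons.prems by simp
qed simp

lemma cols_det_diffs_right:
  "Suc (length pre + length vs + length rest) = r \<Longrightarrow>
    cols_det r (pre @ diffs_right v vs @ rest) = cols_det r (pre @ v # vs @ rest)"
proof (induction vs arbitrary: pre v)
  case (Cons v' vs)
  have "cols_det r (pre @ diffs_right v (v' # vs) @ rest) =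
      cols_det r (pre @ (\<lambda>i. v i - v' i) # v' # vs @ rest)"
    using Cons.IH[of "pre @ [\<lambda>i. v i - v' i]" v'] Cons.prems by simp
  then show ?case using cols_det_subtract_right[of pre "vs @ rest" r v v'] Cons.prems by simp
qed simp

text \<open>Expansion along the last row, whose only nonzero entry is the 1 in column
  \<open>v\<close>. Read backwards, it enlarges the determinant when a ribbon starts.\<close>

lemma cols_det_unit_row:
  assumes "length pre + length rest = r" and v: "v r = 1" and z: "\<forall>v'\<in>set pre \<union> set rest. v' r = 0"
  shows "cols_det (Suc r) (pre @ v # rest) = (- 1) ^ (r + length pre) * cols_det r (pre @ rest)"
proof -
  let ?A = "mat (Suc r) (Suc r) (\<lambda>(i, j). ((pre @ v # rest) ! j) i)"
  have row: "?A $$ (r, j) = (if j = length pre then 1 else 0)" if "j < Suc r" for j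
  proof (cases "j = length pre")
    case True
    then show ?thesis using that v by simp
  next
    case False
    have "(pre @ v # rest) ! j \<in> set pre \<union> set rest"
      using False that assms(1) by (auto simp: nth_append nth_Cons')
    then have "((pre @ v # rest) ! j) r = 0" using z by blast
    then show ?thesis using that False by simp
  qed
  have "cols_det (Suc r) (pre @ v # rest) = (\<Sum>j<Suc r. ?A $$ (r, j) * cofactor ?A r j)"
    unfolding cols_det_def by (intro laplace_expansion_row) auto
  also have "\<dots> = (\<Sum>j<Suc r. if j = length pre then cofactor ?A r j else 0)"
    using row by (intro sum.cong) auto
  also have "\<dots> = cofactor ?A r (length pre)"
    using assms(1) by (subst sum.delta) auto
  also have "mat_delete ?A r (length pre) = mat r r (\<lambda>(i, j). ((pre @ rest) ! j) i)"
  proof (rule eq_matI)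
    fix k l assume "k < dim_row (mat r r (\<lambda>(i, j). ((pre @ rest) ! j) i))"
      "l < dim_col (mat r r (\<lambda>(i, j). ((pre @ rest) ! j) i))"
    then show "mat_delete ?A r (length pre) $$ (k, l) = mat r r (\<lambda>(i, j). ((pre @ rest) ! j) i) $$ (k, l)"
      using assms(1) by (simp add: mat_delete_def nth_append)
  qed (simp_all add: mat_delete_def)
  then have "cofactor ?A r (length pre) = (- 1) ^ (r + length pre) * cols_det r (pre @ rest)"
    by (simp add: cofactor_def cols_det_def)
  finally show ?thesis .
qed

section \<open>Sums over independent choices of columns\<close>

definition tuples :: "'b set list \<Rightarrow> 'b list set" where
  "tuples Ss = {a. list_all2 (\<in>) a Ss}"

lemma tuples_Nil [simp]: "tuples [] = {[]}"
  by (simp add: tuples_def)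

lemma tuples_Cons: "tuples (S # Ss) = (\<lambda>(s, a). s # a) ` (S \<times> tuples Ss)"
  by (auto simp: tuples_def list_all2_Cons2)

lemma in_tuples_iff: "a \<in> tuples Ss \<longleftrightarrow> length a = length Ss \<and> (\<forall>t<length a. a ! t \<in> Ss ! t)"
  by (auto simp: tuples_def list_all2_conv_all_nth)

lemma finite_tuples: "(\<And>S. S \<in> set Ss \<Longrightarrow> finite S) \<Longrightarrow> finite (tuples Ss)"
  by (induction Ss) (auto simp: tuples_Cons)

lemma sum_tuples_Cons: "(\<Sum>a\<in>tuples (S # Ss). g a) = (\<Sum>s\<in>S. \<Sum>a\<in>tuples Ss. g (s # a))"
  unfolding tuples_Cons sum.cartesian_product
  by (subst sum.reindex) (auto simp: inj_on_def intro!: sum.cong)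

text \<open>Multilinearity: each sum can be moved into its own column.\<close>

lemma cols_det_tuples:
  "length pre + length Ss + length rest = r \<Longrightarrow>
    (\<Sum>a\<in>tuples Ss. cols_det r (pre @ map f a @ rest)) =
    cols_det r (pre @ map (\<lambda>S i. \<Sum>a\<in>S. f a i) Ss @ rest)"
proof (induction Ss arbitrary: pre)
  case (Cons S Ss)
  have "(\<Sum>a\<in>tuples (S # Ss). cols_det r (pre @ map f a @ rest)) =
      (\<Sum>s\<in>S. \<Sum>a\<in>tuples Ss. cols_det r ((pre @ [f s]) @ map f a @ rest))"
    by (simp add: sum_tuples_Cons)
  also have "\<dots> = (\<Sum>s\<in>S. cols_det r ((pre @ [f s]) @ map (\<lambda>S i. \<Sum>a\<in>S. f a i) Ss @ rest))"
    using Cons.prems by (intro sum.cong refl Cons.IH) simp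
  also have "\<dots> = cols_det r (pre @ map (\<lambda>S i. \<Sum>a\<in>S. f a i) (S # Ss) @ rest)"
    using cols_det_sum[of pre "map (\<lambda>S i. \<Sum>a\<in>S. f a i) Ss @ rest" r f S] Cons.prems by simp
  finally show ?case .
qed simp

lemma cols_det_scale_all:
  "length pre + length bs + length rest = r \<Longrightarrow>
    cols_det r (pre @ map (\<lambda>b i. x b * f b i) bs @ rest) = prod_list (map x bs) * cols_det r (pre @ map f bs @ rest)"
proof (induction bs arbitrary: pre)
  case (Cons b bs)
  show ?case
    using Cons.IH[of "pre @ [\<lambda>i. x b * f b i]"] Cons.prems
      cols_det_scale[of pre "map f bs @ rest" r "x b" "f b"]
    by (simp add: algebra_simps)
qed simp

text \<open>An event describes the passage from one diagonal of a diagram to the next one: whether the southeast border steps to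
  the right, and whether the number of cells on the diagonal changes. By convexity this number can only increase at a step
  to the right, where a ribbon of the decomposition starts, and only decrease at a step up, where one ends. Lists of events
  have the latest event first.\<close>

type_synonym event = "bool \<times> bool"

fun num_starts :: "event list \<Rightarrow> nat" where
  "num_starts [] = 0"
| "num_starts (ev # es) = (if ev = (True, True) then Suc (num_starts es) else num_starts es)"

fun num_ends :: "event list \<Rightarrow> nat" where
  "num_ends [] = 0"
| "num_ends (ev # es) = (if ev = (False, True) then Suc (num_ends es) else num_ends es)"

fun admissible :: "event list \<Rightarrow> bool" where
  "admissible [] = True"
| "admissible (ev # es) \<longleftrightarrow> admissible es \<and> num_ends (ev # es) \<le> num_starts (ev # es)"

text \<open>At a start the expansion uses row \<open>r\<close> and the column in position
  \<open>r - num_ends es\<close>, whose indices sum to \<open>num_ends es\<close> modulo 2.\<close>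

fun det_sign :: "event list \<Rightarrow> 'a :: comm_ring_1" where
  "det_sign [] = 1"
| "det_sign (ev # es) = (if ev = (True, True) then (- 1) ^ num_ends es else 1) * det_sign es"

text \<open>\<open>L b\<close> is the set of admissible left neighbours of an entry \<open>b\<close>, and its complement the set of admissible
  entries below \<open>b\<close>: \<open>{a. a \<le> b}\<close> yields column-strict fillings, \<open>{a. a < b}\<close> the transposed condition.\<close>

locale transfer =
  fixes A :: "nat set" and L :: "nat \<Rightarrow> nat set" and x :: "nat \<Rightarrow> 'a :: comm_ring_1"
  assumes finite_A [simp]: "finite A"
    and L_subset: "L b \<subseteq> A"
    and L_mono: "b \<le> b' \<Longrightarrow> L b \<subseteq> L b'"
    and L_lower: "a \<in> L b \<Longrightarrow> a' \<in> A \<Longrightarrow> a' \<le> a \<Longrightarrow> a' \<in> L b"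
begin

lemma finite_L [simp]: "finite (L b)"
  using finite_subset[OF L_subset] by simp

text \<open>For decreasing entries the sets \<open>L b\<close> decrease, and interlacing means
  choosing one element in each successive difference; the flag adds a choice in the last
  set.\<close>

fun chain :: "bool \<Rightarrow> nat set \<Rightarrow> nat list \<Rightarrow> nat set list" where
  "chain e S [] = (if e then [S] else [])"
| "chain e S (b # bs) = (S - L b) # chain e (L b) bs"

text \<open>The choices on the preceding diagonal. At an up step the first entry is bounded above
  only by the alphabet, and an ending ribbon adds an entry; at a right step it is bounded by
  \<open>L b\<close>, and a starting ribbon leaves one entry fewer. A start without entries is
  impossible: \<open>[{}]\<close> makes its sum empty.\<close>

fun interlacing :: "event \<Rightarrow> nat list \<Rightarrow> nat set list" where
  "interlacing (False, e) bs = chain e A bs"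
| "interlacing (True, s) [] = (if s then [{}] else [])"
| "interlacing (True, s) (b # bs) = chain (\<not> s) (L b) bs"

text \<open>Generating function of everything up to the current diagonal, with the entries
  \<open>b\<close> on that diagonal prescribed.\<close>

fun total :: "event list \<Rightarrow> nat list \<Rightarrow> 'a" where
  "total [] b = (if b = [] then 1 else 0)"
| "total (ev # es) b = prod_list (map x b) * (\<Sum>a\<in>tuples (interlacing ev b). total es a)"

definition step_set :: "bool \<Rightarrow> nat \<Rightarrow> nat set" where
  "step_set s b = (if s then L b else A - L b)"

text \<open>Entry i is the generating function of the border segment from the start of the ribbon
  numbered i to the current diagonal, with last entry \<open>b\<close>.\<close>

fun column :: "event list \<Rightarrow> nat \<Rightarrow> nat \<Rightarrow> 'a" where
  "column [] b i = 0"
| "column (ev # es) b i = x b * (if ev = (True, True) \<and> i = num_starts es then 1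
     else \<Sum>a\<in>step_set (fst ev) b. column es a i)"

text \<open>When a ribbon ends, its last entry becomes free; the column is summed over it and then
  stays fixed.\<close>

fun ended :: "event list \<Rightarrow> (nat \<Rightarrow> 'a) list" where
  "ended [] = []"
| "ended (ev # es) = (if ev = (False, True) then [\<lambda>i. \<Sum>a\<in>A. column es a i] else []) @ ended es"

lemma length_ended [simp]: "length (ended es) = num_ends es"
proof (induction es)
  case (Cons ev es)
  then show ?case by (cases "ev = (False, True)") simp_all
qed simp

lemma column_beyond: "num_starts es \<le> i \<Longrightarrow> column es b i = 0"
  by (induction es arbitrary: b) (auto split: if_splits)

lemma ended_beyond: "v \<in> set (ended es) \<Longrightarrow> num_starts es \<le> i \<Longrightarrow> v i = 0"
proof (induction es)
  case (Cons ev es)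
  then show ?case by (cases "ev = (False, True)") (auto simp: column_beyond split: if_splits)
qed simp

lemma length_chain [simp]: "length (chain e S bs) = length bs + (if e then 1 else 0)"
  by (induction bs arbitrary: S) auto

lemma finite_chain: "finite S \<Longrightarrow> T \<in> set (chain e S bs) \<Longrightarrow> finite T"
proof (induction bs arbitrary: S)
  case (Cons b bs)
  show ?case using Cons.IH[OF finite_L] Cons.prems by auto
qed (simp split: if_splits)

text \<open>\<open>L b\<close> is closed downwards in \<open>A\<close>, so an entry chosen outside
  it exceeds all entries chosen inside it.\<close>

lemma tuples_chain_decreasing:
  assumes "a \<in> tuples (chain e S bs)" "sorted_wrt (>) bs" "\<And>b. b \<in> set bs \<Longrightarrow> L b \<subseteq> S" "S \<subseteq> A"
  shows "sorted_wrt (>) a \<and> set a \<subseteq> S"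
  using assms
proof (induction bs arbitrary: S a)
  case Nil
  then show ?case by (auto simp: tuples_Cons split: if_splits)
next
  case (Cons b bs)
  from Cons.prems(1) obtain s a' where a: "a = s # a'" "s \<in> S" "s \<notin> L b" "a' \<in> tuples (chain e (L b) bs)"
    by (auto simp: tuples_Cons)
  have IH: "sorted_wrt (>) a' \<and> set a' \<subseteq> L b"
  proof (rule Cons.IH[OF a(4)])
    show "L b' \<subseteq> L b" if "b' \<in> set bs" for b' using Cons.prems(2) that by (intro L_mono) auto
  qed (use Cons.prems L_subset in auto)
  have "t < s" if "t \<in> set a'" for t
  proof (rule ccontr)
    assume "\<not> t < s"
    then have "s \<in> L b" using L_lower[of t b s] IH that a(2) Cons.prems(4) by auto
    then show False using a(3) by simp
  qed
  then show ?case using a IH Cons.prems(3)[of b] by auto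
qed

lemma interlacing_decreasing:
  assumes "a \<in> tuples (interlacing ev bs)" "sorted_wrt (>) bs"
  shows "sorted_wrt (>) a \<and> set a \<subseteq> A"
proof (cases ev)
  case (Pair r s)
  show ?thesis
  proof (cases r)
    case False
    then show ?thesis using tuples_chain_decreasing[of a s A bs] assms L_subset Pair by auto
  next
    case True
    show ?thesis
    proof (cases bs)
      case Nil
      then show ?thesis using assms True Pair by (auto simp: tuples_Cons split: if_splits)
    next
      case (Cons b cs)
      have "sorted_wrt (>) a \<and> set a \<subseteq> L b"
      proof (rule tuples_chain_decreasing)
        show "a \<in> tuples (chain (\<not> s) (L b) cs)" using assms(1) True Pair Cons by simp
        show "L b' \<subseteq> L b" if "b' \<in> set cs" for b' using assms(2) that Cons by (intro L_mono) auto
      qed (use assms(2) Cons L_subset in auto)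
      then show ?thesis using L_subset by auto
    qed
  qed
qed

lemma finite_interlacing: "finite (tuples (interlacing ev bs))"
proof (rule finite_tuples)
  fix S assume "S \<in> set (interlacing ev bs)"
  then show "finite S"
    using finite_chain[OF finite_A] finite_chain[OF finite_L]
    by (cases "(ev, bs)" rule: interlacing.cases) (auto split: if_splits)
qed

lemma sum_Diff_L: "L b \<subseteq> S \<Longrightarrow> finite S \<Longrightarrow> (\<Sum>a\<in>S - L b. f a) = (\<Sum>a\<in>S. f a) - (\<Sum>a\<in>L b. f a :: 'a)"
  by (simp add: sum_diff)

lemma sums_chain_right:
  fixes f :: "nat \<Rightarrow> nat \<Rightarrow> 'a"
  assumes "sorted_wrt (>) bs" "\<And>b. b \<in> set bs \<Longrightarrow> L b \<subseteq> S" "finite S"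
  shows "map (\<lambda>S i. \<Sum>a\<in>S. f a i) (chain True S bs) =
    diffs_right (\<lambda>i. \<Sum>a\<in>S. f a i) (map (\<lambda>b i. \<Sum>a\<in>L b. f a i) bs)"
  using assms
proof (induction bs arbitrary: S)
  case (Cons b bs)
  have "L b' \<subseteq> L b" if "b' \<in> set bs" for b' using Cons.prems(1) that by (intro L_mono) auto
  then show ?case using Cons by (simp add: sum_Diff_L)
qed simp

lemma sums_chain_left:
  fixes f :: "nat \<Rightarrow> nat \<Rightarrow> 'a"
  assumes "sorted_wrt (>) (p # bs)"
  shows "map (\<lambda>S i. \<Sum>a\<in>S. f a i) (chain e (L p) bs) =
    diffs_left (\<lambda>i. \<Sum>a\<in>A - L p. f a i) (map (\<lambda>b i. \<Sum>a\<in>A - L b. f a i) bs @ (if e then [\<lambda>i. \<Sum>a\<in>A. f a i] else []))"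
  using assms
proof (induction bs arbitrary: p)
  case Nil
  show ?case using L_subset by (simp add: sum_Diff_L)
next
  case (Cons b bs)
  have "L b \<subseteq> L p" using Cons.prems by (intro L_mono) auto
  then show ?case using Cons L_subset by (simp add: sum_Diff_L)
qed

text \<open>The row \<open>r\<close> of the new ribbon holds 1 in every active column; the
  differences cancel these ones except in the last column.\<close>

lemma sums_chain_start:
  fixes f :: "nat \<Rightarrow> nat \<Rightarrow> 'a"
  assumes "sorted_wrt (>) (p # bs)" "\<And>a. f a r = 0"
  shows "diffs_right (\<lambda>i. if i = r then 1 else \<Sum>a\<in>L p. f a i) (map (\<lambda>b i. if i = r then 1 else \<Sum>a\<in>L b. f a i) bs) =
    map (\<lambda>S i. \<Sum>a\<in>S. f a i) (chain False (L p) bs) @ [\<lambda>i. if i = r then 1 else \<Sum>a\<in>L (last (p # bs)). f a i]"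
  using assms(1)
proof (induction bs arbitrary: p)
  case (Cons b bs)
  have "L b \<subseteq> L p" using Cons.prems by (intro L_mono) auto
  then have "(\<lambda>i. (if i = r then 1 else \<Sum>a\<in>L p. f a i) - (if i = r then 1 else \<Sum>a\<in>L b. f a i)) =
      (\<lambda>i. \<Sum>a\<in>L p - L b. f a i)"
    by (auto simp: sum_Diff_L assms(2))
  then show ?case using Cons by (simp cong: if_cong)
qed (simp cong: if_cong)

text \<open>Interlacing with \<open>b\<close> amounts to subtracting neighbouring columns, which does not change the determinant.\<close>

lemma total_eq_det:
  assumes "admissible es" "length b + num_ends es = num_starts es" "sorted_wrt (>) b"
  shows "total es b = det_sign es * cols_det (num_starts es) (map (column es) b @ ended es)"
  using assms
proof (induction es arbitrary: b)
  case Nil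
  then show ?case by (simp add: cols_det_def)
next
  case (Cons ev es)
  let ?sum = "\<lambda>S i. \<Sum>a\<in>S. column es a i"
  let ?Ss = "interlacing ev b" and ?r = "num_starts es"
  obtain rt ch where ev: "ev = (rt, ch)" by fastforce
  have adm: "admissible es" "num_ends es \<le> num_starts es" using Cons.prems(1) by (cases es; auto)+
  have len: "length ?Ss + num_ends es = ?r"
    using Cons.prems(2) adm(2) by (cases "(ev, b)" rule: interlacing.cases) (auto split: if_splits)
  have "(\<Sum>a\<in>tuples ?Ss. total es a) = (\<Sum>a\<in>tuples ?Ss. det_sign es * cols_det ?r (map (column es) a @ ended es))"
  proof (intro sum.cong refl Cons.IH[OF adm(1)])
    fix a assume a: "a \<in> tuples ?Ss"
    then show "length a + num_ends es = ?r" using len by (simp add: in_tuples_iff)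
    show "sorted_wrt (>) a" using interlacing_decreasing[OF a Cons.prems(3)] by simp
  qed
  also have "\<dots> = det_sign es * cols_det ?r (map ?sum ?Ss @ ended es)"
    using cols_det_tuples[of "[]" ?Ss "ended es" ?r "column es"] len by (simp add: sum_distrib_left[symmetric])
  finally have tot: "total (ev # es) b = det_sign es * (prod_list (map x b) * cols_det ?r (map ?sum ?Ss @ ended es))"
    by simp
  show ?case
  proof (cases rt)
    case False
    \<comment> \<open>If a ribbon ends, the last set of a nonempty chain is \<open>L b\<close>, that
      is, \<open>A\<close> minus \<open>A - L b\<close> for the last entry; the sum over
      \<open>A\<close> is the new fixed column.\<close>
    define E where "E = (if ch then [?sum A] else [])"
    have lenE: "length b + length E + num_ends es = ?r" using len False ev by (cases ch) (simp_all add: E_def)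
    have "cols_det ?r (map ?sum ?Ss @ ended es) = cols_det ?r (map (\<lambda>b. ?sum (A - L b)) b @ E @ ended es)"
    proof (cases b)
      case Nil
      then show ?thesis using False ev by (simp add: E_def)
    next
      case (Cons p bs)
      have "map ?sum ?Ss = ?sum (A - L p) # diffs_left (?sum (A - L p)) (map (\<lambda>b. ?sum (A - L b)) bs @ E)"
        using sums_chain_left[of p bs "column es" ch] Cons.prems(3) False ev Cons unfolding E_def by simp
      then show ?thesis
        using cols_det_diffs_left[of "[]" "map (\<lambda>b. ?sum (A - L b)) bs @ E" "ended es" ?r "?sum (A - L p)"] lenE Cons
        by simp
    qed
    moreover have "column (ev # es) c = (\<lambda>i. x c * ?sum (A - L c) i)" for c
      using False ev by (auto simp: step_set_def)
    moreover have "ended (ev # es) = E @ ended es" "det_sign (ev # es) = (det_sign es :: 'a)"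
      "num_starts (ev # es) = ?r" using False ev by (auto simp: E_def)
    moreover have "cols_det ?r (map (\<lambda>c i. x c * ?sum (A - L c) i) b @ E @ ended es) =
        prod_list (map x b) * cols_det ?r (map (\<lambda>b. ?sum (A - L b)) b @ E @ ended es)"
      using cols_det_scale_all[of "[]" b "E @ ended es" ?r x "\<lambda>c. ?sum (A - L c)"] lenE by simp
    ultimately show ?thesis unfolding tot by simp
  next
    case True
    note rt = this
    show ?thesis
    proof (cases ch)
      case False
      have "cols_det ?r (map ?sum ?Ss @ ended es) = cols_det ?r (map (\<lambda>b. ?sum (L b)) b @ ended es)"
      proof (cases b)
        case Nil
        then show ?thesis using rt False ev by simp
      next
        case (Cons p bs)
        have "L c \<subseteq> L p" if "c \<in> set bs" for c using Cons.prems(3) Cons that by (intro L_mono) auto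
        then have "map ?sum ?Ss = diffs_right (?sum (L p)) (map (\<lambda>b. ?sum (L b)) bs)"
          using sums_chain_right[of bs "L p" "column es"] Cons.prems(3) rt False ev Cons by (simp add: L_mono)
        then show ?thesis
          using cols_det_diffs_right[of "[]" "map (\<lambda>b. ?sum (L b)) bs" "ended es" ?r "?sum (L p)"] len rt False ev Cons
          by simp
      qed
      moreover have "column (ev # es) c = (\<lambda>i. x c * ?sum (L c) i)" for c
        using False ev rt by (auto simp: step_set_def)
      moreover have "ended (ev # es) = ended es" "det_sign (ev # es) = (det_sign es :: 'a)"
        "num_starts (ev # es) = ?r" using False ev rt by auto
      moreover have "cols_det ?r (map (\<lambda>c i. x c * ?sum (L c) i) b @ ended es) =
          prod_list (map x b) * cols_det ?r (map (\<lambda>b. ?sum (L b)) b @ ended es)"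
        using cols_det_scale_all[of "[]" b "ended es" ?r x "\<lambda>c. ?sum (L c)"] Cons.prems(2) False ev rt
        by simp
      ultimately show ?thesis unfolding tot by simp
    next
      case True
      have "b \<noteq> []" using Cons.prems(2) adm(2) True rt ev by auto
      then obtain p bs where b: "b = p # bs" by (cases b) auto
      \<comment> \<open>Columns of the enlarged matrix, with the row of the starting ribbon filled
        with ones.\<close>
      define v where "v c i = (if i = ?r then 1 else ?sum (L c) i)" for c i
      have Ss: "?Ss = chain False (L p) bs" using rt True ev b by simp
      have z: "\<forall>v'\<in>set (map ?sum ?Ss) \<union> set (ended es). v' ?r = 0"
        using ended_beyond column_beyond by auto
      have "cols_det (Suc ?r) (map v b @ ended es) = cols_det (Suc ?r) (diffs_right (v p) (map v bs) @ ended es)"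
        using cols_det_diffs_right[of "[]" "map v bs" "ended es" "Suc ?r" "v p"] len Ss b by simp
      also have "diffs_right (v p) (map v bs) = map ?sum ?Ss @ [v (last (p # bs))]"
        unfolding v_def Ss using sums_chain_start[of p bs "column es" ?r] Cons.prems(3) b column_beyond by blast
      also have "cols_det (Suc ?r) ((map ?sum ?Ss @ [v (last (p # bs))]) @ ended es) =
          (- 1) ^ (?r + length ?Ss) * cols_det ?r (map ?sum ?Ss @ ended es)"
        using cols_det_unit_row[where pre = "map ?sum ?Ss" and rest = "ended es" and r = ?r and v = "v (last (p # bs))", OF _ _ z] len by (simp add: v_def)
      also have "?r + length ?Ss = num_ends es + 2 * length ?Ss" using len by simp
      finally have "cols_det (Suc ?r) (map v b @ ended es) =
          (- 1) ^ num_ends es * cols_det ?r (map ?sum ?Ss @ ended es)"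
        by (simp add: power_add power_mult)
      moreover have minus_one_power_mult_self: "(- 1) ^ n * (- 1) ^ n = (1 :: 'a)" for n
        by (simp flip: power_mult_distrib)
      ultimately have "cols_det ?r (map ?sum ?Ss @ ended es) = (- 1) ^ num_ends es * cols_det (Suc ?r) (map v b @ ended es)"
        using minus_one_power_mult_self by (simp flip: mult.assoc)
      moreover have "column (ev # es) c = (\<lambda>i. x c * v c i)" for c
        using True ev rt by (auto simp: step_set_def v_def)
      moreover have "ended (ev # es) = ended es" "det_sign (ev # es) = ((- 1) ^ num_ends es * det_sign es :: 'a)"
        "num_starts (ev # es) = Suc ?r" using True ev rt by auto
      moreover have "cols_det (Suc ?r) (map (\<lambda>c i. x c * v c i) b @ ended es) =
          prod_list (map x b) * cols_det (Suc ?r) (map v b @ ended es)"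
        using cols_det_scale_all[of "[]" b "ended es" "Suc ?r" x v] len Ss b by simp
      ultimately show ?thesis unfolding tot by (simp add: mult_ac)
    qed
  qed
qed

section \<open>Entries of the determinant as weights of single strips\<close>

fun path_weight :: "bool list \<Rightarrow> nat \<Rightarrow> 'a" where
  "path_weight [] b = x b"
| "path_weight (s # u) b = x b * (\<Sum>a\<in>step_set s b. path_weight u a)"

definition path_total :: "bool list \<Rightarrow> 'a" where
  "path_total u = (\<Sum>a\<in>A. path_weight u a)"

text \<open>Row i ignores all starts and ends after its own start; only the directions of the border
  steps matter.\<close>

lemma column_path_weight:
  "column (es2 @ (True, True) # es1) b (num_starts es1) = path_weight (map fst es2) b"
proof (induction es2 arbitrary: b)
  case (Cons ev es2)
  have "num_starts es1 < num_starts (es2 @ (True, True) # es1)" by (induction es2) auto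
  then show ?case using Cons by simp
qed simp

lemma tuples_singleton: "tuples [S] = (\<lambda>a. [a]) ` S"
  by (auto simp: tuples_Cons)

lemma total_path:
  "total ((False, True) # map (\<lambda>s. (s, False)) u @ [(True, True)]) [] = path_total u"
proof -
  have "total (map (\<lambda>s. (s, False)) u @ [(True, True)]) [b] = path_weight u b" for b
  proof (induction u arbitrary: b)
    case (Cons s u)
    have "tuples (interlacing (s, False) [b]) = (\<lambda>a. [a]) ` step_set s b"
      by (cases s) (simp_all add: tuples_singleton step_set_def)
    then show ?case using Cons by (simp add: sum.reindex inj_on_def)
  qed simp
  then show ?thesis by (simp add: path_total_def tuples_singleton sum.reindex inj_on_def)
qed

end

lemma num_starts_split:
  "i < num_starts es \<Longrightarrow> \<exists>es2 es1. es = es2 @ (True, True) # es1 \<and> num_starts es1 = i"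
proof (induction es)
  case (Cons ev es)
  show ?case
  proof (cases "ev = (True, True) \<and> i = num_starts es")
    case True
    then show ?thesis by (intro exI[of _ "[]"] exI[of _ es]) auto
  next
    case False
    then have "i < num_starts es" using Cons.prems by (auto split: if_splits)
    then obtain es2 es1 where "es = es2 @ (True, True) # es1" "num_starts es1 = i" using Cons.IH by blast
    then show ?thesis by (intro exI[of _ "ev # es2"] exI[of _ es1]) auto
  qed
qed simp

text \<open>At the end no entry is active, so the determinant consists of the fixed columns. Their
  entries are path totals from a start to a later end, or zero if the ribbon of the row has not yet
  started; the sign depends on the events only.\<close>

lemma total_eq_if_path_totals_eq:
  assumes S: "transfer A L" and T: "transfer A L'"
    and es: "admissible es" "num_ends es = num_starts es"
    and paths: "\<And>es1 es2 es3. es = es3 @ (False, True) # es2 @ (True, True) # es1 \<Longrightarrow>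
      transfer.path_total A L x (map fst es2) = transfer.path_total A L' x (map fst es2)"
  shows "transfer.total A L x es [] = transfer.total A L' x es []"
proof -
  interpret S: transfer A L x by (rule S)
  interpret T: transfer A L' x by (rule T)
  have "S.ended es = T.ended es" using paths
  proof (induction es)
    case (Cons ev es)
    have IH: "S.ended es = T.ended es"
    proof (rule Cons.IH)
      fix es1 es2 es3 assume "es = es3 @ (False, True) # es2 @ (True, True) # es1"
      then have "ev # es = (ev # es3) @ (False, True) # es2 @ (True, True) # es1" by simp
      then show "S.path_total (map fst es2) = T.path_total (map fst es2)" by (rule Cons.prems)
    qed
    have "(\<Sum>a\<in>A. S.column es a i) = (\<Sum>a\<in>A. T.column es a i)" if ev: "ev = (False, True)" for i
    proof (cases "i < num_starts es")
      case True
      then obtain es2 es1 where e: "es = es2 @ (True, True) # es1" "num_starts es1 = i"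
        using num_starts_split by blast
      then have "S.path_total (map fst es2) = T.path_total (map fst es2)"
        using Cons.prems[of "[]" es2 es1] ev by simp
      then show ?thesis
        unfolding S.path_total_def T.path_total_def e(1) e(2)[symmetric] S.column_path_weight T.column_path_weight .
    next
      case False
      then show ?thesis by (simp add: S.column_beyond T.column_beyond)
    qed
    then show ?case using IH by auto
  qed simp
  then show ?thesis
    using S.total_eq_det[of es "[]"] T.total_eq_det[of es "[]"] es by simp
qed

section \<open>Generating functions of diagrams layer by layer\<close>

text \<open>The left and the lower neighbour both lie on the preceding diagonal, so a filling can be
  tested one diagonal at a time.\<close>

definition fits :: "(nat \<Rightarrow> nat set) \<Rightarrow> cell set \<Rightarrow> (cell \<Rightarrow> nat) \<Rightarrow> cell \<Rightarrow> bool" where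
  "fits L D T c \<longleftrightarrow>
     ((fst c, snd c - 1) \<in> D \<longrightarrow> T (fst c, snd c - 1) \<in> L (T c)) \<and>
     ((fst c + 1, snd c) \<in> D \<longrightarrow> T (fst c + 1, snd c) \<notin> L (T c))"

context transfer begin

definition gen :: "cell set \<Rightarrow> 'a" where
  "gen D = (\<Sum>T\<in>{T \<in> D \<rightarrow>\<^sub>E A. \<forall>c\<in>D. fits L D T c}. \<Prod>c\<in>D. x (T c))"

lemma chain_nth:
  "t < length (chain e S bs) \<Longrightarrow> chain e S bs ! t =
    (if t = 0 then S else L (bs ! (t - 1))) - (if t < length bs then L (bs ! t) else {})"
proof (induction bs arbitrary: S t)
  case (Cons b bs)
  then show ?case by (cases t) auto
qed (simp split: if_splits)

lemma in_interlacing_right: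
  assumes "length b = (if ch then Suc l else l)"
  shows "a \<in> tuples (interlacing (True, ch) b) \<longleftrightarrow>
    length a = l \<and> (\<forall>t<l. a ! t \<in> L (b ! t) \<and> (Suc t < length b \<longrightarrow> a ! t \<notin> L (b ! Suc t)))"
proof (cases b)
  case Nil
  then show ?thesis using assms by (auto split: if_splits)
next
  case (Cons p bs)
  then have len: "length (chain (\<not> ch) (L p) bs) = l" using assms by (auto split: if_splits)
  have "a ! t \<in> chain (\<not> ch) (L p) bs ! t \<longleftrightarrow>
      a ! t \<in> L (b ! t) \<and> (Suc t < length b \<longrightarrow> a ! t \<notin> L (b ! Suc t))" if "t < l" for t
  proof -
    have t: "t < length (chain (\<not> ch) (L p) bs)" using that len by simp
    show ?thesis unfolding chain_nth[OF t] using Cons by (cases t) simp_all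
  qed
  then have "(\<forall>t<l. a ! t \<in> chain (\<not> ch) (L p) bs ! t) \<longleftrightarrow>
      (\<forall>t<l. a ! t \<in> L (b ! t) \<and> (Suc t < length b \<longrightarrow> a ! t \<notin> L (b ! Suc t)))" by (rule all_cong)
  moreover have "interlacing (True, ch) b = chain (\<not> ch) (L p) bs" using Cons by simp
  ultimately show ?thesis unfolding in_tuples_iff using len by metis
qed

lemma in_interlacing_up:
  assumes "l = (if ch then Suc (length b) else length b)"
  shows "a \<in> tuples (interlacing (False, ch) b) \<longleftrightarrow>
    length a = l \<and> (\<forall>t<l. (t = 0 \<longrightarrow> a ! t \<in> A) \<and> (0 < t \<longrightarrow> a ! t \<in> L (b ! (t - 1))) \<and>
      (t < length b \<longrightarrow> a ! t \<notin> L (b ! t)))"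
proof -
  have len: "length (chain ch A b) = l" using assms by simp
  have "a ! t \<in> chain ch A b ! t \<longleftrightarrow> (t = 0 \<longrightarrow> a ! t \<in> A) \<and> (0 < t \<longrightarrow> a ! t \<in> L (b ! (t - 1))) \<and>
      (t < length b \<longrightarrow> a ! t \<notin> L (b ! t))" if "t < l" for t
  proof -
    have t: "t < length (chain ch A b)" using that len by simp
    show ?thesis unfolding chain_nth[OF t] by (cases t) simp_all
  qed
  then have "(\<forall>t<l. a ! t \<in> chain ch A b ! t) \<longleftrightarrow>
      (\<forall>t<l. (t = 0 \<longrightarrow> a ! t \<in> A) \<and> (0 < t \<longrightarrow> a ! t \<in> L (b ! (t - 1))) \<and>
        (t < length b \<longrightarrow> a ! t \<notin> L (b ! t)))" by (rule all_cong)
  then show ?thesis unfolding in_tuples_iff interlacing.simps len by metis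
qed

end

text \<open>On diagonal \<open>d\<close> the diagram consists of \<open>n d\<close> consecutive cells, the southeasternmost one in row \<open>r d\<close>.\<close>

locale layers = transfer A L x
  for A :: "nat set" and L :: "nat \<Rightarrow> nat set" and x :: "nat \<Rightarrow> 'a :: comm_ring_1" +
  fixes D :: "cell set" and r :: "int \<Rightarrow> int" and n :: "int \<Rightarrow> nat" and P :: int
  assumes finite_D: "finite D"
    and cells: "(i, j) \<in> D \<longleftrightarrow> r (j - i) - int (n (j - i)) < i \<and> i \<le> r (j - i)"
    and steps: "(r (d + 1) = r d \<and> (n (d + 1) = n d \<or> n (d + 1) = Suc (n d))) \<or>
      (r (d + 1) = r d - 1 \<and> (n (d + 1) = n d \<or> n d = Suc (n (d + 1))))"
    and before: "d < P \<Longrightarrow> n d = 0"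
begin

definition event_at :: "int \<Rightarrow> event" where
  "event_at d = (r (d + 1) = r d, n (d + 1) \<noteq> n d)"

text \<open>The first event leads from the empty diagonal \<open>P - 1\<close> to \<open>P\<close>;
  after k events the current diagonal is \<open>P - 1 + k\<close>.\<close>

fun events :: "nat \<Rightarrow> event list" where
  "events 0 = []"
| "events (Suc k) = event_at (P - 1 + int k) # events k"

definition cell_at :: "int \<Rightarrow> int \<Rightarrow> cell" where
  "cell_at d t = (r d - t, r d - t + d)"

lemma diag_of_cell_at [simp]: "diag_of (cell_at d t) = d"
  by (simp add: cell_at_def diag_of_def)

lemma cell_at_in_D [simp]: "cell_at d t \<in> D \<longleftrightarrow> 0 \<le> t \<and> t < int (n d)"
  unfolding cell_at_def cells by auto

definition layer :: "int \<Rightarrow> cell set" where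
  "layer d = {c \<in> D. diag_of c = d}"

definition below :: "int \<Rightarrow> cell set" where
  "below d = {c \<in> D. diag_of c \<le> d}"

definition config :: "int \<Rightarrow> (cell \<Rightarrow> nat) \<Rightarrow> nat list" where
  "config d T = map (\<lambda>t. T (cell_at d (int t))) [0..<n d]"

lemma length_config [simp]: "length (config d T) = n d"
  by (simp add: config_def)

lemma config_nth [simp]: "t < n d \<Longrightarrow> config d T ! t = T (cell_at d (int t))"
  by (simp add: config_def)

lemma layer_eq: "layer d = (\<lambda>t. cell_at d (int t)) ` {..<n d}"
proof (intro subset_antisym subsetI)
  fix c assume c: "c \<in> layer d"
  obtain i j where ij: "c = (i, j)" by fastforce
  have d: "j - i = d" using c ij by (simp add: layer_def diag_of_def)
  then have "r d - int (n d) < i \<and> i \<le> r d" using c ij cells[of i j] by (simp add: layer_def)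
  then have "c = cell_at d (int (nat (r d - i)))" "nat (r d - i) < n d"
    using ij d by (auto simp: cell_at_def)
  then show "c \<in> (\<lambda>t. cell_at d (int t)) ` {..<n d}" by blast
qed (auto simp: layer_def)

lemma below_Suc: "below (d + 1) = below d \<union> layer (d + 1)" "below d \<inter> layer (d + 1) = {}"
  by (auto simp: below_def layer_def)

lemma prod_layer: "(\<Prod>c\<in>layer d. x (T c)) = prod_list (map x (config d T))"
proof -
  have "inj_on (\<lambda>t. cell_at d (int t)) {..<n d}" by (auto simp: inj_on_def cell_at_def)
  then have "(\<Prod>c\<in>layer d. x (T c)) = (\<Prod>t<n d. x (T (cell_at d (int t))))"
    unfolding layer_eq by (simp add: prod.reindex)
  also have "\<dots> = prod_list (map x (config d T))"
    by (simp add: prod.list_conv_set_nth lessThan_atLeast0)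
  finally show ?thesis .
qed

text \<open>At a right step the left and lower neighbours of cell t are the cells t and t - 1 of the
  preceding diagonal, at an up step the cells t + 1 and t. This is the index pattern of the
  chains.\<close>

lemma fits_layer_iff:
  assumes A: "\<And>c. c \<in> layer d \<Longrightarrow> T c \<in> A"
  shows "(\<forall>c\<in>layer (d + 1). fits L D T c) \<longleftrightarrow>
    config d T \<in> tuples (interlacing (event_at d) (config (d + 1) T))"
proof -
  let ?a = "config d T" and ?b = "config (d + 1) T"
  have all: "(\<forall>c\<in>layer (d + 1). fits L D T c) \<longleftrightarrow> (\<forall>t<n (d + 1). fits L D T (cell_at (d + 1) (int t)))"
    unfolding layer_eq by auto
  from steps[of d] show ?thesis
  proof (elim disjE[where P = "_ \<and> _"])
    assume s: "r (d + 1) = r d \<and> (n (d + 1) = n d \<or> n (d + 1) = Suc (n d))"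
    then have ev: "event_at d = (True, n (d + 1) \<noteq> n d)" by (simp add: event_at_def)
    have "fits L D T (cell_at (d + 1) (int t)) \<longleftrightarrow>
        (t < n d \<longrightarrow> ?a ! t \<in> L (?b ! t)) \<and> (0 < t \<longrightarrow> ?a ! (t - 1) \<notin> L (?b ! t))" if t: "t < n (d + 1)" for t
    proof -
      have nb: "(fst (cell_at (d + 1) (int t)), snd (cell_at (d + 1) (int t)) - 1) = cell_at d (int t)"
        "(fst (cell_at (d + 1) (int t)) + 1, snd (cell_at (d + 1) (int t))) = cell_at d (int t - 1)"
        using s by (auto simp: cell_at_def)
      have "int t - 1 = int (t - 1)" if "0 < t" using that by simp
      moreover have "0 < t \<Longrightarrow> t - 1 < n d" using t s by auto
      ultimately show ?thesis unfolding fits_def nb using t by auto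
    qed
    then have "(\<forall>c\<in>layer (d + 1). fits L D T c) \<longleftrightarrow> (\<forall>t<n (d + 1).
        (t < n d \<longrightarrow> ?a ! t \<in> L (?b ! t)) \<and> (0 < t \<longrightarrow> ?a ! (t - 1) \<notin> L (?b ! t)))"
      unfolding all by blast
    also have "\<dots> \<longleftrightarrow> (\<forall>t<n d. ?a ! t \<in> L (?b ! t) \<and> (Suc t < n (d + 1) \<longrightarrow> ?a ! t \<notin> L (?b ! Suc t)))"
    proof safe
      fix t assume H: "\<forall>t<n (d + 1). (t < n d \<longrightarrow> ?a ! t \<in> L (?b ! t)) \<and> (0 < t \<longrightarrow> ?a ! (t - 1) \<notin> L (?b ! t))"
        and t: "t < n d"
      show "?a ! t \<in> L (?b ! t)" using H t s by auto
      assume t': "Suc t < n (d + 1)" and m: "?a ! t \<in> L (?b ! Suc t)"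
      show False using spec[OF H, of "Suc t"] t' m by simp
    next
      fix t assume H: "\<forall>t<n d. ?a ! t \<in> L (?b ! t) \<and> (Suc t < n (d + 1) \<longrightarrow> ?a ! t \<notin> L (?b ! Suc t))"
        and t: "t < n (d + 1)"
      show "?a ! t \<in> L (?b ! t)" if "t < n d" using H that by blast
      assume t': "0 < t" and m: "?a ! (t - 1) \<in> L (?b ! t)"
      show False using spec[OF H, of "t - 1"] t t' m s by auto
    qed
    also have "\<dots> \<longleftrightarrow> ?a \<in> tuples (interlacing (event_at d) ?b)"
      unfolding ev using in_interlacing_right[of ?b "n (d + 1) \<noteq> n d" "n d" ?a] s by auto
    finally show ?thesis .
  next
    assume s: "r (d + 1) = r d - 1 \<and> (n (d + 1) = n d \<or> n d = Suc (n (d + 1)))"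
    then have ev: "event_at d = (False, n (d + 1) \<noteq> n d)" by (simp add: event_at_def)
    have "fits L D T (cell_at (d + 1) (int t)) \<longleftrightarrow>
        (Suc t < n d \<longrightarrow> ?a ! Suc t \<in> L (?b ! t)) \<and> ?a ! t \<notin> L (?b ! t)" if t: "t < n (d + 1)" for t
    proof -
      have nb: "(fst (cell_at (d + 1) (int t)), snd (cell_at (d + 1) (int t)) - 1) = cell_at d (int (Suc t))"
        "(fst (cell_at (d + 1) (int t)) + 1, snd (cell_at (d + 1) (int t))) = cell_at d (int t)"
        using s by (auto simp: cell_at_def)
      have "t < n d" using t s by auto
      moreover have "1 + int t < int (n d) \<longleftrightarrow> Suc t < n d" by linarith
      ultimately show ?thesis unfolding fits_def nb cell_at_in_D using t by simp
    qed
    then have "(\<forall>c\<in>layer (d + 1). fits L D T c) \<longleftrightarrow> (\<forall>t<n (d + 1).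
        (Suc t < n d \<longrightarrow> ?a ! Suc t \<in> L (?b ! t)) \<and> ?a ! t \<notin> L (?b ! t))"
      unfolding all by blast
    also have "\<dots> \<longleftrightarrow> (\<forall>t<n d. (t = 0 \<longrightarrow> ?a ! t \<in> A) \<and> (0 < t \<longrightarrow> ?a ! t \<in> L (?b ! (t - 1))) \<and>
      (t < n (d + 1) \<longrightarrow> ?a ! t \<notin> L (?b ! t)))"
    proof safe
      fix t assume H: "\<forall>t<n (d + 1). (Suc t < n d \<longrightarrow> ?a ! Suc t \<in> L (?b ! t)) \<and> ?a ! t \<notin> L (?b ! t)"
        and t: "t < n d"
      show "0 < n d \<Longrightarrow> ?a ! 0 \<in> A" using A[of "cell_at d 0"] by (simp add: layer_def)
      show "?a ! t \<in> L (?b ! (t - 1))" if "0 < t" using spec[OF H, of "t - 1"] that t s by auto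
      show False if "t < n (d + 1)" "?a ! t \<in> L (?b ! t)" using H that by blast
    next
      fix t assume H: "\<forall>t<n d. (t = 0 \<longrightarrow> ?a ! t \<in> A) \<and> (0 < t \<longrightarrow> ?a ! t \<in> L (?b ! (t - 1))) \<and>
          (t < n (d + 1) \<longrightarrow> ?a ! t \<notin> L (?b ! t))"
        and t: "t < n (d + 1)"
      show "?a ! Suc t \<in> L (?b ! t)" if "Suc t < n d" using spec[OF H, of "Suc t"] that by simp
      show False if "?a ! t \<in> L (?b ! t)" using spec[OF H, of t] that t s by auto
    qed
    also have "\<dots> \<longleftrightarrow> ?a \<in> tuples (interlacing (event_at d) ?b)"
      unfolding ev using in_interlacing_up[of "n d" "n (d + 1) \<noteq> n d" ?b ?a] s by auto
    finally show ?thesis .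
  qed
qed

definition fillings :: "int \<Rightarrow> (cell \<Rightarrow> nat) set" where
  "fillings d = {T \<in> below d \<rightarrow>\<^sub>E A. \<forall>c\<in>below d. fits L D T c}"

definition partial :: "int \<Rightarrow> nat list \<Rightarrow> 'a" where
  "partial d b = (\<Sum>T\<in>{T \<in> fillings d. config d T = b}. \<Prod>c\<in>below d. x (T c))"

lemma finite_below [simp]: "finite (below d)" "finite (layer d)"
  using finite_D by (auto simp: below_def layer_def)

lemma finite_fillings [simp]: "finite (fillings d)"
  unfolding fillings_def by (rule finite_subset[OF _ finite_PiE[of "below d" "\<lambda>_. A"]]) auto

lemma fits_cong:
  assumes "T c = T' c" "\<And>c'. c' \<in> D \<Longrightarrow> diag_of c' = diag_of c - 1 \<Longrightarrow> T c' = T' c'"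
  shows "fits L D T c \<longleftrightarrow> fits L D T' c"
proof -
  have "diag_of (fst c, snd c - 1) = diag_of c - 1" "diag_of (fst c + 1, snd c) = diag_of c - 1"
    by (auto simp: diag_of_def)
  then have "(fst c, snd c - 1) \<in> D \<Longrightarrow> T (fst c, snd c - 1) = T' (fst c, snd c - 1)"
    "(fst c + 1, snd c) \<in> D \<Longrightarrow> T (fst c + 1, snd c) = T' (fst c + 1, snd c)"
    using assms(2) by blast+
  then show ?thesis unfolding fits_def assms(1) by auto
qed

lemma config_cong: "(\<And>c. c \<in> layer d \<Longrightarrow> T c = T' c) \<Longrightarrow> config d T = config d T'"
  unfolding config_def layer_eq by auto

lemma layer_subset_below: "layer d \<subseteq> below d"
  by (auto simp: layer_def below_def)

text \<open>The top layer is prescribed and its conditions involve only diagonal \<open>d\<close>;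
  so restriction to \<open>below d\<close> is a bijection onto the fillings whose last layer
  interlaces with \<open>b\<close>.\<close>

lemma partial_step:
  assumes b: "length b = n (d + 1)" "set b \<subseteq> A"
  shows "partial (d + 1) b =
    prod_list (map x b) * (\<Sum>a\<in>tuples (interlacing (event_at d) b). partial d a)"
proof -
  let ?X = "tuples (interlacing (event_at d) b)"
  let ?w = "\<lambda>d T. \<Prod>c\<in>below d. x (T c)"
  let ?U = "{T \<in> fillings d. config d T \<in> ?X}"
  let ?V = "{T \<in> fillings (d + 1). config (d + 1) T = b}"
  \<comment> \<open>Inverts \<open>cell_at (d + 1)\<close>: the cell in row r (d + 1) - t receives
    the entry with index t.\<close>
  define top where "top c = b ! nat (r (d + 1) - fst c)" for c :: cell
  define res where "res T = restrict T (below d)" for T :: "cell \<Rightarrow> nat"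
  define ext where "ext T c = (if c \<in> below d then T c else if c \<in> layer (d + 1) then top c else undefined)"
    for T :: "cell \<Rightarrow> nat" and c
  have top_cell: "top (cell_at (d + 1) (int t)) = b ! t" if "t < n (d + 1)" for t
    using that by (simp add: top_def cell_at_def)
  have topA: "top c \<in> A" if "c \<in> layer (d + 1)" for c
  proof -
    obtain t where "t < n (d + 1)" "c = cell_at (d + 1) (int t)" using \<open>c \<in> layer (d + 1)\<close> unfolding layer_eq by auto
    then show ?thesis using top_cell b by auto
  qed
  have inX: "config d T \<in> ?X" if "T \<in> fillings (d + 1)" "config (d + 1) T = b" for T
    using fits_layer_iff[of d T] that layer_subset_below[of d] unfolding fillings_def below_Suc by auto
  have sub: "layer d \<subseteq> below d" by (rule layer_subset_below)
  have lower: "c' \<in> below d" if "c' \<in> D" "c \<in> below d" "diag_of c' = diag_of c - 1" for c c'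
    using that by (simp add: below_def)
  have "partial (d + 1) b = (\<Sum>T\<in>?U. prod_list (map x b) * ?w d T)"
    unfolding partial_def
  proof (rule sum.reindex_bij_witness[of _ ext res])
    fix T assume T: "T \<in> ?V"
    have Tc: "T c = top c" if "c \<in> layer (d + 1)" for c
    proof -
      obtain t where t: "t < n (d + 1)" "c = cell_at (d + 1) (int t)" using \<open>c \<in> layer (d + 1)\<close> unfolding layer_eq by auto
      then have "T c = config (d + 1) T ! t" by simp
      also have "\<dots> = b ! t" using T by blast
      finally show ?thesis using t top_cell by simp
    qed
    show "ext (res T) = T"
    proof
      fix c
      have "T c = undefined" if "c \<notin> below (d + 1)" using T that PiE_arb unfolding fillings_def by fast
      then show "ext (res T) c = T c" unfolding ext_def res_def using Tc below_Suc by auto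
    qed
    have "res T \<in> fillings d"
    proof -
      have "fits L D (res T) c" if "c \<in> below d" for c
      proof -
        have "fits L D T c" using T that below_Suc by (auto simp: fillings_def)
        moreover have "fits L D T c \<longleftrightarrow> fits L D (res T) c"
          using that lower[OF _ that] by (intro fits_cong) (simp_all add: res_def)
        ultimately show ?thesis by simp
      qed
      then show ?thesis using T below_Suc unfolding fillings_def res_def by auto
    qed
    moreover have "config d (res T) = config d T" by (rule config_cong) (use sub in \<open>auto simp: res_def\<close>)
    ultimately show "res T \<in> ?U" using inX T by auto
    have "?w (d + 1) T = ?w d T * (\<Prod>c\<in>layer (d + 1). x (T c))"
      unfolding below_Suc(1) by (rule prod.union_disjoint) (use below_Suc in auto)
    also have "?w d T = ?w d (res T)" by (rule prod.cong) (auto simp: res_def)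
    finally show "prod_list (map x b) * ?w d (res T) = ?w (d + 1) T"
      using T by (simp add: prod_layer mult.commute)
  next
    fix T assume T: "T \<in> ?U"
    have ext_below: "ext T c = T c" if "c \<in> below d" for c using that by (simp add: ext_def)
    have ext_layer: "ext T c = top c" if "c \<in> layer (d + 1)" for c
      using that below_Suc(2)[of d] by (auto simp: ext_def)
    show "res (ext T) = T"
    proof
      fix c show "res (ext T) c = T c"
      proof (cases "c \<in> below d")
        case False
        then have "T c = undefined" using T PiE_arb unfolding fillings_def by fast
        then show ?thesis using False by (simp add: res_def)
      qed (simp add: res_def ext_below)
    qed
    have cfg: "config (d + 1) (ext T) = b"
      using b(1) by (intro nth_equalityI) (simp_all add: ext_layer top_cell layer_eq)
    have cfg': "config d (ext T) = config d T" by (rule config_cong) (use sub ext_below in auto)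
    have A: "ext T c \<in> A" if "c \<in> below (d + 1)" for c
    proof (cases "c \<in> below d")
      case True
      then have "T c \<in> A" using T unfolding fillings_def by (blast dest: PiE_mem)
      then show ?thesis using ext_below[OF True] by simp
    next
      case False
      then have "c \<in> layer (d + 1)" using that below_Suc(1) by blast
      then show ?thesis using topA ext_layer by simp
    qed
    have "\<forall>c\<in>layer (d + 1). fits L D (ext T) c"
    proof -
      have "ext T c \<in> A" if "c \<in> layer d" for c using A that sub below_Suc(1) by blast
      then show ?thesis using fits_layer_iff[of d "ext T"] cfg cfg' T by simp
    qed
    moreover have "fits L D (ext T) c" if "c \<in> below d" for c
    proof -
      have "fits L D T c" using T that by (auto simp: fillings_def)
      moreover have "fits L D (ext T) c \<longleftrightarrow> fits L D T c"
        using that lower[OF _ that] ext_below by (intro fits_cong) simp_all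
      ultimately show ?thesis by simp
    qed
    moreover have "ext T \<in> below (d + 1) \<rightarrow>\<^sub>E A" using A below_Suc(1) by (intro PiE_I) (simp_all add: ext_def)
    ultimately have "ext T \<in> fillings (d + 1)" unfolding fillings_def below_Suc(1) by blast
    then show "ext T \<in> ?V" using cfg by simp
  qed
  also have "\<dots> = prod_list (map x b) * (\<Sum>T\<in>?U. ?w d T)" by (simp add: sum_distrib_left)
  also have "(\<Sum>T\<in>?U. ?w d T) = (\<Sum>a\<in>?X. \<Sum>T\<in>{T \<in> ?U. config d T = a}. ?w d T)"
    by (rule sum.group[symmetric]) (auto simp: finite_interlacing)
  also have "\<dots> = (\<Sum>a\<in>?X. partial d a)"
    unfolding partial_def by (intro sum.cong refl arg_cong2[where f = sum]) auto
  finally show ?thesis .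
qed

lemma num_starts_events: "n (P - 1 + int k) + num_ends (events k) = num_starts (events k)"
proof (induction k)
  case 0 then show ?case by (simp add: before)
next
  case (Suc k)
  let ?d = "P - 1 + int k"
  have "P - 1 + int (Suc k) = ?d + 1" by simp
  then show ?case using Suc steps[of ?d] by (auto simp: event_at_def)
qed

lemma admissible_events: "admissible (events k)"
proof (induction k)
  case (Suc k)
  then show ?case using num_starts_events[of "Suc k"] by simp
qed simp

lemma partial_eq_total:
  "length b = n (P - 1 + int k) \<Longrightarrow> sorted_wrt (>) b \<Longrightarrow> set b \<subseteq> A \<Longrightarrow> partial (P - 1 + int k) b = total (events k) b"
proof (induction k arbitrary: b)
  case 0
  have "below (P - 1) = {}"
    using before cells by (fastforce simp: below_def diag_of_def)
  then have "fillings (P - 1) = {\<lambda>_. undefined}" by (auto simp: fillings_def)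
  moreover have "config (P - 1) T = []" for T by (simp add: config_def before)
  ultimately show ?case using 0 \<open>below (P - 1) = {}\<close> by (simp add: partial_def before)
next
  case (Suc k)
  let ?d = "P - 1 + int k"
  have d: "P - 1 + int (Suc k) = ?d + 1" by simp
  have "partial (?d + 1) b = prod_list (map x b) * (\<Sum>a\<in>tuples (interlacing (event_at ?d) b). partial ?d a)"
    using partial_step[of b ?d] Suc.prems d by simp
  also have "(\<Sum>a\<in>tuples (interlacing (event_at ?d) b). partial ?d a) =
      (\<Sum>a\<in>tuples (interlacing (event_at ?d) b). total (events k) a)"
  proof (intro sum.cong refl Suc.IH)
    fix a assume a: "a \<in> tuples (interlacing (event_at ?d) b)"
    show "sorted_wrt (>) a" "set a \<subseteq> A" using interlacing_decreasing[OF a Suc.prems(2)] by auto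
    from steps[of ?d] show "length a = n ?d"
    proof (elim disjE[where P = "_ \<and> _"])
      assume s: "r (?d + 1) = r ?d \<and> (n (?d + 1) = n ?d \<or> n (?d + 1) = Suc (n ?d))"
      then show ?thesis
        using a in_interlacing_right[of b "n (?d + 1) \<noteq> n ?d" "n ?d" a] Suc.prems(1) d by (auto simp: event_at_def)
    next
      assume s: "r (?d + 1) = r ?d - 1 \<and> (n (?d + 1) = n ?d \<or> n ?d = Suc (n (?d + 1)))"
      then show ?thesis
        using a in_interlacing_up[of "n ?d" "n (?d + 1) \<noteq> n ?d" b a] Suc.prems(1) d by (auto simp: event_at_def)
    qed
  qed
  finally show ?case unfolding d by simp
qed

lemma gen_eq_total:
  assumes "\<And>d. P - 1 + int k \<le> d \<Longrightarrow> n d = 0"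
  shows "gen D = total (events k) []"
proof -
  let ?d = "P - 1 + int k"
  have "diag_of c \<le> ?d" if "c \<in> D" for c
  proof (rule ccontr)
    assume "\<not> diag_of c \<le> ?d"
    then have "n (diag_of c) = 0" using assms by simp
    moreover have "r (diag_of c) - int (n (diag_of c)) < fst c \<and> fst c \<le> r (diag_of c)"
      using \<open>c \<in> D\<close> cells[of "fst c" "snd c"] by (simp add: diag_of_def)
    ultimately show False by simp
  qed
  then have "below ?d = D" by (auto simp: below_def)
  then have "gen D = partial ?d []"
    unfolding gen_def partial_def fillings_def using assms[of ?d] by (simp add: config_def)
  then show ?thesis using partial_eq_total[of "[]" k] assms[of ?d] by simp
qed

end

section \<open>Segments of the border ribbon\<close>

context transfer begin

text \<open>A strip is a diagram with one start and one end; \<open>rev\<close> appears because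
  event lists have the latest event first.\<close>

lemma gen_strip: "gen (strip c u) = path_total (rev u)"
proof -
  define p where "p = diag_of c"
  define l where "l = length u"
  \<comment> \<open>The last summand lowers the row once after the last diagonal, so that leaving
    the strip counts as an up step and hence as an end.\<close>
  define r where "r d = fst c - int (count_list (take (nat (d - p)) u) False) - (if d > p + int l then 1 else 0)" for d
  define n :: "int \<Rightarrow> nat" where "n d = (if p \<le> d \<and> d \<le> p + int l then 1 else 0)" for d
  have r_cell: "strip_end c (take k u) = (r (p + int k), r (p + int k) + (p + int k))" if "k \<le> l" for k
  proof -
    have "fst (strip_end c (take k u)) = r (p + int k)" using that by (simp add: strip_end_eq r_def)
    moreover have "diag_of (strip_end c (take k u)) = p + int k" using that by (simp add: p_def l_def)
    ultimately show ?thesis by (cases "strip_end c (take k u)") (simp add: diag_of_def)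
  qed
  have r_Suc: "r (p + int k + 1) = r (p + int k) - (if u ! k then 0 else 1)" if "k < l" for k
  proof -
    have "nat (p + int k + 1 - p) = Suc k" by simp
    then show ?thesis using that by (simp add: r_def take_Suc_conv_app_nth l_def)
  qed
  interpret lay: layers A L x "strip c u" r n p
  proof
    fix i j
    show "(i, j) \<in> strip c u \<longleftrightarrow> r (j - i) - int (n (j - i)) < i \<and> i \<le> r (j - i)"
    proof
      assume "(i, j) \<in> strip c u"
      then obtain k where k: "k \<le> l" "(i, j) = strip_end c (take k u)" by (auto simp: strip_conv l_def)
      then have "i = r (p + int k)" "j - i = p + int k" using r_cell by auto
      then show "r (j - i) - int (n (j - i)) < i \<and> i \<le> r (j - i)" using k(1) by (simp add: n_def)
    next
      assume *: "r (j - i) - int (n (j - i)) < i \<and> i \<le> r (j - i)"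
      then have n: "p \<le> j - i" "j - i \<le> p + int l" by (auto simp: n_def split: if_splits)
      then obtain k where k: "j - i = p + int k" "k \<le> l" by (metis add.commute add_le_cancel_right of_nat_le_iff zle_iff_zadd)
      have "i = r (j - i)" using * n by (simp add: n_def)
      then have "(i, j) = strip_end c (take k u)" using k r_cell[of k] by simp
      then show "(i, j) \<in> strip c u" using k(2) by (auto simp: strip_conv l_def)
    qed
  next
    fix d
    consider "d + 1 < p" | "d + 1 = p" | k where "d = p + int k" "k < l" | "d = p + int l" | "d > p + int l"
      by (metis add.commute linorder_neqE_linordered_idom nat_int_comparison(2) zless_iff_Suc_zadd
          add_le_cancel_right le_less less_le_not_le not_less zle_iff_zadd zless_imp_add1_zle add_less_cancel_left)
    then show "(r (d + 1) = r d \<and> (n (d + 1) = n d \<or> n (d + 1) = Suc (n d))) \<or>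
      (r (d + 1) = r d - 1 \<and> (n (d + 1) = n d \<or> n d = Suc (n (d + 1))))"
    proof cases
      case 3
      then show ?thesis using r_Suc[of k] by (auto simp: n_def)
    next
      case 4
      then have "nat (d + 1 - p) = Suc l" "nat (d - p) = l" by auto
      then show ?thesis using 4 by (simp add: n_def r_def l_def)
    qed (auto simp: n_def r_def l_def)
  qed (auto simp: n_def)
  have ev: "lay.events (Suc k) = map (\<lambda>s. (s, False)) (rev (take k u)) @ [(True, True)]" if "k \<le> l" for k
    using that
  proof (induction k)
    case 0
    have "lay.event_at (p - 1) = (True, True)" by (simp add: lay.event_at_def n_def r_def)
    then show ?case by simp
  next
    case (Suc k)
    have "p - 1 + int (Suc k) = p + int k" by simp
    moreover have "lay.event_at (p + int k) = (u ! k, False)"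
      using Suc.prems r_Suc[of k] by (simp add: lay.event_at_def n_def)
    ultimately show ?case using Suc by (simp add: take_Suc_conv_app_nth l_def)
  qed
  have "p - 1 + int (Suc l) = p + int l" by simp
  moreover have "lay.event_at (p + int l) = (False, True)"
  proof -
    have "nat (p + int l + 1 - p) = Suc l" by simp
    then show ?thesis by (simp add: lay.event_at_def n_def r_def l_def)
  qed
  ultimately have "lay.events (Suc (Suc l)) = (False, True) # map (\<lambda>s. (s, False)) (rev u) @ [(True, True)]"
    using ev[of l] by (simp add: l_def)
  moreover have "gen (strip c u) = total (lay.events (Suc (Suc l))) []"
    by (rule lay.gen_eq_total) (simp add: n_def)
  ultimately show ?thesis using total_path by simp
qed

end

definition diag_count :: "cell set \<Rightarrow> int \<Rightarrow> nat" where
  "diag_count D d = card {c \<in> D. diag_of c = d}"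

context layers begin

lemma n_eq_diag_count: "n d = diag_count D d"
proof -
  have "inj_on (\<lambda>t. cell_at d (int t)) {..<n d}" by (auto simp: inj_on_def cell_at_def)
  then have "card (layer d) = n d" unfolding layer_eq by (simp add: card_image)
  then show ?thesis by (simp add: diag_count_def layer_def)
qed

lemma events_suffix: "events k = xs @ ys \<Longrightarrow> ys = events (length ys)"
proof (induction k arbitrary: xs)
  case (Suc k)
  show ?case
  proof (cases xs)
    case Nil
    have "length (events j) = j" for j by (induction j) auto
    then show ?thesis using Suc.prems Nil by (metis append_Nil)
  next
    case (Cons e xs')
    then show ?thesis using Suc.prems Suc.IH[of xs'] by simp
  qed
qed simp

definition step_word :: "int \<Rightarrow> nat \<Rightarrow> bool list" where
  "step_word p k = map (\<lambda>i. r (p + int i + 1) = r (p + int i)) [0..<k]"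

lemma events_append: "events (k + l) = rev (map (\<lambda>i. event_at (P - 1 + int k + int i)) [0..<l]) @ events k"
  by (induction l) (simp_all add: algebra_simps)

lemma border_cells: "segment SE D p q =
  (\<lambda>d. cell_at d 0) ` {d. p \<le> d \<and> d \<le> q \<and> 0 < n d}"
proof (intro subset_antisym subsetI)
  fix c assume c: "c \<in> segment SE D p q"
  obtain i j where ij: "c = (i, j)" by fastforce
  have "(i, j) \<in> D" "(i + 1, j + 1) \<notin> D" using c ij by auto
  then have "i = r (j - i)" "0 < n (j - i)" using cells[of i j] cells[of "i + 1" "j + 1"] by auto
  then have "c = cell_at (j - i) 0" "p \<le> j - i \<and> j - i \<le> q \<and> 0 < n (j - i)"
    using c ij by (auto simp: cell_at_def diag_of_def)
  then show "c \<in> (\<lambda>d. cell_at d 0) ` {d. p \<le> d \<and> d \<le> q \<and> 0 < n d}" by blast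
next
  fix c assume "c \<in> (\<lambda>d. cell_at d 0) ` {d. p \<le> d \<and> d \<le> q \<and> 0 < n d}"
  then obtain d where d: "c = cell_at d 0" "p \<le> d" "d \<le> q" "0 < n d" by blast
  have "cell_at d 0 \<in> D" "cell_at d (- 1) \<notin> D" using d by simp_all
  then have "cell_at d 0 \<in> border_ribbon SE D" by (simp add: cell_at_def algebra_simps)
  then show "c \<in> segment SE D p q" using d by simp
qed

lemma strip_step_word: "strip (cell_at p 0) (step_word p k) = (\<lambda>d. cell_at d 0) ` {p..p + int k}"
  and strip_end_step_word: "strip_end (cell_at p 0) (step_word p k) = cell_at (p + int k) 0"
proof (induction k)
  case 0
  { case 1 show ?case by (simp add: step_word_def)
  next
    case 2 show ?case by (simp add: step_word_def) }
next
  case (Suc k)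
  have w: "step_word p (Suc k) = step_word p k @ [r (p + int k + 1) = r (p + int k)]"
    by (simp add: step_word_def)
  have m: "move (r (p + int k + 1) = r (p + int k)) (cell_at (p + int k) 0) = cell_at (p + int (Suc k)) 0"
    using steps[of "p + int k"] by (auto simp: move_def cell_at_def algebra_simps)
  have "{p..p + int (Suc k)} = insert (p + int (Suc k)) {p..p + int k}" by auto
  then have "(\<lambda>d. cell_at d 0) ` {p..p + int (Suc k)} = insert (cell_at (p + int (Suc k)) 0) ((\<lambda>d. cell_at d 0) ` {p..p + int k})"
    by (simp only: image_insert)
  then show "strip (cell_at p 0) (step_word p (Suc k)) = (\<lambda>d. cell_at d 0) ` {p..p + int (Suc k)}"
    using Suc m by (simp add: w strip_snoc)
  show "strip_end (cell_at p 0) (step_word p (Suc k)) = cell_at (p + int (Suc k)) 0"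
    using Suc m by (simp add: w)
qed

end

text \<open>Starts and ends among the events are jumps of the diagonal counts, and the events
  between a start at p and an end at q spell the border segment from p to q.\<close>

lemma layers_gen_eq:
  assumes S: "layers A L D r n P" and T: "layers A L' D r n P"
    and Q: "\<And>d. Q < d \<Longrightarrow> n d = 0" and ne: "\<And>d. P \<le> d \<Longrightarrow> d \<le> Q \<Longrightarrow> 0 < n d"
    and seg: "\<And>p q. p \<le> q \<Longrightarrow> diag_count D p = Suc (diag_count D (p - 1)) \<Longrightarrow>
      diag_count D q = Suc (diag_count D (q + 1)) \<Longrightarrow>
      transfer.gen A L x (segment SE D p q) =
      transfer.gen A L' x (segment SE D p q)"
  shows "transfer.gen A L x D = transfer.gen A L' x D"
proof -
  interpret S: layers A L x D r n P by (rule S)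
  interpret T: layers A L' x D r n P by (rule T)
  define k where "k = nat (Q - P) + 2"
  have k: "n d = 0" if "P - 1 + int k \<le> d" for d using that Q[of d] by (cases "P \<le> Q") (auto simp: k_def)
  have ends: "num_ends (S.events k) = num_starts (S.events k)"
    using S.num_starts_events[of k] k[of "P - 1 + int k"] by simp
  have ev: "T.events k = S.events k" for k by (induction k) (auto simp: S.event_at_def T.event_at_def)
  have "S.total (S.events k) [] = T.total (S.events k) []"
  proof (rule total_eq_if_path_totals_eq[OF S.transfer_axioms T.transfer_axioms S.admissible_events ends])
    fix es1 es2 es3 assume eq: "S.events k = es3 @ (False, True) # es2 @ (True, True) # es1"
    define k1 where "k1 = length es1"
    define l where "l = length es2"
    define p where "p = P + int k1"
    define q where "q = p + int l"
    have e1: "(True, True) # es1 = S.events (Suc k1)"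
      using S.events_suffix[of k "es3 @ (False, True) # es2" "(True, True) # es1"] eq by (simp add: k1_def)
    then have start: "S.event_at (p - 1) = (True, True)" by (simp add: p_def algebra_simps)
    have e2: "es2 @ (True, True) # es1 = S.events (Suc k1 + l)"
      using S.events_suffix[of k "es3 @ [(False, True)]" "es2 @ (True, True) # es1"] eq
      by (simp add: k1_def l_def add.commute)
    have e3: "(False, True) # es2 @ (True, True) # es1 = S.events (Suc (Suc k1 + l))"
      using S.events_suffix[of k es3 "(False, True) # es2 @ (True, True) # es1"] eq
      by (simp add: k1_def l_def add.commute)
    have idx: "P - 1 + int (Suc k1 + l) = q" by (simp add: q_def p_def)
    have stop: "S.event_at q = (False, True)" using e3 unfolding S.events.simps idx by simp
    have es2: "es2 = rev (map (\<lambda>i. S.event_at (p + int i)) [0..<l])"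
    proof -
      have "P - 1 + int (Suc k1) = p" by (simp add: p_def)
      then have "S.events (Suc k1 + l) = rev (map (\<lambda>i. S.event_at (p + int i)) [0..<l]) @ S.events (Suc k1)"
        using S.events_append[of "Suc k1" l] by simp
      then show ?thesis using e1 e2 by simp
    qed
    have np: "n p = Suc (n (p - 1))" using start S.steps[of "p - 1"] by (auto simp: S.event_at_def)
    have nq: "n q = Suc (n (q + 1))" using stop S.steps[of q] by (auto simp: S.event_at_def)
    have pq: "P \<le> p" "q \<le> Q" "p \<le> q"
      using np nq S.before[of p] Q[of q] by (fastforce simp: p_def q_def not_le[symmetric])+
    have "{d. p \<le> d \<and> d \<le> q \<and> 0 < n d} = {p..p + int l}" using pq ne by (auto simp: q_def)
    then have seg_eq: "segment SE D p q = strip (S.cell_at p 0) (S.step_word p l)"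
      unfolding S.border_cells S.strip_step_word by simp
    have word: "rev (S.step_word p l) = map fst es2"
      unfolding es2 S.step_word_def by (simp add: rev_map comp_def S.event_at_def add.assoc)
    have "S.gen (strip (S.cell_at p 0) (S.step_word p l)) = T.gen (strip (S.cell_at p 0) (S.step_word p l))"
      using seg[OF pq(3)] np nq unfolding seg_eq S.n_eq_diag_count by simp
    then show "S.path_total (map fst es2) = T.path_total (map fst es2)"
      unfolding S.gen_strip T.gen_strip word .
  qed
  then show ?thesis using S.gen_eq_total[OF k] T.gen_eq_total[OF k] ev by simp
qed

text \<open>By convexity the first and the last row of a diagonal each stay or move up by one when
  passing to the next; the four combinations are the four kinds of events.\<close>

lemma connected_layers:
  assumes fin: "finite D" and cvx: "order_convex D" and con: "diagram_connected D" and ne: "D \<noteq> {}"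
  shows "\<exists>r n P Q. (\<forall>d. (r (d + 1) = r d \<and> (n (d + 1) = n d \<or> n (d + 1) = Suc (n d))) \<or>
      (r (d + 1) = r d - 1 \<and> (n (d + 1) = n d \<or> n d = Suc (n (d + 1))))) \<and>
    (\<forall>i j. (i, j) \<in> D \<longleftrightarrow> r (j - i) - int (n (j - i)) < i \<and> i \<le> r (j - i)) \<and>
    (\<forall>d. 0 < n d \<longleftrightarrow> P \<le> d \<and> d \<le> Q)"
proof -
  define S where "S d = {i. (i, i + d) \<in> D}" for d
  define hi where "hi d = Max (S d)" for d
  define lo where "lo d = Min (S d)" for d
  define P where "P = Min (diag_of ` D)"
  define Q where "Q = Max (diag_of ` D)"
  have fd: "finite (diag_of ` D)" "diag_of ` D \<noteq> {}" using fin ne by auto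
  have finS: "finite (S d)" for d
  proof -
    have "S d \<subseteq> fst ` D" unfolding S_def by force
    then show ?thesis using fin finite_subset by blast
  qed
  have diagS: "d \<in> diag_of ` D \<longleftrightarrow> S d \<noteq> {}" for d
  proof
    assume "d \<in> diag_of ` D"
    then obtain i j where "(i, j) \<in> D" "d = j - i" by (auto simp: diag_of_def)
    then have "i \<in> S d" by (simp add: S_def)
    then show "S d \<noteq> {}" by blast
  qed (force simp: S_def diag_of_def)
  have neS: "S d \<noteq> {} \<longleftrightarrow> P \<le> d \<and> d \<le> Q" for d
  proof
    assume "S d \<noteq> {}"
    then show "P \<le> d \<and> d \<le> Q" using diagS fd by (simp add: P_def Q_def)
  next
    assume d: "P \<le> d \<and> d \<le> Q"
    obtain a b where ab: "a \<in> D" "diag_of a = P" "b \<in> D" "diag_of b = Q"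
      using Min_in[OF fd] Max_in[OF fd] unfolding P_def Q_def by fastforce
    have "{diag_of a..diag_of b} \<subseteq> diag_of ` D"
      using con ab(1,3) unfolding connected_iff_diag_interval[OF cvx] by blast
    moreover have "d \<in> {diag_of a..diag_of b}" using d ab by simp
    ultimately show "S d \<noteq> {}" using diagS by blast
  qed
  have PQ: "P \<le> Q" using fd unfolding P_def Q_def by (meson Max_ge Min_in)
  have hl: "(hi d, hi d + d) \<in> D" "(lo d, lo d + d) \<in> D" "(i, i + d) \<in> D \<longleftrightarrow> lo d \<le> i \<and> i \<le> hi d"
    if "P \<le> d" "d \<le> Q" for d i
  proof -
    have "S d \<noteq> {}" using neS that by blast
    then show 1: "(hi d, hi d + d) \<in> D" "(lo d, lo d + d) \<in> D"
      using Max_in[OF finS] Min_in[OF finS] unfolding hi_def lo_def S_def by blast+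
    show "(i, i + d) \<in> D \<longleftrightarrow> lo d \<le> i \<and> i \<le> hi d"
      using Max_ge[OF finS, of i d] Min_le[OF finS, of i d] diag_comparable[OF cvx 1(2) 1(1), of i]
      unfolding hi_def lo_def by (auto simp: S_def)
  qed
  have lohi: "lo d \<le> hi d" if "P \<le> d" "d \<le> Q" for d using hl[OF that] by blast
  have hstep: "hi (d + 1) = hi d \<or> hi (d + 1) = hi d - 1" if "P \<le> d" "d < Q" for d
  proof -
    have d: "P \<le> d + 1" "d + 1 \<le> Q" "d \<le> Q" using that by auto
    have a: "(hi d, hi d + d) \<in> D" using hl(1)[of d] that by auto
    have b: "(hi (d + 1), hi (d + 1) + (d + 1)) \<in> D" using hl(1)[of "d + 1"] d by auto
    have "\<not> hi d < hi (d + 1)"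
    proof
      assume "hi d < hi (d + 1)"
      then have "(hi d + 1, hi d + 1 + d) \<in> D" using order_convexD[OF cvx a b, of "hi d + 1" "hi d + 1 + d"] by auto
      then show False using hl(3)[of d "hi d + 1"] that by auto
    qed
    moreover have "\<not> hi (d + 1) < hi d - 1"
    proof
      assume "hi (d + 1) < hi d - 1"
      then have "(hi (d + 1) + 1, hi (d + 1) + 1 + (d + 1)) \<in> D"
        using order_convexD[OF cvx b a, of "hi (d + 1) + 1" "hi (d + 1) + 1 + (d + 1)"] by auto
      then show False using hl(3)[of "d + 1" "hi (d + 1) + 1"] d by auto
    qed
    ultimately show ?thesis by linarith
  qed
  have lstep: "lo (d + 1) = lo d \<or> lo (d + 1) = lo d - 1" if "P \<le> d" "d < Q" for d
  proof -
    have d: "P \<le> d + 1" "d + 1 \<le> Q" "d \<le> Q" using that by auto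
    have a: "(lo d, lo d + d) \<in> D" using hl(2)[of d] that by auto
    have b: "(lo (d + 1), lo (d + 1) + (d + 1)) \<in> D" using hl(2)[of "d + 1"] d by auto
    have "\<not> lo d < lo (d + 1)"
    proof
      assume "lo d < lo (d + 1)"
      then have "(lo (d + 1) - 1, lo (d + 1) - 1 + (d + 1)) \<in> D"
        using order_convexD[OF cvx a b, of "lo (d + 1) - 1" "lo (d + 1) - 1 + (d + 1)"] by auto
      then show False using hl(3)[of "d + 1" "lo (d + 1) - 1"] d by auto
    qed
    moreover have "\<not> lo (d + 1) < lo d - 1"
    proof
      assume "lo (d + 1) < lo d - 1"
      then have "(lo d - 1, lo d - 1 + d) \<in> D"
        using order_convexD[OF cvx b a, of "lo d - 1" "lo d - 1 + d"] by auto
      then show False using hl(3)[of d "lo d - 1"] that by auto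
    qed
    ultimately show ?thesis by linarith
  qed
  \<comment> \<open>A second cell on an extreme diagonal would force, by convexity, a cell on a
    diagonal outside the range.\<close>
  have hiP: "hi P = lo P"
  proof (rule ccontr)
    assume "hi P \<noteq> lo P"
    then have "lo P < hi P" using lohi[of P] PQ by auto
    then have "(lo P + 1, lo P + P) \<in> D"
      using order_convexD[OF cvx hl(2)[of P] hl(1)[of P], of "lo P + 1" "lo P + P"] PQ by auto
    then have "lo P + 1 \<in> S (P - 1)" by (simp add: S_def)
    then show False using neS[of "P - 1"] by auto
  qed
  have hiQ: "hi Q = lo Q"
  proof (rule ccontr)
    assume "hi Q \<noteq> lo Q"
    then have "lo Q < hi Q" using lohi[of Q] PQ by auto
    then have "(lo Q, lo Q + (Q + 1)) \<in> D"
      using order_convexD[OF cvx hl(2)[of Q] hl(1)[of Q], of "lo Q" "lo Q + (Q + 1)"] PQ by auto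
    then have "lo Q \<in> S (Q + 1)" by (simp add: S_def)
    then show False using neS[of "Q + 1"] by auto
  qed
  \<comment> \<open>Constant before \<open>P\<close> and one higher up after \<open>Q\<close>:
    entering the diagram is a right step with a start, leaving it an up step with an end.\<close>
  define r where "r d = (if d < P then hi P else if d > Q then hi Q - 1 else hi d)" for d
  define n where "n d = (if P \<le> d \<and> d \<le> Q then nat (hi d - lo d + 1) else 0)" for d
  have "(r (d + 1) = r d \<and> (n (d + 1) = n d \<or> n (d + 1) = Suc (n d))) \<or>
      (r (d + 1) = r d - 1 \<and> (n (d + 1) = n d \<or> n d = Suc (n (d + 1))))" for d
  proof -
    consider "d + 1 < P" | "d + 1 = P" | "P \<le> d" "d < Q" | "d = Q" | "d > Q" by linarith
    then show ?thesis
    proof cases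
      case 2
      then show ?thesis using PQ hiP by (auto simp: r_def n_def)
    next
      case 3
      have "r d = hi d" "r (d + 1) = hi (d + 1)" "n d = nat (hi d - lo d + 1)" "n (d + 1) = nat (hi (d + 1) - lo (d + 1) + 1)"
        using 3 by (auto simp: r_def n_def)
      moreover have "lo d \<le> hi d" "lo (d + 1) \<le> hi (d + 1)" using lohi 3 by auto
      ultimately show ?thesis using hstep[OF 3] lstep[OF 3] by auto
    next
      case 4
      then show ?thesis using PQ hiQ by (auto simp: r_def n_def)
    qed (use PQ in \<open>auto simp: r_def n_def\<close>)
  qed
  moreover have "(i, j) \<in> D \<longleftrightarrow> r (j - i) - int (n (j - i)) < i \<and> i \<le> r (j - i)" for i j
  proof (cases "P \<le> j - i \<and> j - i \<le> Q")
    case True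
    then show ?thesis using hl(3)[of "j - i" i] lohi[of "j - i"] by (auto simp: r_def n_def)
  next
    case False
    then have "i \<notin> S (j - i)" using neS[of "j - i"] by blast
    then show ?thesis using False by (auto simp: S_def n_def)
  qed
  moreover have "0 < n d \<longleftrightarrow> P \<le> d \<and> d \<le> Q" for d
    using lohi[of d] by (auto simp: n_def)
  ultimately show ?thesis by blast
qed

lemma gen_eq_if_segments_eq:
  assumes S: "transfer A L" and T: "transfer A L'"
    and D: "finite D" "order_convex D" "diagram_connected D" "D \<noteq> {}"
    and seg: "\<And>p q. p \<le> q \<Longrightarrow> diag_count D p = Suc (diag_count D (p - 1)) \<Longrightarrow>
      diag_count D q = Suc (diag_count D (q + 1)) \<Longrightarrow>
      transfer.gen A L x (segment SE D p q) =
      transfer.gen A L' x (segment SE D p q)"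
  shows "transfer.gen A L x D = transfer.gen A L' x D"
proof -
  obtain r n P Q where *: "\<forall>d. (r (d + 1) = r d \<and> (n (d + 1) = n d \<or> n (d + 1) = Suc (n d))) \<or>
      (r (d + 1) = r d - 1 \<and> (n (d + 1) = n d \<or> n d = Suc (n (d + 1))))"
    "\<forall>i j. (i, j) \<in> D \<longleftrightarrow> r (j - i) - int (n (j - i)) < i \<and> i \<le> r (j - i)"
    "\<forall>d. 0 < n d \<longleftrightarrow> P \<le> d \<and> d \<le> Q"
    using connected_layers[OF D] by blast
  have "layers A L D r n P" if "transfer A L" for L
    using that D(1) * by (simp add: layers_def layers_axioms_def) (metis not_le not_gr0)
  note lay = this
  have "n d = 0" if "Q < d" for d using *(3) that by (metis gr0I not_le)
  moreover have "0 < n d" if "P \<le> d" "d \<le> Q" for d using *(3) that by blast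
  ultimately show ?thesis
    using layers_gen_eq[OF lay[OF S] lay[OF T] _ _ seg] by blast
qed

section \<open>Starts and ends of ribbons as jumps of the diagonal counts\<close>

lemma diag_count_minus_border:
  assumes "finite D" "order_convex D"
  shows "diag_count (D - border_ribbon SE D) d = diag_count D d - 1"
proof (cases "d \<in> diag_of ` D")
  case True
  let ?B = "{c \<in> border_ribbon SE D. diag_of c = d}" and ?C = "{c \<in> D. diag_of c = d}"
  obtain c where c: "c \<in> border_ribbon SE D" "diag_of c = d"
    using True diag_of_border[OF assms(1), of SE] by (metis imageE)
  have "c' = c" if c': "c' \<in> border_ribbon SE D" "diag_of c' = d" for c'
  proof -
    obtain i j i' j' where ij: "c = (i, j)" "c' = (i', j')" by fastforce
    have d: "j = i + d" "j' = i' + d" using c c' ij by (auto simp: diag_of_def)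
    have "\<not> i < i'" using diag_comparable[OF assms(2), of i d i' "i + 1"] c c' ij d by (auto simp: algebra_simps)
    moreover have "\<not> i' < i" using diag_comparable[OF assms(2), of i' d i "i' + 1"] c c' ij d by (auto simp: algebra_simps)
    ultimately show ?thesis using ij d by simp
  qed
  then have "?B = {c}" using c by blast
  moreover have "{c \<in> D - border_ribbon SE D. diag_of c = d} = ?C - ?B" by blast
  moreover have "c \<in> ?C" using c border_ribbon_subset by blast
  ultimately show ?thesis using assms(1) by (simp add: diag_count_def)
next
  case False
  then have "{c \<in> D. diag_of c = d} = {}" "{c \<in> D - border_ribbon SE D. diag_of c = d} = {}" by blast+
  then show ?thesis unfolding diag_count_def by (simp only: card.empty)
qed

lemma diag_count_pos: "finite D \<Longrightarrow> 0 < diag_count D d \<longleftrightarrow> d \<in> diag_of ` D"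
  by (auto simp: diag_count_def card_gt_0_iff)

text \<open>The component consists of the cells whose diagonals are joined to \<open>p\<close> by
  nonempty diagonals; the last clause lets neighbouring diagonals be located in it.\<close>

lemma component_at:
  assumes "order_convex D" "p \<in> diag_of ` D"
  shows "\<exists>C\<in>diagram_components D. p \<in> diag_of ` C \<and>
    (\<forall>c\<in>D. {min p (diag_of c)..max p (diag_of c)} \<subseteq> diag_of ` D \<longrightarrow> c \<in> C)"
proof -
  define I where "I = {d. {min p d..max p d} \<subseteq> diag_of ` D}"
  define C where "C = {c \<in> D. diag_of c \<in> I}"
  define A where "A = {c \<in> D. diag_of c \<notin> I \<and> diag_of c < p}"
  define B where "B = {c \<in> D. diag_of c \<notin> I \<and> p < diag_of c}"
  have pI: "p \<in> I" using assms(2) by (simp add: I_def)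
  have D: "D = A \<union> C \<union> B" using pI by (auto simp: A_def B_def C_def) (metis linorder_neqE)
  have gapA: "\<exists>e. diag_of a < e \<and> e < diag_of c \<and> e \<notin> diag_of ` D" if ac: "a \<in> A" "c \<in> C" for a c
  proof -
    have "\<exists>e\<in>{min p (diag_of a)..max p (diag_of a)}. e \<notin> diag_of ` D" using ac(1) unfolding A_def I_def by blast
    moreover have "diag_of a < p" using ac(1) by (simp add: A_def)
    ultimately obtain e where e: "diag_of a \<le> e" "e \<le> p" "e \<notin> diag_of ` D" by (auto simp: min_def max_def)
    have "diag_of a \<noteq> e" using e(3) ac(1) by (auto simp: A_def)
    moreover have "e < diag_of c"
    proof (rule ccontr)
      assume "\<not> e < diag_of c"
      then have "e \<in> {min p (diag_of c)..max p (diag_of c)}" using e by auto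
      then show False using ac(2) e(3) by (auto simp: C_def I_def)
    qed
    ultimately show ?thesis using e by force
  qed
  have gapB: "\<exists>e. diag_of c < e \<and> e < diag_of b \<and> e \<notin> diag_of ` D" if bc: "b \<in> B" "c \<in> C" for b c
  proof -
    have "\<exists>e\<in>{min p (diag_of b)..max p (diag_of b)}. e \<notin> diag_of ` D" using bc(1) unfolding B_def I_def by blast
    moreover have "p < diag_of b" using bc(1) by (simp add: B_def)
    ultimately obtain e where e: "p \<le> e" "e \<le> diag_of b" "e \<notin> diag_of ` D" by (auto simp: min_def max_def)
    have "diag_of b \<noteq> e" using e(3) bc(1) by (auto simp: B_def)
    moreover have "diag_of c < e"
    proof (rule ccontr)
      assume "\<not> diag_of c < e"
      then have "e \<in> {min p (diag_of c)..max p (diag_of c)}" using e by auto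
      then show False using bc(2) e(3) by (auto simp: C_def I_def)
    qed
    ultimately show ?thesis using e by force
  qed
  have CA: "strictly_north_east C A"
    unfolding strictly_north_east_def
  proof (intro ballI)
    fix c a assume "c \<in> C" "a \<in> A"
    then show "fst c < fst a \<and> snd a < snd c"
      using gapA[of a c] north_east_if_diag_gap[OF assms(1), of a c] by (auto simp: A_def C_def)
  qed
  have BC: "strictly_north_east B C"
    unfolding strictly_north_east_def
  proof (intro ballI)
    fix b c assume "b \<in> B" "c \<in> C"
    then show "fst b < fst c \<and> snd c < snd b"
      using gapB[of b c] north_east_if_diag_gap[OF assms(1), of c b] by (auto simp: B_def C_def)
  qed
  obtain c0 where c0: "c0 \<in> D" "diag_of c0 = p" using assms(2) by blast
  then have c0C: "c0 \<in> C" using pI by (simp add: C_def)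
  have imgC: "diag_of ` C = I"
  proof
    show "I \<subseteq> diag_of ` C"
    proof
      fix d assume d: "d \<in> I"
      then have "d \<in> diag_of ` D" by (auto simp: I_def)
      then show "d \<in> diag_of ` C" using d by (auto simp: C_def)
    qed
  qed (auto simp: C_def)
  have comp: "order_convex C" by (rule order_convex_summand[OF assms(1) D CA BC])
  have "diagram_connected C"
    unfolding connected_iff_diag_interval[OF comp] imgC
  proof (intro ballI subsetI)
    fix a b e assume "a \<in> C" "b \<in> C" "e \<in> {diag_of a..diag_of b}"
    then have ab: "{min p (diag_of a)..max p (diag_of a)} \<subseteq> diag_of ` D"
      "{min p (diag_of b)..max p (diag_of b)} \<subseteq> diag_of ` D" "diag_of a \<le> e" "e \<le> diag_of b"
      by (auto simp: C_def I_def)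
    have "{min p e..max p e} \<subseteq> diag_of ` D"
    proof
      fix t assume "t \<in> {min p e..max p e}"
      then have "t \<in> {min p (diag_of a)..max p (diag_of a)} \<or> t \<in> {min p (diag_of b)..max p (diag_of b)}"
        using ab(3,4) by (auto simp: min_def max_def split: if_splits)
      then show "t \<in> diag_of ` D" using ab(1,2) by blast
    qed
    then show "e \<in> I" by (simp add: I_def)
  qed
  then have "C \<in> diagram_components D"
    unfolding diagram_components_def using c0C D CA BC by blast
  moreover have "p \<in> diag_of ` C" using c0C c0 by blast
  moreover have "\<forall>c\<in>D. {min p (diag_of c)..max p (diag_of c)} \<subseteq> diag_of ` D \<longrightarrow> c \<in> C"
    by (simp add: C_def I_def)
  ultimately show ?thesis by blast
qed

text \<open>Removing the border lowers every nonzero count by one, so the jump at \<open>p\<close>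
  survives in the component of the rest containing \<open>p\<close>. Once diagonal p - 1 is empty,
  the border itself starts at \<open>p\<close>.\<close>

lemma start_of_ribbon:
  assumes "finite D" "order_convex D" "diagram_connected D" "diag_count D p = Suc (diag_count D (p - 1))"
  shows "\<exists>R\<in>ribbon_decomposition SE D. Min (diag_of ` R) = p"
  using assms
proof (induction "card D" arbitrary: D rule: less_induct)
  case less
  have pD: "p \<in> diag_of ` D" using less.prems diag_count_pos[of D p] by simp
  then have ne: "D \<noteq> {}" by blast
  let ?B = "border_ribbon SE D" and ?D = "D - border_ribbon SE D"
  have B: "?B \<in> ribbon_decomposition SE D"
    unfolding ribbon_decomposition_def using in_decomposition.first[OF ne, of SE] by simp
  show ?case
  proof (cases "diag_count D (p - 1) = 0")
    case True
    then have np: "p - 1 \<notin> diag_of ` D" using diag_count_pos[OF less.prems(1), of "p - 1"] by simp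
    have "p \<le> d" if "d \<in> diag_of ` D" for d
    proof (rule ccontr)
      assume "\<not> p \<le> d"
      then have "p - 1 \<in> {d..p}" by simp
      moreover have "{d..p} \<subseteq> diag_of ` D"
        using less.prems(3) that pD unfolding connected_iff_diag_interval[OF less.prems(2)] by blast
      ultimately show False using np by blast
    qed
    then have "Min (diag_of ` D) = p" using pD less.prems(1) by (intro Min_eqI) auto
    then have "Min (diag_of ` ?B) = p" using diag_of_border[OF less.prems(1)] by (simp only:)
    then show ?thesis using B by blast
  next
    case False
    have fin': "finite ?D" using less.prems(1) by simp
    have cvx': "order_convex ?D" using order_convex_minus_border less.prems(2) by blast
    have cnt: "diag_count ?D d = diag_count D d - 1" for d
      using diag_count_minus_border less.prems(1,2) by blast
    have "0 < diag_count ?D p" using cnt[of p] less.prems(4) False by simp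
    then have p': "p \<in> diag_of ` ?D" using diag_count_pos[OF fin'] by blast
    obtain C where C: "C \<in> diagram_components ?D" "p \<in> diag_of ` C"
      "\<And>c. c \<in> ?D \<Longrightarrow> {min p (diag_of c)..max p (diag_of c)} \<subseteq> diag_of ` ?D \<Longrightarrow> c \<in> C"
      using component_at[OF cvx' p'] by blast
    have CD: "C \<subseteq> ?D" using component_subset C(1) by blast
    \<comment> \<open>Remaining cells on diagonal p - 1 are joined to \<open>p\<close> and hence
      belong to the same component, so both counts can be taken in \<open>C\<close>.\<close>
    have near: "c \<in> C" if c: "c \<in> ?D" "diag_of c = p \<or> diag_of c = p - 1" for c
    proof (rule C(3)[OF c(1)])
      have "{p - 1..p} = {p - 1, p}" by auto
      note pp = this
      from c(2) show "{min p (diag_of c)..max p (diag_of c)} \<subseteq> diag_of ` ?D"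
      proof
        assume "diag_of c = p - 1"
        then show ?thesis using imageI[OF c(1), of diag_of] p' pp by (simp add: min_def max_def)
      qed (use p' in simp)
    qed
    have "{c \<in> C. diag_of c = d} = {c \<in> ?D. diag_of c = d}" if "d = p \<or> d = p - 1" for d
      using CD near that by blast
    then have cntC: "diag_count C d = diag_count ?D d" if "d = p \<or> d = p - 1" for d
      using that unfolding diag_count_def by simp
    have "card C < card D"
    proof (rule psubset_card_mono[OF less.prems(1)])
      have "?B \<noteq> {}" using diag_of_border[OF less.prems(1), of SE] ne by auto
      then show "C \<subset> D" using CD border_ribbon_subset by blast
    qed
    moreover have "finite C" using CD fin' finite_subset by blast
    moreover have "order_convex C" using order_convex_component[OF cvx' C(1)] .
    moreover have "diagram_connected C" using C(1) by (simp add: diagram_components_def)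
    moreover have "diag_count C p = Suc (diag_count C (p - 1))"
      using cntC cnt less.prems(4) False by simp
    ultimately obtain R where R: "R \<in> ribbon_decomposition SE C" "Min (diag_of ` R) = p"
      using less.hyps by blast
    then have "R \<in> ribbon_decomposition SE D"
      using in_decomposition.later[OF C(1)] by (simp add: ribbon_decomposition_def)
    then show ?thesis using R(2) by blast
  qed
qed

lemma diag_of_conj_image: "diag_of ` conj_diagram D = uminus ` diag_of ` D"
  by (simp add: conj_diagram_def image_image)

lemma diag_count_conj: "diag_count (conj_diagram D) d = diag_count D (- d)"
proof -
  have "{c \<in> conj_diagram D. diag_of c = d} = prod.swap ` {c \<in> D. diag_of c = - d}"
  proof -
    have "{c \<in> prod.swap ` D. diag_of c = d} = prod.swap ` {c \<in> D. diag_of (prod.swap c) = d}" by blast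
    moreover have "{c \<in> D. diag_of (prod.swap c) = d} = {c \<in> D. diag_of c = - d}" by auto
    ultimately show ?thesis by (simp add: conj_diagram_def)
  qed
  then show ?thesis unfolding diag_count_def by (simp add: card_image)
qed

lemma in_ribbon_decomposition_finite:
  assumes "R \<in> ribbon_decomposition x D" "finite D" shows "finite R" "R \<noteq> {}"
proof -
  have "in_decomposition x D R" using assms(1) by (simp add: ribbon_decomposition_def)
  then show "finite R" by (rule finite_subset[OF in_decomposition_subset assms(2)])
  show "R \<noteq> {}" using \<open>in_decomposition x D R\<close> assms(2)
  proof (induction rule: in_decomposition.induct)
    case (first D)
    then show ?case using diag_of_border[of D x] by auto
  next
    case (later C D R)
    have "C \<subseteq> D" using component_subset[OF later.hyps(1)] by blast
    then have "finite C" using later.prems finite_subset by blast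
    then show ?case by (rule later.IH)
  qed
qed

lemma Min_uminus_image: "finite S \<Longrightarrow> S \<noteq> {} \<Longrightarrow> Min (uminus ` S) = - Max (S :: int set)"
  by (intro Min_eqI) auto

lemma Max_uminus_image: "finite S \<Longrightarrow> S \<noteq> {} \<Longrightarrow> Max (uminus ` S) = - Min (S :: int set)"
  by (intro Max_eqI) auto

text \<open>Reflection turns ends of ribbons into starts.\<close>

lemma end_of_ribbon:
  assumes D: "finite D" "order_convex D" "diagram_connected D" and q: "diag_count D q = Suc (diag_count D (q + 1))"
  shows "\<exists>R\<in>ribbon_decomposition SE D. Max (diag_of ` R) = q"
proof -
  have con: "diagram_connected (conj_diagram D)"
    using conj.connected_image[OF D(3)] by (simp add: conj_diagram_def)
  have fin: "finite (conj_diagram D)" using D(1) by (simp add: conj_diagram_def)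
  have "\<exists>R\<in>ribbon_decomposition SE (conj_diagram D). Min (diag_of ` R) = - q"
    by (rule start_of_ribbon[OF fin order_convex_conj[OF D(2)] con]) (use q in \<open>simp add: diag_count_conj add.commute\<close>)
  then obtain R where R: "R \<in> ribbon_decomposition SE D" "Min (diag_of ` conj_diagram R) = - q"
    using conj.ribbon_decomposition_image[of SE D] by (auto simp: conj_diagram_def)
  then have "Max (diag_of ` R) = q"
  proof -
    have "Min (uminus ` diag_of ` R) = - Max (diag_of ` R)"
      using in_ribbon_decomposition_finite[OF R(1) D(1)] by (intro Min_uminus_image) auto
    then show ?thesis using R(2) unfolding diag_of_conj_image by linarith
  qed
  then show ?thesis using R(1) by blast
qed

section \<open>Coefficients of skew Schur functions\<close>

text \<open>Bounding the entries by \<open>K\<close> keeps all sums finite; a coefficient with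
  finite support is seen for \<open>K\<close> large enough.\<close>

definition le_set :: "nat \<Rightarrow> nat \<Rightarrow> nat set" where
  "le_set K b = {a \<in> {1..K}. a \<le> b}"

definition less_set :: "nat \<Rightarrow> nat \<Rightarrow> nat set" where
  "less_set K b = {a \<in> {1..K}. a < b}"

lemma transfer_le: "transfer {1..K} (le_set K)"
  by unfold_locales (auto simp: le_set_def)

lemma transfer_less: "transfer {1..K} (less_set K)"
  by unfold_locales (auto simp: less_set_def)

definition schur_gen :: "nat \<Rightarrow> (nat \<Rightarrow> 'a :: comm_ring_1) \<Rightarrow> cell set \<Rightarrow> 'a" where
  "schur_gen K x D = transfer.gen {1..K} (le_set K) x D"

definition conj_gen :: "nat \<Rightarrow> (nat \<Rightarrow> 'a :: comm_ring_1) \<Rightarrow> cell set \<Rightarrow> 'a" where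
  "conj_gen K x D = transfer.gen {1..K} (less_set K) x D"

lemmas schur_gen_eq = schur_gen_def transfer.gen_def[OF transfer_le]
lemmas conj_gen_eq = conj_gen_def transfer.gen_def[OF transfer_less]

text \<open>A common bijection: \<open>h\<close> moves the cells and the involution \<rho> relabels
  the entries. The reflection takes \<rho> to be the identity, the half turn the reversal of the
  alphabet.\<close>

lemma sum_fillings_image:
  fixes x :: "nat \<Rightarrow> 'a :: comm_ring_1" and h g :: "cell \<Rightarrow> cell"
  assumes inv: "\<And>c. g (h c) = c" and \<rho>: "\<And>a. a \<in> A \<Longrightarrow> \<rho> a \<in> A \<and> \<rho> (\<rho> a) = a"
    and \<Phi>: "\<And>T. T \<in> h ` D \<rightarrow> A \<Longrightarrow> \<Phi>' T \<longleftrightarrow> \<Phi> (\<lambda>c\<in>D. \<rho> (T (h c)))"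
  shows "(\<Sum>T\<in>{T \<in> h ` D \<rightarrow>\<^sub>E A. \<Phi>' T}. \<Prod>c\<in>h ` D. x (T c)) =
    (\<Sum>T\<in>{T \<in> D \<rightarrow>\<^sub>E A. \<Phi> T}. \<Prod>c\<in>D. x (\<rho> (T c)))"
proof (rule sum.reindex_bij_witness[where i = "\<lambda>T. \<lambda>c\<in>h ` D. \<rho> (T (g c))" and j = "\<lambda>T. \<lambda>c\<in>D. \<rho> (T (h c))"])
  have inj: "inj_on h D" using inv by (metis inj_onI)
  fix T assume T: "T \<in> {T \<in> h ` D \<rightarrow>\<^sub>E A. \<Phi>' T}"
  have TA: "T (h c) \<in> A" if "c \<in> D" for c using T that by auto
  show "(\<lambda>c\<in>h ` D. \<rho> ((\<lambda>c\<in>D. \<rho> (T (h c))) (g c))) = T"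
  proof
    fix c show "(\<lambda>c\<in>h ` D. \<rho> ((\<lambda>c\<in>D. \<rho> (T (h c))) (g c))) c = T c"
    proof (cases "c \<in> h ` D")
      case True then show ?thesis using inv \<rho> TA by auto
    next
      case False
      then have "T c = undefined" using T PiE_arb by fast
      then show ?thesis using False by simp
    qed
  qed
  show "(\<lambda>c\<in>D. \<rho> (T (h c))) \<in> {T \<in> D \<rightarrow>\<^sub>E A. \<Phi> T}"
    using T \<Phi>[of T] TA \<rho> by (auto simp: PiE_def)
  have "(\<Prod>c\<in>D. x (\<rho> ((\<lambda>c\<in>D. \<rho> (T (h c))) c))) = (\<Prod>c\<in>D. x (T (h c)))"
    using TA \<rho> by (intro prod.cong) auto
  also have "\<dots> = (\<Prod>c\<in>h ` D. x (T c))" by (simp add: prod.reindex[OF inj])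
  finally show "(\<Prod>c\<in>D. x (\<rho> ((\<lambda>c\<in>D. \<rho> (T (h c))) c))) = (\<Prod>c\<in>h ` D. x (T c))" .
next
  fix T assume T: "T \<in> {T \<in> D \<rightarrow>\<^sub>E A. \<Phi> T}"
  have TA: "T c \<in> A" if "c \<in> D" for c using T that by auto
  show eq: "(\<lambda>c\<in>D. \<rho> ((\<lambda>c\<in>h ` D. \<rho> (T (g c))) (h c))) = T"
  proof
    fix c show "(\<lambda>c\<in>D. \<rho> ((\<lambda>c\<in>h ` D. \<rho> (T (g c))) (h c))) c = T c"
    proof (cases "c \<in> D")
      case True then show ?thesis using inv \<rho> TA by auto
    next
      case False
      then have "T c = undefined" using T PiE_arb by fast
      then show ?thesis using False by simp
    qed
  qed
  have "(\<lambda>c\<in>h ` D. \<rho> (T (g c))) \<in> h ` D \<rightarrow>\<^sub>E A" using inv TA \<rho> by auto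
  moreover from this have "\<Phi>' (\<lambda>c\<in>h ` D. \<rho> (T (g c)))" using \<Phi>[of "\<lambda>c\<in>h ` D. \<rho> (T (g c))"] T eq by (auto simp: PiE_def)
  ultimately show "(\<lambda>c\<in>h ` D. \<rho> (T (g c))) \<in> {T \<in> h ` D \<rightarrow>\<^sub>E A. \<Phi>' T}" by simp
qed

lemma fits_all_iff:
  "(\<forall>c\<in>D. fits L D T c) \<longleftrightarrow>
    (\<forall>i j. (i, j) \<in> D \<longrightarrow> (i, j + 1) \<in> D \<longrightarrow> T (i, j) \<in> L (T (i, j + 1))) \<and>
    (\<forall>i j. (i, j) \<in> D \<longrightarrow> (i + 1, j) \<in> D \<longrightarrow> T (i + 1, j) \<notin> L (T (i, j)))"
proof
  assume H: "\<forall>c\<in>D. fits L D T c"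
  then show "(\<forall>i j. (i, j) \<in> D \<longrightarrow> (i, j + 1) \<in> D \<longrightarrow> T (i, j) \<in> L (T (i, j + 1))) \<and>
      (\<forall>i j. (i, j) \<in> D \<longrightarrow> (i + 1, j) \<in> D \<longrightarrow> T (i + 1, j) \<notin> L (T (i, j)))"
    by (fastforce simp: fits_def)
next
  assume H: "(\<forall>i j. (i, j) \<in> D \<longrightarrow> (i, j + 1) \<in> D \<longrightarrow> T (i, j) \<in> L (T (i, j + 1))) \<and>
      (\<forall>i j. (i, j) \<in> D \<longrightarrow> (i + 1, j) \<in> D \<longrightarrow> T (i + 1, j) \<notin> L (T (i, j)))"
  show "\<forall>c\<in>D. fits L D T c"
  proof
    fix c assume "c \<in> D"
    obtain i j where c: "c = (i, j)" by fastforce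
    then show "fits L D T c" unfolding fits_def
      using H[THEN conjunct1, rule_format, of i "j - 1"] H[THEN conjunct2, rule_format, of i j] \<open>c \<in> D\<close> by simp
  qed
qed

text \<open>With the strict sets rows increase strictly and columns weakly, which reflection turns
  into the column-strict condition.\<close>

lemma conj_gen_eq_schur_gen: "conj_gen K x D = schur_gen K x (conj_diagram D)"
proof -
  have "schur_gen K x (conj_diagram D) = (\<Sum>T\<in>{T \<in> D \<rightarrow>\<^sub>E {1..K}. \<forall>c\<in>D. fits (less_set K) D T c}. \<Prod>c\<in>D. x (id (T c)))"
    unfolding schur_gen_eq conj_diagram_def
  proof (rule sum_fillings_image[where g = prod.swap])
    fix T assume T: "T \<in> prod.swap ` D \<rightarrow> {1..K}"
    have TA: "T (j, i) \<in> {1..K}" if "(i, j) \<in> D" for i j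
      using T imageI[OF that, of prod.swap] by auto
    show "(\<forall>c\<in>prod.swap ` D. fits (le_set K) (prod.swap ` D) T c) \<longleftrightarrow>
        (\<forall>c\<in>D. fits (less_set K) D (\<lambda>c\<in>D. id (T (prod.swap c))) c)"
      unfolding fits_all_iff swap_in_image le_set_def less_set_def using TA
      by (auto simp: not_le not_less)
  qed auto
  then show ?thesis unfolding conj_gen_eq by simp
qed

text \<open>A half turn reverses both orders, which is compensated by reversing the alphabet. The
  variables are permuted accordingly, without appeal to the symmetry of Schur functions.\<close>

lemma schur_gen_uminus: "schur_gen K x (uminus ` D) = schur_gen K (\<lambda>i. x (K + 1 - i)) D"
  unfolding schur_gen_eq
proof (rule sum_fillings_image[where g = uminus])
  fix T assume T: "T \<in> uminus ` D \<rightarrow> {1..K}"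
  have TA: "T (- i, - j) \<in> {1..K}" if "(i, j) \<in> D" for i j
    using T imageI[OF that, of uminus] by auto
  have rev: "K + 1 - a \<in> {1..K}" "K + 1 - a \<le> K + 1 - b \<longleftrightarrow> b \<le> a" if "a \<in> {1..K}" "b \<in> {1..K}" for a b
    using that by auto
  have "(\<forall>c\<in>uminus ` D. fits (le_set K) (uminus ` D) T c) \<longleftrightarrow>
      (\<forall>i j. (i, j) \<in> D \<longrightarrow> (i, j + 1) \<in> D \<longrightarrow> T (- i, - j - 1) \<le> T (- i, - j)) \<and>
      (\<forall>i j. (i, j) \<in> D \<longrightarrow> (i + 1, j) \<in> D \<longrightarrow> T (- i - 1, - j) < T (- i, - j))"
    (is "?L \<longleftrightarrow> ?R1 \<and> ?R2")
  proof -
    have "?L \<longleftrightarrow> (\<forall>i j. (- i, - j) \<in> D \<longrightarrow> (- i, - j - 1) \<in> D \<longrightarrow> T (i, j) \<le> T (i, j + 1)) \<and>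
      (\<forall>i j. (- i, - j) \<in> D \<longrightarrow> (- i - 1, - j) \<in> D \<longrightarrow> T (i, j) < T (i + 1, j))"
    proof -
      have "T (i, j) \<in> {1..K}" if "(- i, - j) \<in> D" for i j using TA[OF that] by simp
      then show ?thesis unfolding fits_all_iff in_uminus_image le_set_def by (fastforce simp: not_le)
    qed
    also have "\<dots> \<longleftrightarrow> ?R1 \<and> ?R2"
    proof (intro conj_cong iffI allI impI)
      fix i j
      assume H: "\<forall>i j. (- i, - j) \<in> D \<longrightarrow> (- i, - j - 1) \<in> D \<longrightarrow> T (i, j) \<le> T (i, j + 1)" "(i, j) \<in> D" "(i, j + 1) \<in> D"
      then show "T (- i, - j - 1) \<le> T (- i, - j)" using H(1)[rule_format, of "- i" "- j - 1"] by (simp add: add.commute)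
    next
      fix i j
      assume H: "?R1" "(- i, - j) \<in> D" "(- i, - j - 1) \<in> D"
      then show "T (i, j) \<le> T (i, j + 1)" using H(1)[rule_format, of "- i" "- j - 1"] by (simp add: add.commute)
    next
      fix i j
      assume H: "\<forall>i j. (- i, - j) \<in> D \<longrightarrow> (- i - 1, - j) \<in> D \<longrightarrow> T (i, j) < T (i + 1, j)" "(i, j) \<in> D" "(i + 1, j) \<in> D"
      then show "T (- i - 1, - j) < T (- i, - j)" using H(1)[rule_format, of "- i - 1" "- j"] by (simp add: add.commute)
    next
      fix i j
      assume H: "?R2" "(- i, - j) \<in> D" "(- i - 1, - j) \<in> D"
      then show "T (i, j) < T (i + 1, j)" using H(1)[rule_format, of "- i - 1" "- j"] by (simp add: add.commute)
    qed
    finally show ?thesis .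
  qed
  also have "\<dots> \<longleftrightarrow> (\<forall>c\<in>D. fits (le_set K) D (\<lambda>c\<in>D. K + 1 - T (- c)) c)"
  proof -
    let ?T = "\<lambda>c\<in>D. K + 1 - T (- c)"
    have "?T (i, j) \<in> le_set K (?T (i, j + 1)) \<longleftrightarrow> T (- i, - j - 1) \<le> T (- i, - j)"
      if "(i, j) \<in> D" "(i, j + 1) \<in> D" for i j
      using that TA[OF that(1)] TA[OF that(2)] by (auto simp: le_set_def)
    moreover have "?T (i + 1, j) \<notin> le_set K (?T (i, j)) \<longleftrightarrow> T (- i - 1, - j) < T (- i, - j)"
      if "(i, j) \<in> D" "(i + 1, j) \<in> D" for i j
      using that TA[OF that(1)] TA[OF that(2)] by (auto simp: le_set_def)
    ultimately show ?thesis unfolding fits_all_iff by blast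
  qed
  finally show "(\<forall>c\<in>uminus ` D. fits (le_set K) (uminus ` D) T c) \<longleftrightarrow>
      (\<forall>c\<in>D. fits (le_set K) D (\<lambda>c\<in>D. K + 1 - T (- c)) c)" .
qed auto

lemma conj_gen_uminus: "conj_gen K x (uminus ` D) = conj_gen K (\<lambda>i. x (K + 1 - i)) D"
proof -
  have "conj_diagram (uminus ` D) = uminus ` conj_diagram D"
    by (force simp: conj_diagram_def image_image)
  then show ?thesis by (simp add: conj_gen_eq_schur_gen schur_gen_uminus)
qed

text \<open>\<open>fits\<close> compares neighbours only; by convexity the cells between two cells
  of a row or column belong to the diagram, so the comparisons chain.\<close>

lemma column_strict_fillings_bounded:
  assumes "order_convex D"
  shows "T \<in> column_strict_fillings D \<and> T ` D \<subseteq> {1..K} \<longleftrightarrow>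
    T \<in> D \<rightarrow>\<^sub>E {1..K} \<and> (\<forall>c\<in>D. fits (le_set K) D T c)"
proof
  assume H: "T \<in> column_strict_fillings D \<and> T ` D \<subseteq> {1..K}"
  then have T: "T \<in> D \<rightarrow>\<^sub>E {1..K}" unfolding column_strict_fillings_def by fastforce
  have row: "T (i, j) \<le> T (i, j')" if "(i, j) \<in> D" "(i, j') \<in> D" "j < j'" for i j j'
    using H that unfolding column_strict_fillings_def by blast
  have col: "T (i, j) < T (i', j)" if "(i, j) \<in> D" "(i', j) \<in> D" "i < i'" for i i' j
    using H that unfolding column_strict_fillings_def by blast
  have "T (i, j) \<in> {1..K}" if "(i, j) \<in> D" for i j using T that by blast
  then show "T \<in> D \<rightarrow>\<^sub>E {1..K} \<and> (\<forall>c\<in>D. fits (le_set K) D T c)"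
    unfolding fits_all_iff le_set_def using T row col by (fastforce simp: not_le)
next
  assume H: "T \<in> D \<rightarrow>\<^sub>E {1..K} \<and> (\<forall>c\<in>D. fits (le_set K) D T c)"
  have TA: "T (i, j) \<in> {1..K}" if "(i, j) \<in> D" for i j using H that by blast
  have row1: "T (i, j) \<le> T (i, j + 1)" if "(i, j) \<in> D" "(i, j + 1) \<in> D" for i j
    using H that unfolding fits_all_iff le_set_def by blast
  have col1: "T (i, j) < T (i + 1, j)" if "(i, j) \<in> D" "(i + 1, j) \<in> D" for i j
    using H that TA[OF that(2)] unfolding fits_all_iff le_set_def by fastforce
  have row: "T (i, j) \<le> T (i, j + int n)" if "(i, j) \<in> D" "(i, j + int n) \<in> D" for i j n
    using that
  proof (induction n)
    case (Suc n)
    have "(i, j + int n) \<in> D"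
      using order_convexD[OF assms Suc.prems, of i "j + int n"] by simp
    then have "T (i, j) \<le> T (i, j + int n)" "T (i, j + int n) \<le> T (i, j + int (Suc n))"
      using Suc row1[of i "j + int n"] by (auto simp: add_ac)
    then show ?case by simp
  qed simp
  have col: "T (i, j) < T (i + 1 + int n, j)" if "(i, j) \<in> D" "(i + 1 + int n, j) \<in> D" for i j n
    using that
  proof (induction n)
    case 0 then show ?case using col1 by simp
  next
    case (Suc n)
    have "(i + 1 + int n, j) \<in> D"
      using order_convexD[OF assms Suc.prems, of "i + 1 + int n" j] by simp
    then have "T (i, j) < T (i + 1 + int n, j)" "T (i + 1 + int n, j) < T (i + 1 + int (Suc n), j)"
      using Suc col1[of "i + 1 + int n" j] by (auto simp: add_ac)
    then show ?case by simp
  qed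
  have "T (i, j) \<le> T (i, j')" if "(i, j) \<in> D" "(i, j') \<in> D" "j < j'" for i j j'
    using row[of i j "nat (j' - j)"] that by simp
  moreover have "T (i, j) < T (i', j)" if "(i, j) \<in> D" "(i', j) \<in> D" "i < i'" for i i' j
    using col[of i j "nat (i' - i - 1)"] that by simp
  moreover have "T \<in> D \<rightarrow>\<^sub>E {1..}"
    by (rule subsetD[OF PiE_mono H[THEN conjunct1]]) auto
  moreover have "T ` D \<subseteq> {1..K}" using H by blast
  ultimately show "T \<in> column_strict_fillings D \<and> T ` D \<subseteq> {1..K}"
    unfolding column_strict_fillings_def by blast
qed

text \<open>The variable with index i in a polynomial ring: the inner mappings are exponent vectors,
  the outer one assigns coefficients to them.\<close>

definition monomial_var :: "nat \<Rightarrow> (nat \<Rightarrow>\<^sub>0 nat) \<Rightarrow>\<^sub>0 int" where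
  "monomial_var i = Poly_Mapping.single (Poly_Mapping.single i 1) 1"

lemma prod_monomial_var:
  "finite D \<Longrightarrow> (\<Prod>c\<in>D. monomial_var (T c)) = Poly_Mapping.single (\<Sum>c\<in>D. Poly_Mapping.single (T c) 1) 1"
  by (induction D rule: finite_induct) (auto simp: monomial_var_def mult_single)

lemma lookup_content:
  assumes "finite D"
  shows "Poly_Mapping.lookup (\<Sum>c\<in>D. Poly_Mapping.single (T c) (1 :: nat)) i = card {c \<in> D. T c = i}"
proof -
  have "Poly_Mapping.lookup (\<Sum>c\<in>D. Poly_Mapping.single (T c) (1 :: nat)) i = (\<Sum>c\<in>D. if T c = i then 1 else 0)"
    unfolding lookup_sum by (intro sum.cong) (auto simp: lookup_single)
  also have "\<dots> = card {c \<in> D. T c = i}" using assms by (simp add: sum.If_cases Int_def)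
  finally show ?thesis .
qed

text \<open>A filling of content \<open>w\<close> uses only entries up to \<open>K\<close>, so no
  filling is lost by the bound.\<close>

lemma skew_schur_eq_coefficient:
  assumes fin: "finite D" and cvx: "order_convex D" and w: "\<And>i. K < i \<Longrightarrow> w i = 0"
  shows "int (skew_schur D w) = Poly_Mapping.lookup (schur_gen K monomial_var D) (Abs_poly_mapping w)"
proof -
  let ?F = "{T \<in> D \<rightarrow>\<^sub>E {1..K}. \<forall>c\<in>D. fits (le_set K) D T c}"
  have "{i. w i \<noteq> 0} \<subseteq> {..K}" using w by (auto simp: not_less[symmetric])
  then have "finite {i. w i \<noteq> 0}" using finite_subset by blast
  then have lw: "Poly_Mapping.lookup (Abs_poly_mapping w) = w" by (simp add: lookup_Abs_poly_mapping)
  have finF: "finite ?F"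
    by (rule finite_subset[OF _ finite_PiE[of D "\<lambda>_. {1..K}"]]) (use fin in auto)
  have cont: "(\<Sum>c\<in>D. Poly_Mapping.single (T c) 1) = Abs_poly_mapping w \<longleftrightarrow> (\<forall>i. card {c \<in> D. T c = i} = w i)" for T
    unfolding poly_mapping_eq_iff lw fun_eq_iff lookup_content[OF fin] ..
  have "{T \<in> column_strict_fillings D. \<forall>i. card {c \<in> D. T c = i} = w i} = {T \<in> ?F. \<forall>i. card {c \<in> D. T c = i} = w i}"
  proof -
    have "T ` D \<subseteq> {1..K}" if T: "T \<in> column_strict_fillings D" "\<forall>i. card {c \<in> D. T c = i} = w i" for T
    proof
      fix i assume "i \<in> T ` D"
      then obtain c where c: "c \<in> D" "T c = i" by blast
      then have "c \<in> {c \<in> D. T c = i}" by simp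
      moreover have "finite {c \<in> D. T c = i}" using fin by simp
      ultimately have "card {c \<in> D. T c = i} \<noteq> 0" unfolding card_eq_0_iff by blast
      then have "i \<le> K" using T(2) w[of i] by (metis not_less)
      moreover have "1 \<le> i" using T(1) c unfolding column_strict_fillings_def by fastforce
      ultimately show "i \<in> {1..K}" by simp
    qed
    then show ?thesis using column_strict_fillings_bounded[OF cvx, of _ K] by blast
  qed
  then have "int (skew_schur D w) = int (card {T \<in> ?F. \<forall>i. card {c \<in> D. T c = i} = w i})"
    by (simp add: skew_schur_def)
  also have "\<dots> = (\<Sum>T\<in>?F. if \<forall>i. card {c \<in> D. T c = i} = w i then 1 else 0)"
    using finF by (simp add: sum.If_cases Int_def)
  also have "\<dots> = (\<Sum>T\<in>?F. Poly_Mapping.lookup (\<Prod>c\<in>D. monomial_var (T c)) (Abs_poly_mapping w))"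
    unfolding prod_monomial_var[OF fin] lookup_single cont[symmetric] by (intro sum.cong) (auto simp: when_def)
  also have "\<dots> = Poly_Mapping.lookup (schur_gen K monomial_var D) (Abs_poly_mapping w)"
    unfolding schur_gen_eq lookup_sum ..
  finally show ?thesis .
qed

lemma skew_equiv_conj:
  assumes fin: "finite D" and cvx: "order_convex D"
    and gen: "\<And>K. schur_gen K monomial_var D = conj_gen K monomial_var D"
  shows "skew_equiv (conj_diagram D) D"
  unfolding skew_equiv_def
proof
  fix w
  have fin': "finite (conj_diagram D)" using fin by (simp add: conj_diagram_def)
  show "skew_schur (conj_diagram D) w = skew_schur D w"
  proof (cases "finite {i. w i \<noteq> 0}")
    case True
    then obtain K where K: "{i. w i \<noteq> 0} \<subseteq> {..K}" using finite_nat_iff_bounded_le by blast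
    then have w: "w i = 0" if "K < i" for i using that by (metis (mono_tags) atMost_iff mem_Collect_eq not_less subsetD)
    have "int (skew_schur (conj_diagram D) w) = int (skew_schur D w)"
      using skew_schur_eq_coefficient[OF fin cvx, of K w] skew_schur_eq_coefficient[OF fin' order_convex_conj[OF cvx], of K w]
        w gen[of K] conj_gen_eq_schur_gen[of K monomial_var D] by simp
    then show ?thesis by simp
  next
    case False
    \<comment> \<open>A finite diagram has no filling using infinitely many values, so both
      coefficients vanish.\<close>
    have "skew_schur E w = 0" if "finite E" for E
    proof -
      have "\<not> (\<forall>i. card {c \<in> E. T c = i} = w i)" for T
      proof
        assume H: "\<forall>i. card {c \<in> E. T c = i} = w i"
        have "i \<in> T ` E" if "w i \<noteq> 0" for i
        proof -
          have "{c \<in> E. T c = i} \<noteq> {}" using H that by (metis card.empty)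
          then show ?thesis by blast
        qed
        then have "{i. w i \<noteq> 0} \<subseteq> T ` E" by blast
        then show False using False \<open>finite E\<close> finite_subset by blast
      qed
      then have "{T \<in> column_strict_fillings E. \<forall>i. card {c \<in> E. T c = i} = w i} = {}" by blast
      then show ?thesis unfolding skew_schur_def by (simp only: card.empty)
    qed
    then show ?thesis using fin fin' by simp
  qed
qed

section \<open>Self-conjugate segments and skew equivalence\<close>

lemma schur_gen_strip_self_conj:
  assumes "conj_word v = v" shows "schur_gen K x (strip e v) = conj_gen K x (strip e v)"
  unfolding conj_gen_eq_schur_gen conj_diagram_strip assms schur_gen_def transfer.gen_strip[OF transfer_le] ..

lemma gen_eq_if_self_conj_segments:
  assumes D: "finite D" "order_convex D" "diagram_connected D" "D \<noteq> {}"
    and seg: "\<And>R R'. R \<in> ribbon_decomposition SE D \<Longrightarrow> R' \<in> ribbon_decomposition SE D \<Longrightarrow>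
      Min (diag_of ` R) \<le> Max (diag_of ` R') \<Longrightarrow>
      \<exists>e v. conj_word v = v \<and>
        segment SE D (Min (diag_of ` R)) (Max (diag_of ` R')) = strip e v"
  shows "schur_gen K x D = conj_gen K x D"
  unfolding schur_gen_def conj_gen_def
proof (rule gen_eq_if_segments_eq[OF transfer_le transfer_less D])
  fix p q assume H: "p \<le> q" "diag_count D p = Suc (diag_count D (p - 1))" "diag_count D q = Suc (diag_count D (q + 1))"
  obtain R R' where R: "R \<in> ribbon_decomposition SE D" "Min (diag_of ` R) = p"
    "R' \<in> ribbon_decomposition SE D" "Max (diag_of ` R') = q"
    using start_of_ribbon[OF D(1-3) H(2)] end_of_ribbon[OF D(1-3) H(3)] by blast
  have "\<exists>e v. conj_word v = v \<and> segment SE D p q = strip e v"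
    using seg[OF R(1,3)] H(1) unfolding R(2,4) by (simp only:)
  then obtain e v where "conj_word v = v" "segment SE D p q = strip e v"
    by (elim exE conjE)
  then show "transfer.gen {1..K} (le_set K) x (segment SE D p q) =
      transfer.gen {1..K} (less_set K) x (segment SE D p q)"
    using schur_gen_strip_self_conj[of v K x e] by (simp only: schur_gen_def conj_gen_def)
qed

lemma strip_segment:
  assumes "a \<le> b" "b \<le> length u"
  shows "{x \<in> strip c u. diag_of c + int a \<le> diag_of x \<and> diag_of x \<le> diag_of c + int b} =
    strip (strip_end c (take a u)) (drop a (take b u))"
proof -
  have idx: "{n. n \<le> length u \<and> diag_of c + int a \<le> diag_of (strip_end c (take n u)) \<and>
      diag_of (strip_end c (take n u)) \<le> diag_of c + int b} = (\<lambda>i. a + i) ` {..b - a}"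
  proof (intro subset_antisym subsetI)
    fix n assume "n \<in> {n. n \<le> length u \<and> diag_of c + int a \<le> diag_of (strip_end c (take n u)) \<and>
      diag_of (strip_end c (take n u)) \<le> diag_of c + int b}"
    then have "a \<le> n" "n \<le> b" by auto
    then show "n \<in> (\<lambda>i. a + i) ` {..b - a}" by (intro image_eqI[of _ _ "n - a"]) auto
  qed (use assms in auto)
  have el: "strip_end c (take (a + i) u) = strip_end (strip_end c (take a u)) (take i (drop a (take b u)))"
    if "i \<le> b - a" for i
  proof -
    have "take i (drop a (take b u)) = take i (drop a u)" using that by (simp add: drop_take min_absorb1)
    then show ?thesis by (simp add: take_add)
  qed
  have len: "length (drop a (take b u)) = b - a" using assms by simp
  show ?thesis
    unfolding strip_filter idx image_image strip_conv[of "strip_end c (take a u)"] len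
    using el by (intro image_cong) auto
qed

lemma uminus_strip: "\<exists>e. uminus ` strip c u = strip e (rev u)"
proof -
  have "uminus ` strip c u = strip (- strip_end c u) (rev u)"
  proof (induction u rule: rev_induct)
    case (snoc b u)
    have "move b (- move b (strip_end c u)) = - strip_end c u"
      by (cases "strip_end c u") (simp add: move_def)
    then show ?case by (simp add: strip_snoc snoc)
  qed simp
  then show ?thesis by blast
qed

context overlap begin

text \<open>Ribbons start at multiples of \<open>length z\<close> after the start of the border and
  end at \<open>length w\<close> plus a positive multiple, the situation of
  \<open>conj_segment\<close>.\<close>

lemma segment_self_conj:
  assumes self: "conj_word u = u" and dec: "staircase_decomposition x D m (strip c u) k N"
    and R: "R \<in> ribbon_decomposition x D" and R': "R' \<in> ribbon_decomposition x D"
    and le: "Min (diag_of ` R) \<le> Max (diag_of ` R')"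
  shows "\<exists>e v. conj_word v = v \<and>
    segment x D (Min (diag_of ` R)) (Max (diag_of ` R')) = strip e v"
proof -
  let ?s = "int (length z)"
  obtain \<theta> where k: "1 \<le> k" and T: "border_ribbon x D = strip \<theta> (w @ repeat k z)"
    and B: "\<And>R. R \<in> ribbon_decomposition x D - {border_ribbon x D} \<Longrightarrow>
      \<exists>i l. 1 \<le> i \<and> i + l < k \<and> block (diag_of \<theta>) R i l"
    and "N = nesting_word (blocks x D (diag_of \<theta>)) k"
    using dec unfolding staircase_decomposition_iff by blast
  have range: "\<exists>i l. diag_of ` S = {diag_of \<theta> + int i * ?s..diag_of \<theta> + int i * ?s + int (length w) + int l * ?s} \<and>
      1 \<le> i + l \<and> i + l \<le> k" if S: "S \<in> ribbon_decomposition x D" for S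
  proof (cases "S = border_ribbon x D")
    case True
    then have "block (diag_of \<theta>) S 0 k" unfolding block_def T by (intro exI[of _ \<theta>]) simp
    then show ?thesis using block_diags k by (metis add_0 order_refl)
  next
    case False
    then obtain i l where "1 \<le> i" "i + l < k" "block (diag_of \<theta>) S i l" using B S by blast
    then show ?thesis using block_diags by (metis less_imp_le_nat trans_le_add1)
  qed
  obtain a l where R: "diag_of ` R = {diag_of \<theta> + int a * ?s..diag_of \<theta> + int a * ?s + int (length w) + int l * ?s}"
    using range[OF R] by blast
  obtain i l' where R': "diag_of ` R' = {diag_of \<theta> + int i * ?s..diag_of \<theta> + int i * ?s + int (length w) + int l' * ?s}"
    and il: "1 \<le> i + l'" "i + l' \<le> k"
    using range[OF R'] by blast
  \<comment> \<open>For a slash l' = 0, but then i \<ge> 1, so every end lies at least one period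
    after the first copy of \<open>w\<close>.\<close>
  obtain b where b: "i + l' = Suc b" using il(1) by (cases "i + l'") auto
  have "Min (diag_of ` R) = diag_of \<theta> + int a * ?s"
    unfolding R by (intro Min_eqI) auto
  then have p: "Min (diag_of ` R) = diag_of \<theta> + int (a * length z)" by simp
  have "Max (diag_of ` R') = diag_of \<theta> + int i * ?s + int (length w) + int l' * ?s"
    unfolding R' by (intro Max_eqI) auto
  also have "\<dots> = diag_of \<theta> + int (length w + (i + l') * length z)" by (simp add: algebra_simps)
  finally have q: "Max (diag_of ` R') = diag_of \<theta> + int (length w + Suc b * length z)" unfolding b .
  have ab: "a * length z \<le> length w + Suc b * length z" using le unfolding p q by linarith
  have bk: "b < k" using il b by simp
  then have "Suc b * length z \<le> k * length z" by (intro mult_le_mono1) simp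
  then have "length w + Suc b * length z \<le> length (w @ repeat k z)" by simp
  then show ?thesis
    unfolding T p q using strip_segment[OF ab] conj_segment[OF self bk ab] by blast
qed

end

lemma skew_equiv_conj_if_self_conj:
  assumes D: "finite D" "order_convex D" "diagram_connected D"
    and ov: "overlap m u w y z" and self: "conj_word u = u"
    and dec: "staircase_decomposition x D m (strip c u) k N"
  shows "skew_equiv (conj_diagram D) D"
proof (rule skew_equiv_conj[OF D(1,2)])
  interpret overlap m u w y z by (rule ov)
  obtain \<theta> where "border_ribbon x D = strip \<theta> (w @ repeat k z)"
    using dec unfolding staircase_decomposition_iff by blast
  then have ne: "D \<noteq> {}" using border_ribbon_subset[of x D] start_in_strip by blast
  note seg = segment_self_conj[OF self dec]
  fix K
  show "schur_gen K monomial_var D = conj_gen K monomial_var D"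
  proof (cases x)
    case SE
    then show ?thesis using gen_eq_if_self_conj_segments[OF D ne] seg by blast
  next
    case NW
    let ?D = "uminus ` D"
    have DD: "uminus ` ?D = D" by (rule rot.image_involution)
    have bor: "border_ribbon SE ?D = uminus ` border_ribbon NW D" using rot.border[of NW D] by simp
    have RD: "ribbon_decomposition SE ?D = (`) uminus ` ribbon_decomposition NW D"
      using rot.ribbon_decomposition_image[of NW D] by simp
    \<comment> \<open>Stated for arbitrary \<open>x\<close>, because turning back to
      \<open>D\<close> reverses the order of the variables.\<close>
    have "schur_gen K x ?D = conj_gen K x ?D" for x :: "nat \<Rightarrow> (nat \<Rightarrow>\<^sub>0 nat) \<Rightarrow>\<^sub>0 int"
    proof (rule gen_eq_if_self_conj_segments)
      show "finite ?D" "order_convex ?D" "diagram_connected ?D" "?D \<noteq> {}"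
        using D ne order_convex_uminus rot.connected_image by auto
      fix S S' assume S: "S \<in> ribbon_decomposition SE ?D" "S' \<in> ribbon_decomposition SE ?D"
        "Min (diag_of ` S) \<le> Max (diag_of ` S')"
      obtain R where R: "R \<in> ribbon_decomposition NW D" "S = uminus ` R" using S(1) unfolding RD by blast
      obtain R' where R': "R' \<in> ribbon_decomposition NW D" "S' = uminus ` R'" using S(2) unfolding RD by blast
      have du: "diag_of (- c) = - diag_of c" for c by (simp add: diag_of_def)
      have img: "diag_of ` uminus ` E = uminus ` diag_of ` E" for E by (simp add: image_image du)
      have min: "Min (diag_of ` S) = - Max (diag_of ` R)"
        unfolding R(2) img using in_ribbon_decomposition_finite[OF R(1) D(1)] by (intro Min_uminus_image) auto
      have max: "Max (diag_of ` S') = - Min (diag_of ` R')"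
        unfolding R'(2) img using in_ribbon_decomposition_finite[OF R'(1) D(1)] by (intro Max_uminus_image) auto
      have "Min (diag_of ` R') \<le> Max (diag_of ` R)" using S(3) unfolding min max by simp
      then obtain e v where ev: "conj_word v = v"
        "segment NW D (Min (diag_of ` R')) (Max (diag_of ` R)) = strip e v"
        using seg NW R(1) R'(1) by blast
      have "segment SE ?D (Min (diag_of ` S)) (Max (diag_of ` S')) =
          uminus ` (segment NW D (Min (diag_of ` R')) (Max (diag_of ` R)))"
      proof -
        have "diag_of (- a, - b) = - diag_of (a, b)" for a b by (simp add: diag_of_def)
        then show ?thesis unfolding bor min max by (auto simp: du simp del: border_ribbon.simps)
      qed
      then obtain e' where "segment SE ?D (Min (diag_of ` S)) (Max (diag_of ` S')) =
          strip e' (rev v)" using ev(2) uminus_strip by metis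
      moreover have "conj_word (rev v) = rev v"
        using ev(1) unfolding conj_word_def by (metis rev_map)
      ultimately show "\<exists>e v. conj_word v = v \<and>
          segment SE ?D (Min (diag_of ` S)) (Max (diag_of ` S')) = strip e v"
        by blast
    qed
    then have "schur_gen K monomial_var (uminus ` ?D) = conj_gen K monomial_var (uminus ` ?D)"
      using schur_gen_uminus[of K monomial_var ?D] conj_gen_uminus[of K monomial_var ?D] by simp
    then show ?thesis unfolding DD .
  qed
qed

theorem corollary7p31:
  fixes D \<alpha> :: "cell set" and m k :: nat and N :: "nesting_letter list" and x :: side
  assumes "skew_diagram D" and "diagram_connected D"
    and "staircase_decomposition x D m \<alpha> k N"
  shows "let m' = card (m_cap m \<alpha> \<alpha>) - (m - 1) in
    (\<not> degenerate_ends m k \<alpha> \<longrightarrow>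
       staircase_decomposition x (conj_diagram D) m' (conj_diagram \<alpha>) k (reverse_nesting N)) \<and>
    (same_shape \<alpha> (conj_diagram \<alpha>) \<longrightarrow> m' = m \<and> skew_equiv (conj_diagram D) D)"
proof -
  have D: "finite D" "order_convex D" using assms(1) by (auto simp: skew_diagram_iff)
  obtain c u where \<alpha>: "\<alpha> = strip c u"
    using assms(3) by (auto simp: staircase_decomposition_def is_ribbon_iff)
  have "\<exists>\<omega>. is_m_cap m \<alpha> \<alpha> \<omega>" and rows: "m < num_rows (strip c u)"
    using assms(3) unfolding staircase_decomposition_def m_cap_nontrivial_def \<alpha> by blast+
  then obtain w where cap: "cap_word m u u w" unfolding \<alpha> is_m_cap_strip by blast
  obtain y z where ov: "overlap m u w y z" using overlapI[OF cap rows] by blast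
  interpret overlap m u w y z by (rule ov)
  obtain e where "m_cap m \<alpha> \<alpha> = strip e w" unfolding \<alpha> using m_cap_strip[OF cap] by blast
  \<comment> \<open>Of the length w + 1 cells, subtracting the m - 1 up steps leaves one more than
    the number of right steps.\<close>
  then have m': "card (m_cap m \<alpha> \<alpha>) - (m - 1) = Suc (count_list w True)"
    using count_eq count_list_bool[of w] by simp
  have conj_\<alpha>: "conj_diagram \<alpha> = strip (prod.swap (strip_end c u)) (conj_word u)"
    by (simp add: \<alpha> conj_diagram_strip)
  have "staircase_decomposition x (conj_diagram D) (Suc (count_list w True)) (conj_diagram \<alpha>) k (reverse_nesting N)"
    if "\<not> degenerate_ends m k \<alpha>"
    using conj_decomposition[OF D ov] assms(3) that unfolding \<alpha> conj_\<alpha>[unfolded \<alpha>] by blast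
  moreover have "Suc (count_list w True) = m \<and> skew_equiv (conj_diagram D) D"
    if "same_shape \<alpha> (conj_diagram \<alpha>)"
  proof -
    have self: "conj_word u = u" using that unfolding conj_\<alpha> unfolding \<alpha> by simp
    \<comment> \<open>Conjugating \<open>u = w z\<close> yields a factorisation of \<open>u\<close>
      with suffix \<open>conj_word w\<close>, while \<open>u = y w\<close> has the suffix
      \<open>w\<close> of equal length.\<close>
    then have "conj_word w = w"
      using left right by (metis append_eq_append_conv conj_word_append length_conj_word)
    then have "count_list w True = count_list w False" by (metis count_list_conj_word not_True_eq_False)
    then show ?thesis
      using count_eq skew_equiv_conj_if_self_conj[OF D assms(2) ov self] assms(3) \<alpha> by simp
  qed
  ultimately show ?thesis unfolding Let_def m' by blast
qed

end
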